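(* Let $c>0$ be a fixed real number. For $\eta>0$ and an integer $N\ge 2$, let $E_{c,\eta}(N)$ be the set of integers $2\le n\le N$ such that either $f_c(n)=\infty$, or $f_c(n)<\infty$ and $$\left|\frac{f_c(n)}{\log n}-\frac{c}{1-\gamma}\right|>\eta .$$ Then, for every $\eta>0$, $$\lim_{N\to\infty}\frac{\#E_{c,\eta}(N)}{N}=0 .$$ Equivalently, $f_c(n)=\left(\frac{c}{1-\gamma}+o(1)\right)\log n$ for almost all positive integers $n$ (in the sense of natural density).
   Context: All logarithms are natural, and $\gamma$ is the Euler–Mascheroni constant. For a prime $p$, $\nu_p$ denotes the $p$-adic valuation. For integers $0\le k\le n$ define $u(n,k):=\prod_{p\le k}p^{\nu_p\binom nk}$ (product over primes $p\le k$), i.e. the largest divisor of $\binom nk$ all of whose prime factors are at most $k$; in particular $u(n,0)=u(n,1)=1$. For real $c>0$ define $f_c(n):=\min\{0\le k\le n:\ u(n,k)>n^c\}$ ($k$ an integer), with $f_c(n)=\infty$ if this set is empty. *)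

theory Defs
  imports "HOL-Analysis.Analysis" "HOL-Computational_Algebra.Primes"
    "HOL-Library.Extended_Nat"
begin

definition u_binom :: "nat \<Rightarrow> nat \<Rightarrow> nat" where
  "u_binom n k = (\<Prod>p | prime p \<and> p \<le> k. p ^ multiplicity p (n choose k))"

definition f_min :: "real \<Rightarrow> nat \<Rightarrow> enat" where
  "f_min c n = (if \<exists>k\<le>n. real (u_binom n k) > real n powr c
            then enat (LEAST k. k \<le> n \<and> real (u_binom n k) > real n powr c)
            else \<infinity>)"

definition E_exc :: "real \<Rightarrow> real \<Rightarrow> nat \<Rightarrow> nat set" where
  "E_exc c \<eta> N = {n \<in> {2..N}. f_min c n = \<infinity> \<or>
     (f_min c n < \<infinity> \<and>
      \<bar>real (the_enat (f_min c n)) / ln (real n) - c / (1 - euler_mascheroni)\<bar> > \<eta>)}"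

(* P holds on a set of positive integers of natural density 1 *)
definition almost_all_pos :: "(nat \<Rightarrow> bool) \<Rightarrow> bool" where
  "almost_all_pos P \<longleftrightarrow>
     (\<lambda>N. real (card {n \<in> {1..N}. P n}) / real N) \<longlonglongrightarrow> 1"

end

theory Submission
  imports Defs
    "HOL-Complex_Analysis.Complex_Analysis"
    "HOL-Number_Theory.Number_Theory"
    "HOL-Number_Theory.Prime_Powers"
    "HOL-Computational_Algebra.Squarefree"
    "HOL-Library.Discrete_Functions"
    "HOL-Real_Asymp.Real_Asymp"
begin

text \<open>
  By Kummer's theorem, the logarithm of \<open>u(n,k)\<close> is the sum of \<open>ln p\<close> over all primes
  \<open>p \<le> k\<close> and all \<open>j \<ge> 1\<close> with \<open>n mod p^j < k mod p^j\<close>. For random \<open>n \<le> N\<close> and \<open>k\<close> of the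
  order of \<open>ln N\<close> the terms with \<open>j \<ge> 2\<close> contribute \<open>o(k)\<close> on average, and those with
  \<open>j = 1\<close> have mean \<open>\<Sum>p\<le>k. ln p * (k mod p) / p\<close> and are almost pairwise independent by
  the Chinese remainder theorem, so that Chebyshev's inequality applies. The mean is
  \<open>(1 - \<gamma>) k + o(k)\<close>, a statement of the strength of the prime number theorem. It is
  obtained by Axer's argument from \<open>\<psi>(x) = x + o(x)\<close>, which in turn comes from
  \<open>\<Sum>n\<le>x. \<mu>(n) / n = o(1)\<close>, proved by Newman's contour integration.

  Since \<open>f(n)\<close> is a first crossing, \<open>u(n,k) \<le> n^c\<close> is needed simultaneously for all
  \<open>k\<close> below the threshold \<open>K\<close>. A union bound over all these \<open>k\<close> is too expensive; instead
  the events \<open>n mod p < k mod p\<close> for \<open>k\<^sub>0 \<le> k < k\<^sub>0 + s\<close>, where \<open>s\<close> is about \<open>\<delta>\<^sup>2 K\<close>, are all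
  contained in \<open>n mod p < k\<^sub>0 mod p + s\<close>, which costs only \<open>O(\<delta> K)\<close> in the mean and leaves a
  bounded number of events.
\<close>


section \<open>The zeta function and the Moebius function\<close>

text \<open>The constant arises by giving all integers \<open>n\<close> weight 1 instead of the
  prime weights: the sum of \<open>(k mod n) / n\<close> over \<open>n\<close> up to
  \<open>k\<close> is k H_k minus the sum of \<open>k div n\<close>, hence k (ln k + gamma) - k (ln
  k + 2 gamma - 1) + O(sqrt k). Chebyshev or Mertens bounds cannot justify this exchange: (k mod p)
  / p is a sawtooth jumping at p = k / m, so the share of primes in each interval between k / (m +
  1) and k / m matters. The Moebius function suits the contour argument because its values are
  bounded and 1 / zeta has no pole at 1; all that is needed is that zeta has no zero on Re s = 1.
  u(n,k) is not monotone in k, so its value at the threshold does not control smaller k. For one k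
  of order ln N the second moment bounds the exceptional proportion only by about (ln K)^2 / K;
  summed over K values of k this no longer tends to 0, which forces the passage to a bounded grid.
  Thresholds are set by ln N instead of ln n. This is harmless, because the n below N^(1 - tau) have
  density 0.\<close>

definition zeta_term :: "complex \<Rightarrow> nat \<Rightarrow> complex" where
  "zeta_term s n = (s - 1) * of_nat (Suc n) powr (- s) - of_nat (Suc n) powr (1 - s) + of_nat (Suc (Suc n)) powr (1 - s)"

text \<open>
  \<open>zeta1 s = (s - 1) * \<zeta>(s)\<close>: the telescoping terms \<open>(n+2) powr (1-s) - (n+1) powr (1-s)\<close> turn the
  series for \<open>(s - 1) * \<zeta>(s)\<close> into one of entire functions that converges for \<open>Re s > 0\<close>.
\<close>
definition zeta1 :: "complex \<Rightarrow> complex" where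
  "zeta1 s = 1 + (\<Sum>n. zeta_term s n)"

text \<open>With \<open>m = n + 1\<close> the term is exactly the first-order Taylor remainder of
  \<open>x powr (1 - s)\<close> between \<open>m\<close> and \<open>m + 1\<close>, so the second
  derivative \<open>s * (s - 1) * x powr (- s - 1)\<close> bounds it.\<close>

lemma norm_zeta_term_le:
  assumes s: "Re s > 0"
  shows "norm (zeta_term s n) \<le> norm s * norm (s - 1) * real (Suc n) powr (- Re s - 1)"
proof -
  define m where "m = Suc n"
  have m: "m > 0" by (simp add: m_def)
  define f where "f = (\<lambda>(i::nat) x. (if i = 0 then x powr (1 - s) else if i = 1 then (1 - s) * x powr (-s)
     else s * (s - 1) * x powr (-s - 1)) :: complex)"
  let ?S = "closed_segment (of_nat m) (of_nat (Suc m)) :: complex set"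
  have S: "\<exists>r. x = of_real r \<and> r \<ge> real m" if "x \<in> ?S" for x
  proof -
    from that obtain u where u: "u \<ge> 0" "x = (1 - of_real u) * of_nat m + of_real u * of_nat (Suc m)"
      by (auto simp: closed_segment_def scaleR_conv_of_real)
    have "x = of_real (real m + u)" by (simp add: u algebra_simps)
    with u show ?thesis by (intro exI[of _ "real m + u"]) auto
  qed
  have "norm (f 0 (of_nat (Suc m)) - (\<Sum>i\<le>(1::nat). f i (of_nat m) * (of_nat (Suc m) - of_nat m :: complex) ^ i / (fact i)))
    \<le> norm s * norm (s - 1) * real m powr (- Re s - 1) * norm (of_nat (Suc m) - of_nat m :: complex) ^ (Suc 1) / fact 1"
  proof (rule complex_Taylor[of ?S])
    fix i :: nat and x assume x: "x \<in> ?S" and i: "i \<le> 1"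
    obtain r where r: "x = of_real r" "r \<ge> real m" using S[OF x] by auto
    have rp: "r > 0" using r m by simp
    have nn: "x \<notin> \<real>\<^sub>\<le>\<^sub>0" using r rp by auto
    consider "i = 0" | "i = 1" using i by linarith
    then have "(f i has_field_derivative f (Suc i) x) (at x)"
      using nn by cases (auto simp: f_def algebra_simps intro!: derivative_eq_intros)
    then show "(f i has_field_derivative f (Suc i) x) (at x within ?S)"
      by (rule has_field_derivative_at_within)
  next
    fix x assume x: "x \<in> ?S"
    obtain r where r: "x = of_real r" "r \<ge> real m" using S[OF x] by auto
    have rp: "r > 0" using r m by simp
    have "norm (f (Suc 1) x) = norm s * norm (s - 1) * r powr (- Re s - 1)"
      using r rp by (simp add: f_def norm_mult norm_powr_real_powr)
    also have "\<dots> \<le> norm s * norm (s - 1) * real m powr (- Re s - 1)"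
      using r m s by (intro mult_left_mono powr_mono2') auto
    finally show "norm (f (Suc 1) x) \<le> norm s * norm (s - 1) * real m powr (- Re s - 1)" .
  qed auto
  then show ?thesis
    by (simp add: f_def zeta_term_def m_def algebra_simps)
qed

lemma zeta_term_holomorphic: "(\<lambda>s. zeta_term s n) holomorphic_on A"
  unfolding zeta_term_def by (intro holomorphic_intros)

lemma zeta1_holomorphic: "zeta1 holomorphic_on {s. Re s > 0}"
proof (rule holomorphic_uniform_sequence[where f = "\<lambda>N s. 1 + (\<Sum>n<N. zeta_term s n)"])
  show "open {s. Re s > 0}" by (simp add: open_halfspace_Re_gt)
  show "(\<lambda>s. 1 + (\<Sum>n<N. zeta_term s n)) holomorphic_on {s. Re s > 0}" for N
    by (intro holomorphic_on_add holomorphic_on_const holomorphic_on_sum zeta_term_holomorphic)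
  fix s assume "s \<in> {s. Re s > 0}"
  hence s: "Re s > 0" by simp
  define d where "d = Re s / 2"
  have d: "d > 0" using s by (simp add: d_def)
  have re: "Re x \<ge> d" if "x \<in> cball s d" for x
  proof -
    have "\<bar>Re (s - x)\<bar> \<le> d" using abs_Re_le_cmod[of "s - x"] that by (simp add: dist_norm)
    thus ?thesis by (simp add: d_def abs_if split: if_splits)
  qed
  have "uniform_limit (cball s d) (\<lambda>N s. \<Sum>n<N. zeta_term s n) (\<lambda>s. suminf (zeta_term s)) sequentially"
  proof (rule Weierstrass_m_test)
    fix n x assume x: "x \<in> cball s d"
    have nx: "norm x \<le> norm s + d" using x norm_triangle_ineq2[of x s] by (simp add: dist_norm norm_minus_commute)
    have nx1: "norm (x - 1) \<le> norm s + d + 1" using nx norm_triangle_ineq4[of x 1] by simp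
    have "norm (zeta_term x n) \<le> norm x * norm (x - 1) * real (Suc n) powr (- Re x - 1)"
      using re[OF x] d by (intro norm_zeta_term_le) auto
    also have "\<dots> \<le> ((norm s + d) * (norm s + d + 1)) * real (Suc n) powr (- d - 1)"
      using re[OF x] d by (intro mult_mono nx nx1 powr_mono) auto
    finally show "norm (zeta_term x n) \<le> ((norm s + d) * (norm s + d + 1)) * real (Suc n) powr (- d - 1)" .
  next
    show "summable (\<lambda>n. ((norm s + d) * (norm s + d + 1)) * real (Suc n) powr (- d - 1))"
      using d by (subst summable_Suc_iff[of "\<lambda>n. ((norm s + d) * (norm s + d + 1)) * real n powr (- d - 1)"], intro summable_mult) (simp add: summable_real_powr_iff)
  qed
  hence "uniform_limit (cball s d) (\<lambda>N s. 1 + (\<Sum>n<N. zeta_term s n)) zeta1 sequentially"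
    unfolding zeta1_def[abs_def] by (rule uniform_limit_add[OF uniform_limit_const])
  moreover have "cball s d \<subseteq> {s. Re s > 0}" using re d by force
  ultimately show "\<exists>d>0. cball s d \<subseteq> {s. 0 < Re s} \<and> uniform_limit (cball s d) (\<lambda>N s. 1 + (\<Sum>n<N. zeta_term s n)) zeta1 sequentially"
    using d by blast
qed

lemma zeta1_1: "zeta1 1 = 1"
proof -
  have "(of_nat (Suc n) :: complex) \<noteq> 0" for n by (simp only: of_nat_eq_0_iff)
  hence "zeta_term 1 n = 0" for n
    unfolding zeta_term_def by (simp del: of_nat_Suc)
  thus ?thesis by (simp add: zeta1_def)
qed

lemma tendsto_Suc_powr_0:
  assumes "Re s < 0"
  shows "(\<lambda>n. of_nat (Suc n) powr s :: complex) \<longlonglongrightarrow> 0"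
proof (rule tendsto_norm_zero_cancel)
  have "(\<lambda>n. real (Suc n) powr Re s) \<longlonglongrightarrow> 0"
    using assms by real_asymp
  thus "(\<lambda>n. norm (of_nat (Suc n) powr s :: complex)) \<longlonglongrightarrow> 0"
    by (simp add: norm_powr_real_powr del: of_nat_Suc)
qed

lemma summable_norm_powr: "Re s > 1 \<Longrightarrow> summable (\<lambda>n. norm (of_nat n powr (- s) :: complex))"
  by (simp add: norm_powr_real_powr summable_real_powr_iff)

text \<open>For \<open>Re s > 1\<close> the telescoping part converges by itself; its sum -1 cancels
  the leading 1 in \<open>zeta1\<close>. The index 0 is harmless in the series because 0 to any
  power is 0 for \<open>powr\<close>.\<close>

lemma zeta1_conv_suminf:
  assumes s: "Re s > 1"
  shows "zeta1 s = (s - 1) * (\<Sum>n. of_nat n powr (- s))"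
proof -
  have "summable (\<lambda>n. of_nat n powr (- s) :: complex)"
    using summable_norm_powr[OF s] by (rule summable_norm_cancel)
  hence "(\<lambda>n. of_nat n powr (- s) :: complex) sums (\<Sum>n. of_nat n powr (- s))" by (rule summable_sums)
  hence "(\<lambda>n. of_nat (Suc n) powr (- s) :: complex) sums (\<Sum>n. of_nat n powr (- s))"
    by (subst sums_Suc_iff) simp
  hence "(\<lambda>n. (s - 1) * of_nat (Suc n) powr (- s)) sums ((s - 1) * (\<Sum>n. of_nat n powr (- s)))"
    by (rule sums_mult)
  moreover have "(\<lambda>n. of_nat (Suc (Suc n)) powr (1 - s) - of_nat (Suc n) powr (1 - s) :: complex) sums (0 - of_nat (Suc 0) powr (1 - s))"
    using s by (intro telescope_sums tendsto_Suc_powr_0) auto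
  ultimately have "(\<lambda>n. (s - 1) * of_nat (Suc n) powr (- s) + (of_nat (Suc (Suc n)) powr (1 - s) - of_nat (Suc n) powr (1 - s)))
     sums ((s - 1) * (\<Sum>n. of_nat n powr (- s)) + (0 - of_nat (Suc 0) powr (1 - s)))"
    by (rule sums_add)
  hence "zeta_term s sums ((s - 1) * (\<Sum>n. of_nat n powr (- s)) - 1)"
    by (simp add: zeta_term_def[abs_def] algebra_simps)
  thus ?thesis by (simp add: zeta1_def sums_iff)
qed

text \<open>Absolute convergence allows the double sum over pairs to be regrouped by their product.
  The regrouping runs over positive indices only, since 0 has infinitely many divisors; the terms at
  0 vanish.\<close>

lemma dirichlet_product:
  fixes a b :: "nat \<Rightarrow> complex"
  assumes a: "summable (\<lambda>n. norm (a n * of_nat n powr (-s)))"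
    and b: "summable (\<lambda>n. norm (b n * of_nat n powr (-s)))"
  shows "(\<lambda>n. (\<Sum>d | d dvd n. a d * b (n div d)) * of_nat n powr (-s)) sums
           ((\<Sum>n. a n * of_nat n powr (-s)) * (\<Sum>n. b n * of_nat n powr (-s)))"
proof -
  define F where "F = (\<lambda>n. a n * of_nat n powr (-s))"
  define G where "G = (\<lambda>n. b n * of_nat n powr (-s))"
  define P where "P = ({0<..} :: nat set)"
  have F0: "F 0 = 0" and G0: "G 0 = 0" by (simp_all add: F_def G_def)
  have F: "(F has_sum suminf F) P"
  proof -
    have "(F has_sum suminf F) UNIV" unfolding F_def
      by (rule norm_summable_imp_has_sum[OF a summable_sums[OF summable_norm_cancel[OF a]]])
    thus ?thesis by (subst has_sum_cong_neutral[of UNIV P F F]) (auto simp: P_def F0)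
  qed
  have G: "(G has_sum suminf G) P"
  proof -
    have "(G has_sum suminf G) UNIV" unfolding G_def
      by (rule norm_summable_imp_has_sum[OF b summable_sums[OF summable_norm_cancel[OF b]]])
    thus ?thesis by (subst has_sum_cong_neutral[of UNIV P G G]) (auto simp: P_def G0)
  qed
  have Fa: "(\<lambda>x. norm (F x)) summable_on P" and Ga: "(\<lambda>x. norm (G x)) summable_on P"
    using a b unfolding F_def G_def
    by (auto intro!: summable_on_subset_banach[OF norm_summable_imp_summable_on])
  have "(\<lambda>z. norm ((\<lambda>(x,y). F x * G y) z)) summable_on P \<times> P"
    unfolding Infinite_Sum.abs_summable_on_Sigma_iff using Fa Ga
    by (auto simp: norm_mult infsum_cmult_right' infsum_cmult_left' abs_mult intro!: summable_on_cmult_right summable_on_cmult_left)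
  hence "(\<lambda>(x,y). F x * G y) summable_on P \<times> P" by (rule abs_summable_summable)
  hence 1: "((\<lambda>(x,y). F x * G y) has_sum (\<Sum>\<^sub>\<infinity>(x,y)\<in>P \<times> P. F x * G y)) (P \<times> P)"
    by (rule has_sum_infsum)
  have "((\<lambda>x. F x * suminf G) has_sum (\<Sum>\<^sub>\<infinity>(x,y)\<in>P \<times> P. F x * G y)) P"
    using 1 by (rule has_sum_SigmaD) (auto intro!: has_sum_cmult_right G)
  moreover have "((\<lambda>x. F x * suminf G) has_sum (suminf F * suminf G)) P"
    by (intro has_sum_cmult_left F)
  ultimately have eq: "(\<Sum>\<^sub>\<infinity>(x,y)\<in>P \<times> P. F x * G y) = suminf F * suminf G"
    using has_sum_unique by blast
  have "((\<lambda>(n,d). F d * G (n div d)) has_sum (suminf F * suminf G)) (SIGMA n:P. {d. d dvd n})"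
    using 1 unfolding eq
    by (subst has_sum_reindex_bij_witness[where j = "\<lambda>(n,d). (d, n div d)" and i = "\<lambda>(x,y). (x * y, x)" and T = "P \<times> P"
        and h = "\<lambda>(x,y). F x * G y" and s' = "suminf F * suminf G"])
       (auto simp: P_def elim!: dvdE)
  hence "((\<lambda>n. \<Sum>d | d dvd n. F d * G (n div d)) has_sum (suminf F * suminf G)) P"
    by (rule has_sum_SigmaD) (auto simp: P_def intro!: has_sum_finite)
  also have "?this \<longleftrightarrow> ((\<lambda>n. (\<Sum>d | d dvd n. a d * b (n div d)) * of_nat n powr (-s)) has_sum (suminf F * suminf G)) UNIV"
  proof (rule has_sum_cong_neutral)
    fix n assume "n \<in> P \<inter> UNIV"
    hence n: "n > 0" by (simp add: P_def)
    have "F d * G (n div d) = a d * b (n div d) * of_nat n powr (-s)" if "d dvd n" for d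
    proof -
      from that obtain k where k: "n = d * k" by auto
      hence "d > 0" "k > 0" using n by auto
      have "(of_nat n :: complex) powr (-s) = of_nat d powr (-s) * of_nat k powr (-s)"
        unfolding k of_nat_mult by (rule powr_times_real) auto
      thus ?thesis using k \<open>d > 0\<close> by (simp add: F_def G_def)
    qed
    thus "(\<Sum>d | d dvd n. F d * G (n div d)) = (\<Sum>d | d dvd n. a d * b (n div d)) * of_nat n powr (-s)"
      by (simp add: sum_distrib_right)
  qed (auto simp: P_def)
  finally show ?thesis unfolding F_def G_def by (rule has_sum_imp_sums)
qed

section \<open>The Moebius function and the Dirichlet series of 1 / zeta\<close>

definition moebius :: "nat \<Rightarrow> real" where
  "moebius n = (if squarefree n then (-1) ^ card (prime_factors n) else 0)"

lemma abs_moebius_le: "\<bar>moebius n\<bar> \<le> 1"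
  by (simp add: moebius_def)

text \<open>Squarefree divisors correspond to sets of prime factors, by taking products. For
  \<open>n > 1\<close>, fixing one prime factor \<open>p\<close> and pairing each set without
  \<open>p\<close> with the same set plus \<open>p\<close> cancels the signs.\<close>

lemma sum_moebius_divisors:
  assumes n: "n > 0"
  shows "(\<Sum>d | d dvd n. moebius d) = (if n = 1 then 1 else 0)"
proof -
  let ?P = "prime_factors n"
  have fin: "finite ?P" by simp
  have sq: "squarefree (\<Prod>A)" and pf: "prime_factors (\<Prod>A) = A" if "A \<subseteq> ?P" for A :: "nat set"
  proof -
    have fA: "finite A" using that fin by (rule finite_subset)
    have pr: "prime p" if "p \<in> A" for p using that \<open>A \<subseteq> ?P\<close> by auto
    have A0: "0 \<notin> A" using pr[of 0] by auto
    show "prime_factors (\<Prod>A) = A"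
      using fA pr A0 by (subst prime_factors_prod) (auto simp: prime_prime_factors)
    have "multiplicity p (\<Prod>A) \<le> 1" if p: "prime p" for p
    proof -
      have "multiplicity p (\<Prod>x\<in>A. x) = (\<Sum>x\<in>A. multiplicity p x)"
        using fA pr p A0 by (subst prime_elem_multiplicity_prod_distrib) auto
      also have "\<dots> = (\<Sum>x\<in>A. if x = p then 1 else 0)"
        using pr p by (intro sum.cong) (auto simp: multiplicity_distinct_prime_power prime_multiplicity_other)
      also have "\<dots> \<le> 1" using fA by simp
      finally show ?thesis by simp
    qed
    moreover have "\<Prod>A \<noteq> 0" using fA A0 by simp
    ultimately show "squarefree (\<Prod>A)"
      by (subst squarefree_factorial_semiring'') auto
  qed
  have "(\<Sum>d | d dvd n. moebius d) = (\<Sum>d | d dvd n \<and> squarefree d. moebius d)"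
    using n by (intro sum.mono_neutral_right) (auto simp: moebius_def)
  also have "\<dots> = (\<Sum>A\<in>Pow ?P. (-1) ^ card A)"
  proof (rule sum.reindex_bij_witness[where i = "\<lambda>A. \<Prod>A" and j = prime_factors])
    fix d assume d: "d \<in> {d. d dvd n \<and> squarefree d}"
    hence d0: "d \<noteq> 0" using n by auto
    have "\<Prod>(prime_factors d) = (\<Prod>p\<in>prime_factors d. p ^ multiplicity p d)"
    proof (rule prod.cong)
      fix p assume p: "p \<in> prime_factors d"
      have "multiplicity p d \<le> 1" using d p squarefree_factorial_semiring''[OF d0] by (auto simp: in_prime_factors_imp_prime)
      moreover have "multiplicity p d > 0" using p by (simp add: prime_factors_multiplicity)
      ultimately have "multiplicity p d = 1" by simp
      thus "p = p ^ multiplicity p d" by simp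
    qed simp
    also have "\<dots> = d" using d0 by (simp add: prime_factorization_nat[symmetric])
    finally show "\<Prod>(prime_factors d) = d" .
    show "prime_factors d \<in> Pow ?P" using d n by (auto intro: dvd_prime_factors[THEN subsetD])
    show "(-1) ^ card (prime_factors d) = moebius d" using d by (simp add: moebius_def)
  next
    fix A assume A: "A \<in> Pow ?P"
    thus "prime_factors (\<Prod>A) = A" using pf by auto
    have "\<Prod>A dvd \<Prod>?P" using A by (intro prod_dvd_prod_subset) auto
    also have "\<dots> dvd (\<Prod>p\<in>?P. p ^ multiplicity p n)"
    proof (rule prod_dvd_prod)
      fix p assume p: "p \<in> ?P"
      have "multiplicity p n > 0" using p by (simp add: prime_factors_multiplicity)
      thus "p dvd p ^ multiplicity p n" by (intro dvd_power disjI1)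
    qed
    also have "\<dots> = n" using n by (simp add: prime_factorization_nat[symmetric])
    finally show "\<Prod>A \<in> {d. d dvd n \<and> squarefree d}" using sq[of A] A by auto
  qed
  also have "\<dots> = (if n = 1 then 1 else 0)"
  proof (cases "?P = {}")
    case True
    hence "n = 1" using n by (simp add: prime_factorization_empty_iff)
    with True show ?thesis by simp
  next
    case False
    then obtain p where p: "p \<in> ?P" by blast
    hence n1: "n \<noteq> 1" by auto
    define Q where "Q = ?P - {p}"
    have PQ: "?P = insert p Q" "p \<notin> Q" "finite Q" using p by (auto simp: Q_def)
    have "(\<Sum>A\<in>Pow ?P. (-1::real) ^ card A) = (\<Sum>A\<in>Pow Q. (-1) ^ card A) + (\<Sum>A\<in>insert p ` Pow Q. (-1) ^ card A)"
      unfolding PQ(1) Pow_insert using PQ by (intro sum.union_disjoint) auto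
    also have "(\<Sum>A\<in>insert p ` Pow Q. (-1::real) ^ card A) = (\<Sum>A\<in>Pow Q. (-1) ^ card (insert p A))"
      using PQ(2) by (subst sum.reindex) (auto simp: inj_on_def)
    also have "\<dots> = (\<Sum>A\<in>Pow Q. - ((-1) ^ card A))"
    proof (rule sum.cong)
      fix A assume "A \<in> Pow Q"
      hence "finite A" "p \<notin> A" using PQ finite_subset by auto
      thus "(-1::real) ^ card (insert p A) = - ((-1) ^ card A)" by simp
    qed simp
    finally show ?thesis using n1 by (simp add: sum_negf)
  qed
  finally show ?thesis .
qed

abbreviation zeta_sum :: "complex \<Rightarrow> complex" where
  "zeta_sum s \<equiv> (\<Sum>n. of_nat n powr (- s))"

text \<open>The convolution of \<open>moebius\<close> with the constant 1 is the unit at 1. This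
  yields both the series for 1 / zeta and the non-vanishing of zeta for
  \<open>Re s > 1\<close>.\<close>

lemma moebius_zeta_sum:
  assumes s: "Re s > 1"
  shows "(\<Sum>n. of_real (moebius n) * of_nat n powr (- s)) * zeta_sum s = 1"
    and "summable (\<lambda>n. norm (of_real (moebius n) * of_nat n powr (- s) :: complex))"
proof -
  show sm: "summable (\<lambda>n. norm (of_real (moebius n) * of_nat n powr (- s) :: complex))"
  proof (rule summable_comparison_test[OF _ summable_norm_powr[OF s]])
    show "\<exists>N. \<forall>n\<ge>N. norm (norm (complex_of_real (moebius n) * of_nat n powr - s)) \<le> norm (of_nat n powr - s :: complex)"
      using abs_moebius_le by (auto simp: norm_mult intro!: mult_left_le_one_le)
  qed
  have "(\<lambda>n. (\<Sum>d | d dvd n. complex_of_real (moebius d) * 1) * of_nat n powr (-s)) sums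
           ((\<Sum>n. of_real (moebius n) * of_nat n powr (-s)) * (\<Sum>n. 1 * of_nat n powr (-s)))"
    using sm summable_norm_powr[OF s] by (intro dirichlet_product) auto
  also have "(\<lambda>n. (\<Sum>d | d dvd n. complex_of_real (moebius d) * 1) * of_nat n powr (-s)) = (\<lambda>n. if n = 1 then 1 else 0)"
  proof
    fix n :: nat
    have "(\<Sum>d | d dvd n. complex_of_real (moebius d)) = of_real (\<Sum>d | d dvd n. moebius d)" by simp
    thus "(\<Sum>d | d dvd n. complex_of_real (moebius d) * 1) * of_nat n powr (-s) = (if n = 1 then 1 else 0)"
      by (cases "n = 0") (simp_all add: sum_moebius_divisors)
  qed
  finally have "(\<lambda>n. if n = 1 then 1 else 0) sums ((\<Sum>n. of_real (moebius n) * of_nat n powr (-s)) * zeta_sum s)" by simp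
  moreover have "(\<lambda>n. if n = 1 then 1 else (0::complex)) sums 1" using sums_single[of 1 "\<lambda>_. 1::complex"] by simp
  ultimately show "(\<Sum>n. of_real (moebius n) * of_nat n powr (- s)) * zeta_sum s = 1"
    using sums_unique2 by blast
qed

section \<open>The logarithmic derivative of zeta and non-vanishing on Re s = 1\<close>

lemma summable_ln_powr:
  assumes "(x::real) > 1"
  shows "summable (\<lambda>n. ln (real n) * real n powr (- x))"
proof -
  define e where "e = (x - 1) / 2"
  have e: "e > 0" using assms by (simp add: e_def)
  have "summable (\<lambda>n. 1 / e * real n powr (e - x))"
    using assms by (intro summable_mult) (simp add: summable_real_powr_iff e_def field_simps)
  moreover have "norm (ln (real n) * real n powr (- x)) \<le> 1 / e * real n powr (e - x)" if "n \<ge> 1" for n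
  proof -
    have "ln (real n) * real n powr (- x) \<le> (real n powr e / e) * real n powr (- x)"
      using that e by (intro mult_right_mono ln_powr_bound) auto
    also have "\<dots> = 1 / e * real n powr (e - x)" using that by (simp add: powr_add[symmetric])
    finally show ?thesis using that by simp
  qed
  ultimately show ?thesis by (rule summable_comparison_test'[where N = 1])
qed

text \<open>\<open>mangoldt\<close> convolved with 1 is the logarithm. The right-hand side of the
  product formula is minus the derivative of \<open>zeta_sum\<close>, so this is the series for -
  zeta' / zeta.\<close>

lemma mangoldt_zeta_sum:
  assumes s: "Re s > 1"
  shows "summable (\<lambda>n. norm (mangoldt n * of_nat n powr (- s) :: complex))"
    and "(\<Sum>n. mangoldt n * of_nat n powr (- s)) * zeta_sum s = (\<Sum>n. Ln (of_nat n) * of_nat n powr (- s))"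
proof -
  show sm: "summable (\<lambda>n. norm (mangoldt n * of_nat n powr (- s) :: complex))"
  proof (rule summable_comparison_test[OF _ summable_ln_powr[OF s]])
    have "norm (norm (mangoldt n * of_nat n powr (- s) :: complex)) \<le> ln (real n) * real n powr (- Re s)" if "n \<ge> 1" for n
      using that mangoldt_le[of n] by (auto simp: norm_mult norm_powr_real_powr abs_mult intro!: mult_right_mono)
    thus "\<exists>N. \<forall>n\<ge>N. norm (norm (mangoldt n * of_nat n powr (- s) :: complex)) \<le> ln (real n) * real n powr (- Re s)"
      by blast
  qed
  have "(\<lambda>n. (\<Sum>d | d dvd n. (mangoldt d :: complex) * 1) * of_nat n powr (-s)) sums
           ((\<Sum>n. mangoldt n * of_nat n powr (-s)) * (\<Sum>n. 1 * of_nat n powr (-s)))"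
    using sm summable_norm_powr[OF s] by (intro dirichlet_product) auto
  also have "(\<lambda>n. (\<Sum>d | d dvd n. (mangoldt d :: complex) * 1) * of_nat n powr (-s)) = (\<lambda>n. Ln (of_nat n) * of_nat n powr (- s))"
  proof
    fix n :: nat
    show "(\<Sum>d | d dvd n. (mangoldt d :: complex) * 1) * of_nat n powr (-s) = Ln (of_nat n) * of_nat n powr (- s)"
      using mangoldt_sum[of n, where ?'a = complex] by (cases "n = 0") simp_all
  qed
  finally show "(\<Sum>n. mangoldt n * of_nat n powr (- s)) * zeta_sum s = (\<Sum>n. Ln (of_nat n) * of_nat n powr (- s))"
    by (simp add: sums_iff)
qed

lemma zeta_sum_has_field_derivative:
  assumes s: "Re s > 1"
  shows "(zeta_sum has_field_derivative - (\<Sum>n. Ln (of_nat n) * of_nat n powr (- s))) (at s)"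
proof -
  let ?S = "{s. Re s > 1}"
  have "\<exists>g g'. \<forall>x \<in> ?S. ((\<lambda>n. of_nat n powr (- x)) sums g x) \<and> ((\<lambda>n. - Ln (of_nat n) * of_nat n powr (- x)) sums g' x) \<and> (g has_field_derivative g' x) (at x)"
  proof (rule series_and_derivative_comparison_local)
    show "open ?S" by (simp add: open_halfspace_Re_gt)
    show "((\<lambda>x. of_nat n powr (- x)) has_field_derivative - Ln (of_nat n) * of_nat n powr (- x)) (at x)" for n x
      by (cases "n = 0") (auto simp: powr_def intro!: derivative_eq_intros)
    fix x :: complex assume "x \<in> ?S"
    hence x: "Re x > 1" by simp
    define d where "d = (Re x - 1) / 2"
    have d: "d > 0" using x by (simp add: d_def)
    have "norm (of_nat n powr (- y) :: complex) \<le> real n powr (- (1 + d))" if "y \<in> ball x d" for n y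
    proof -
      have "\<bar>Re (x - y)\<bar> < d" using abs_Re_le_cmod[of "x - y"] that by (simp add: dist_norm)
      hence "Re y > 1 + d" by (simp add: d_def abs_if field_simps split: if_splits)
      thus ?thesis by (cases "n = 0") (auto simp: norm_powr_real_powr intro!: powr_mono)
    qed
    moreover have "summable (\<lambda>n. real n powr (- (1 + d)))" using d by (simp add: summable_real_powr_iff)
    ultimately show "\<exists>d h. 0 < d \<and> summable h \<and> (\<forall>\<^sub>F n in sequentially. \<forall>y\<in>ball x d \<inter> ?S. norm (of_nat n powr (- y) :: complex) \<le> h n)"
      using d by (intro exI[of _ d] exI[of _ "\<lambda>n. real n powr (- (1 + d))"] conjI always_eventually) auto
  qed
  then obtain g g' where g: "\<And>x. Re x > 1 \<Longrightarrow> (\<lambda>n. of_nat n powr (- x)) sums g x"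
      "\<And>x. Re x > 1 \<Longrightarrow> (\<lambda>n. - Ln (of_nat n) * of_nat n powr (- x)) sums g' x"
      "\<And>x. Re x > 1 \<Longrightarrow> (g has_field_derivative g' x) (at x)" by (auto simp: Ball_def)
  have "g' s = - (\<Sum>n. Ln (of_nat n) * of_nat n powr (- s))"
    using sums_minus[OF g(2)[OF s]] by (simp add: sums_iff)
  with g(3)[OF s] have "(g has_field_derivative - (\<Sum>n. Ln (of_nat n) * of_nat n powr (- s))) (at s)" by simp
  moreover have "eventually (\<lambda>x. x \<in> ?S) (nhds s)"
    using s by (intro eventually_nhds_in_open) (simp_all add: open_halfspace_Re_gt)
  hence "eventually (\<lambda>x. zeta_sum x = g x) (nhds s)"
    by eventually_elim (use g(1) in \<open>auto simp: sums_iff\<close>)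
  ultimately show ?thesis by (subst DERIV_cong_ev[OF refl _ refl])
qed

lemma zeta_sum_nonzero: "Re s > 1 \<Longrightarrow> zeta_sum s \<noteq> 0"
  using moebius_zeta_sum(1)[of s] by auto

lemma zeta_sum_log_derivative:
  assumes s: "Re s > 1"
  shows "(zeta_sum has_field_derivative - (\<Sum>n. mangoldt n * of_nat n powr (- s)) * zeta_sum s) (at s)"
  using zeta_sum_has_field_derivative[OF s] mangoldt_zeta_sum(2)[OF s] by simp

text \<open>
  The logarithmic derivative of \<open>zeta_341 t\<close> is \<open>- (\<Sum>n. \<Lambda>(n) * n powr (-x) * (3 + 4 cos + cos))\<close>, with
  angles \<open>t * ln n\<close> and \<open>2 * t * ln n\<close>, hence nonpositive. The function is therefore bounded below
  on \<open>1 < x \<le> 2\<close> by its value at \<open>2\<close>.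
\<close>
abbreviation zeta_341 :: "real \<Rightarrow> real \<Rightarrow> real" where
  "zeta_341 t x \<equiv> norm (zeta_sum (of_real x)) ^ 3 * norm (zeta_sum (of_real x + \<i> * of_real t)) ^ 4 *
     norm (zeta_sum (of_real x + 2 * \<i> * of_real t))"

lemma three_four_one:
  fixes t :: real
  shows "\<exists>c>0. \<forall>x. 1 < x \<longrightarrow> x \<le> 2 \<longrightarrow>
     zeta_341 t x \<ge> c"
proof -
  let ?S = "{s. Re s > 1}"
  define L where "L = (\<lambda>s. \<Sum>n. mangoldt n * of_nat n powr (- s) :: complex)"
  have op: "open ?S" and cv: "convex ?S" by (simp_all add: open_halfspace_Re_gt convex_halfspace_Re_gt)
  have hz: "zeta_sum holomorphic_on ?S"
    using zeta_sum_has_field_derivative by (subst holomorphic_on_open[OF op]) blast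
  have "(\<lambda>s. deriv zeta_sum s / zeta_sum s) holomorphic_on ?S"
    using zeta_sum_nonzero by (intro holomorphic_intros hz op) auto
  hence hL: "(\<lambda>s. - L s) holomorphic_on ?S"
    by (rule holomorphic_transform) (use zeta_sum_nonzero in \<open>auto simp: L_def DERIV_imp_deriv[OF zeta_sum_log_derivative]\<close>)
  \<comment> \<open>On the convex half plane a primitive \<open>g\<close> of the logarithmic
    derivative serves as log zeta up to a constant: below, \<open>zeta_sum s * exp (- g s)\<close>
    has derivative 0. Absolute values then become real parts of \<open>g\<close>.\<close>
  have "\<exists>g. \<forall>s\<in>?S. (g has_field_derivative - L s) (at s within ?S)"
  proof (rule holomorphic_convex_primitive'[OF cv op hL])
    fix g assume g: "\<And>s. s \<in> ?S \<Longrightarrow> (g has_field_derivative - L s) (at s within ?S)"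
    show "\<exists>g. \<forall>s\<in>?S. (g has_field_derivative - L s) (at s within ?S)"
      by (intro exI[of _ g] ballI g)
  qed
  then obtain g where g: "\<forall>s\<in>?S. (g has_field_derivative - L s) (at s within ?S)" ..
  have g': "(g has_field_derivative - L s) (at s)" if "Re s > 1" for s
    using bspec[OF g, of s] at_within_open[OF _ op, of s] that by simp
  have "\<exists>c. \<forall>s\<in>?S. zeta_sum s * exp (- g s) = c"
  proof (rule has_field_derivative_zero_constant[OF cv])
    fix s assume s: "s \<in> ?S"
    have "((\<lambda>s. zeta_sum s * exp (- g s)) has_field_derivative 0) (at s)"
      using s by (auto intro!: derivative_eq_intros zeta_sum_log_derivative g' simp: L_def)
    thus "((\<lambda>s. zeta_sum s * exp (- g s)) has_field_derivative 0) (at s within ?S)"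
      by (rule has_field_derivative_at_within)
  qed
  then obtain c where c: "\<And>s. Re s > 1 \<Longrightarrow> zeta_sum s * exp (- g s) = c" by auto
  have zc: "zeta_sum s = c * exp (g s)" if "Re s > 1" for s
    using c[OF that] by (simp add: exp_minus field_simps)
  have c0: "c \<noteq> 0" using c[of 2] zeta_sum_nonzero[of 2] by auto
  have nz: "norm (zeta_sum s) = norm c * exp (Re (g s))" if "Re s > 1" for s
    using zc[OF that] by (simp add: norm_mult norm_exp_eq_Re)
  define h where "h = (\<lambda>x. 3 * Re (g (of_real x)) + 4 * Re (g (of_real x + \<i> * of_real t)) + Re (g (of_real x + 2 * \<i> * of_real t)))"
  define h' where "h' = (\<lambda>x. - (3 * Re (L (of_real x)) + 4 * Re (L (of_real x + \<i> * of_real t)) + Re (L (of_real x + 2 * \<i> * of_real t))))"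
  have dg: "((\<lambda>x. Re (g (of_real x + a))) has_real_derivative - Re (L (of_real x + a))) (at x)" if "x > 1" "Re a = 0" for x a
  proof -
    have "((\<lambda>x. g (of_real x + a)) has_vector_derivative (1 * (- L (of_real x + a)))) (at x)"
      by (rule field_vector_diff_chain_at[where f = "\<lambda>x. of_real x + a" and g = g, unfolded o_def])
         (use that in \<open>auto intro!: derivative_eq_intros g'\<close>)
    from bounded_linear.has_vector_derivative[OF bounded_linear_Re this] show ?thesis
      by (simp add: has_real_derivative_iff_has_vector_derivative)
  qed
  have dh: "(h has_real_derivative h' x) (at x)" if "x > 1" for x
    using DERIV_add[OF DERIV_add[OF DERIV_cmult[OF dg[OF that, of 0], of 3] DERIV_cmult[OF dg[OF that, of "\<i> * of_real t"], of 4]]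
        dg[OF that, of "2 * \<i> * of_real t"]]
    unfolding h_def h'_def by simp
  have h'_le: "h' x \<le> 0" if x: "x > 1" for x
  proof -
    have ReL: "(\<lambda>n. mangoldt n * real n powr (- x) * cos (u * ln (real n))) sums Re (L (of_real x + \<i> * of_real u))" for u
    proof -
      have "(\<lambda>n. mangoldt n * of_nat n powr (- (of_real x + \<i> * of_real u)) :: complex) sums L (of_real x + \<i> * of_real u)"
        unfolding L_def using x by (intro summable_sums summable_norm_cancel[OF mangoldt_zeta_sum(1)]) simp
      from sums_Re[OF this] show ?thesis
      proof (rule sums_cong[THEN iffD1, rotated])
        fix n
        show "Re (mangoldt n * of_nat n powr (- (of_real x + \<i> * of_real u))) = mangoldt n * real n powr (- x) * cos (u * ln (real n))"
        proof (cases "n = 0")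
          case False
          have "(of_nat n :: complex) powr (- (of_real x + \<i> * of_real u)) = exp (of_real (- x * ln (real n)) + \<i> * of_real (- u * ln (real n)))"
            using False by (simp add: powr_def algebra_simps Ln_of_nat)
          hence "Re (of_nat n powr (- (of_real x + \<i> * of_real u)) :: complex) = real n powr (- x) * cos (u * ln (real n))"
            using False by (simp add: Re_exp powr_def)
          moreover have "(mangoldt n :: complex) = of_real (mangoldt n)" by simp
          hence "Re (mangoldt n * z) = mangoldt n * Re z" for z :: complex by (metis Re_complex_of_real times_complex.sel(1) Im_complex_of_real mult_zero_left diff_zero)
          ultimately show ?thesis by simp
        qed auto
      qed
    qed
    define F where "F = (\<lambda>n. 3 * (mangoldt n * real n powr (- x) * cos (0 * ln (real n))) + 4 * (mangoldt n * real n powr (- x) * cos (t * ln (real n)))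
        + mangoldt n * real n powr (- x) * cos (2 * t * ln (real n)))"
    have F_sums: "F sums (3 * Re (L (of_real x + \<i> * of_real 0)) + 4 * Re (L (of_real x + \<i> * of_real t)) + Re (L (of_real x + \<i> * of_real (2 * t))))"
      unfolding F_def by (intro sums_add sums_mult ReL)
    have F_nonneg: "0 \<le> F n" for n
    proof -
      define w where "w = cos (t * ln (real n))"
      have cd: "cos (2 * t * ln (real n)) = 2 * w ^ 2 - 1"
        using cos_double_cos[of "t * ln (real n)"] by (simp add: w_def mult_ac)
      \<comment> \<open>With \<open>w\<close> the cosine of the single angle, 3 + 4 w + (2 w^2 - 1)
        = 2 (1 + w)^2.\<close>
      have "F n = mangoldt n * real n powr (- x) * (2 * (1 + w) ^ 2)"
        unfolding F_def cd w_def[symmetric] by (simp add: algebra_simps power2_eq_square)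
      also have "\<dots> \<ge> 0" by (simp add: mangoldt_nonneg)
      finally show ?thesis .
    qed
    have "0 \<le> 3 * Re (L (of_real x + \<i> * of_real 0)) + 4 * Re (L (of_real x + \<i> * of_real t)) + Re (L (of_real x + \<i> * of_real (2 * t)))"
      by (rule sums_le[where f = "\<lambda>_. 0" and g = F, OF F_nonneg sums_zero F_sums])
    thus ?thesis by (simp add: h'_def algebra_simps)
  qed
  show ?thesis
  proof (intro exI[of _ "norm c ^ 8 * exp (h 2)"] conjI allI impI)
    show "norm c ^ 8 * exp (h 2) > 0" using c0 by simp
    fix x :: real assume x: "1 < x" "x \<le> 2"
    have "h 2 \<le> h x"
    proof (rule DERIV_nonpos_imp_nonincreasing[OF x(2)])
      fix y assume "x \<le> y" "y \<le> 2"
      thus "\<exists>D. (h has_real_derivative D) (at y) \<and> D \<le> 0" using dh[of y] h'_le[of y] x by auto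
    qed
    hence "norm c ^ 8 * exp (h 2) \<le> norm c ^ 8 * exp (h x)" by (simp add: mult_left_mono)
    also have "\<dots> = zeta_341 t x"
    proof -
      have e3: "exp (3 * u) = exp u ^ 3" and e4: "exp (4 * u) = exp u ^ 4" for u :: real
        using exp_of_nat_mult[of 3 u] exp_of_nat_mult[of 4 u] by simp_all
      have c8: "norm c ^ 8 = norm c ^ 3 * norm c ^ 4 * norm c" by (simp add: eval_nat_numeral)
      have "Re (of_real x) > 1" "Re (of_real x + \<i> * of_real t) > 1" "Re (of_real x + 2 * \<i> * of_real t) > 1"
        using x by simp_all
      note nz = this[THEN nz]
      show ?thesis unfolding nz h_def exp_add e3 e4 power_mult_distrib c8 by (simp only: mult_ac)
    qed
    finally show "norm c ^ 8 * exp (h 2) \<le> zeta_341 t x" .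
  qed
qed

text \<open>On the line Re s = 1 with t nonzero, a zero at \<open>1 + i t\<close> contributes order
  at least 4 to \<open>zeta_341\<close>, the pole at 1 takes away only 3, and there is no pole at
  \<open>1 + 2 i t\<close>. The product would tend to 0 as \<open>x\<close> decreases to 1, against
  its positive lower bound.\<close>

lemma zeta1_nonzero:
  assumes s: "Re s \<ge> 1"
  shows "zeta1 s \<noteq> 0"
proof (cases "Re s > 1")
  case True
  thus ?thesis using zeta1_conv_suminf[OF True] zeta_sum_nonzero[OF True] by auto
next
  case False
  hence Re_s: "Re s = 1" using s by simp
  define t where "t = Im s"
  have s_eq: "s = 1 + \<i> * of_real t" using Re_s by (simp add: t_def complex_eq_iff)
  show ?thesis
  proof (cases "t = 0")
    case True
    thus ?thesis using zeta1_1 by (simp add: s_eq)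
  next
    case t: False
    show ?thesis
    proof
      assume zero: "zeta1 s = 0"
      obtain c where c: "c > 0" "\<And>x. 1 < x \<Longrightarrow> x \<le> 2 \<Longrightarrow>
        zeta_341 t x \<ge> c"
        using three_four_one[of t] by metis
      have cont: "isCont zeta1 w" if "Re w > 0" for w
        using zeta1_holomorphic that holomorphic_on_imp_continuous_on[OF zeta1_holomorphic]
        by (simp add: continuous_on_eq_continuous_at open_halfspace_Re_gt)
      define h where "h = (\<lambda>n. 1 / real (Suc n))"
      have h: "h n > 0" "h n \<le> 1" for n by (simp_all add: h_def)
      have h0: "h \<longlonglongrightarrow> 0" unfolding h_def by real_asymp
      \<comment> \<open>This is \<open>zeta_341 t (1 + h n)\<close> times the bounded-below factors
        that turn zeta into \<open>zeta1\<close> away from 1. The powers of \<open>h n\<close>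
        balance as 1 + 3 - 4 = 0; the surplus factor \<open>h n\<close> sends \<open>F\<close> to 0,
        while the difference quotient converges to the derivative \<open>D\<close>.\<close>
      define F where "F = (\<lambda>n. h n * norm (zeta1 (of_real (1 + h n))) ^ 3 * norm (zeta1 (s + of_real (h n)) / of_real (h n)) ^ 4 * norm (zeta1 (of_real (1 + h n) + 2 * \<i> * of_real t)))"
      have hc: "(\<lambda>n. of_real (h n) :: complex) \<longlonglongrightarrow> 0" using tendsto_of_real[OF h0, where ?'a = complex] by simp
      obtain D where D: "(zeta1 has_field_derivative D) (at s)"
        using holomorphic_derivI[OF zeta1_holomorphic open_halfspace_Re_gt, of s UNIV] Re_s by auto
      have "(\<lambda>w. (zeta1 (s + w) - zeta1 s) / w) \<midarrow>0\<rightarrow> D" using D by (simp add: DERIV_def)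
      moreover have "filterlim (\<lambda>n. of_real (h n) :: complex) (at 0) sequentially"
        using hc h by (auto simp: filterlim_at less_imp_neq[symmetric])
      ultimately have "(\<lambda>n. (zeta1 (s + of_real (h n)) - zeta1 s) / of_real (h n)) \<longlonglongrightarrow> D"
        by (rule filterlim_compose)
      hence 1: "(\<lambda>n. zeta1 (s + of_real (h n)) / of_real (h n)) \<longlonglongrightarrow> D" by (simp add: zero)
      have 2: "(\<lambda>n. zeta1 (of_real (1 + h n))) \<longlonglongrightarrow> zeta1 1"
        by (rule isCont_tendsto_compose[OF cont]) (use tendsto_add[OF tendsto_const[of 1] hc] in auto)
      have 3: "(\<lambda>n. zeta1 (of_real (1 + h n) + 2 * \<i> * of_real t)) \<longlonglongrightarrow> zeta1 (1 + 2 * \<i> * of_real t)"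
        by (rule isCont_tendsto_compose[OF cont]) (use tendsto_add[OF tendsto_add[OF tendsto_const[of 1] hc] tendsto_const[of "2 * \<i> * of_real t"]] in auto)
      have "F \<longlonglongrightarrow> 0 * norm (zeta1 1) ^ 3 * norm D ^ 4 * norm (zeta1 (1 + 2 * \<i> * of_real t))"
        unfolding F_def by (intro tendsto_mult tendsto_power tendsto_norm h0 1 2 3)
      hence F0: "F \<longlonglongrightarrow> 0" by simp
      have "F n \<ge> c * \<bar>t\<bar> ^ 4 * (2 * \<bar>t\<bar>)" for n
      proof -
        define x where "x = 1 + h n"
        have x: "1 < x" "x \<le> 2" using h[of n] by (simp_all add: x_def)
        have hx: "h n = x - 1" by (simp add: x_def)
        have sx: "s + of_real (h n) = of_real x + \<i> * of_real t" by (simp add: s_eq x_def)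
        define a b d where "a = norm (zeta_sum (of_real x))" and "b = norm (zeta_sum (of_real x + \<i> * of_real t))"
          and "d = norm (zeta_sum (of_real x + 2 * \<i> * of_real t))"
        have norm_x1: "norm (complex_of_real x - 1) = x - 1"
          using x norm_of_real[of "x - 1", where ?'a = complex] by simp
        have A: "norm (zeta1 (of_real (1 + h n))) = (x - 1) * a"
          using x zeta1_conv_suminf[of "of_real x"] unfolding x_def[symmetric]
          by (simp add: norm_mult a_def norm_x1) 
        have B: "norm (zeta1 (s + of_real (h n)) / of_real (h n)) = norm (of_real x + \<i> * of_real t - 1) * b / (x - 1)"
          using x zeta1_conv_suminf[of "of_real x + \<i> * of_real t"] unfolding sx
          by (simp add: norm_mult norm_divide b_def hx norm_x1)
        have C: "norm (zeta1 (of_real (1 + h n) + 2 * \<i> * of_real t)) = norm (of_real x + 2 * \<i> * of_real t - 1) * d"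
          using x zeta1_conv_suminf[of "of_real x + 2 * \<i> * of_real t"] unfolding x_def[symmetric]
          by (simp add: norm_mult d_def)
        have T1: "norm (of_real x + \<i> * of_real t - 1) \<ge> \<bar>t\<bar>"
          using abs_Im_le_cmod[of "of_real x + \<i> * of_real t - 1"] by simp
        have T2: "norm (of_real x + 2 * \<i> * of_real t - 1) \<ge> 2 * \<bar>t\<bar>"
          using abs_Im_le_cmod[of "of_real x + 2 * \<i> * of_real t - 1"] by simp
        have alg: "e * (e * a) ^ 3 * (p * b / e) ^ 4 * (q * d) = a ^ 3 * b ^ 4 * d * p ^ 4 * q" if "e \<noteq> 0" for e p q
          using that by (simp add: power_mult_distrib power_divide eval_nat_numeral)
        have "c * \<bar>t\<bar> ^ 4 * (2 * \<bar>t\<bar>) \<le> (a ^ 3 * b ^ 4 * d) * norm (of_real x + \<i> * of_real t - 1) ^ 4 * norm (of_real x + 2 * \<i> * of_real t - 1)"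
          using c(2)[OF x] c(1) T1 T2 unfolding a_def b_def d_def
          by (intro mult_mono power_mono) auto
        also have "\<dots> = F n"
          unfolding F_def A B C unfolding hx by (rule alg[symmetric]) (use x in simp)
        finally show ?thesis .
      qed
      hence "c * \<bar>t\<bar> ^ 4 * (2 * \<bar>t\<bar>) \<le> 0"
        by (intro tendsto_lowerbound[OF F0]) auto
      moreover have "c * \<bar>t\<bar> ^ 4 * (2 * \<bar>t\<bar>) > 0" using c t by simp
      ultimately show False by simp
    qed
  qed
qed

section \<open>Newman's contour argument\<close>

lemma powr_diff_bound:
  fixes u x :: real
  assumes u: "u > 0" and x: "x > 0"
  shows "(u + 1) powr (- x - 1) \<le> (u powr (- x) - (u + 1) powr (- x)) / x"
proof -
  have "\<exists>z. u < z \<and> z < u + 1 \<and> (u + 1) powr (- x) - u powr (- x) = (u + 1 - u) * (- x * z powr (- x - 1))"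
    using u by (intro MVT2) (auto intro!: derivative_eq_intros simp: powr_diff)
  then obtain z where z: "u < z" "z < u + 1" "u powr (- x) - (u + 1) powr (- x) = x * z powr (- x - 1)" by auto
  have "(u + 1) powr (- x - 1) \<le> z powr (- x - 1)" using z u x by (intro powr_mono2') auto
  thus ?thesis using z x by (simp add: field_simps)
qed

text \<open>Comparison with the integral of \<open>x powr (y - 1)\<close>. For \<open>y <= 1\<close>
  the integrand decreases and the sum is at most \<open>N powr y / y\<close>. For
  \<open>y > 1\<close> it increases, so the comparison covers only \<open>n < N\<close> and the last
  term supplies the summand \<open>1 / N\<close>.\<close>

lemma sum_powr_bound:
  fixes y :: real
  assumes y: "y > 0" and N: "N > 0"
  shows "(\<Sum>n=1..N. real n powr (y - 1)) \<le> real N powr y * (1 / y + 1 / real N)"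
proof (cases "y \<le> 1")
  case True
  have "(\<Sum>n=1..N. real n powr (y - 1)) \<le> real N powr y / y"
  proof (induction N)
    case (Suc N)
    have "real (Suc N) powr (y - 1) \<le> (real (Suc N) powr y - real N powr y) / y"
    proof (cases "N = 0")
      case True
      thus ?thesis using y \<open>y \<le> 1\<close> by (simp add: field_simps)
    next
      case False
      have "\<exists>z. real N < z \<and> z < real (Suc N) \<and> real (Suc N) powr y - real N powr y = (real (Suc N) - real N) * (y * z powr (y - 1))"
        using False by (intro MVT2) (auto intro!: derivative_eq_intros simp: powr_diff)
      then obtain z where z: "real N < z" "z < real (Suc N)" "real (Suc N) powr y - real N powr y = y * z powr (y - 1)" by auto
      have "real (Suc N) powr (y - 1) \<le> z powr (y - 1)" using z True False by (intro powr_mono2') auto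
      thus ?thesis using z y by (simp add: field_simps)
    qed
    with Suc.IH show ?case by (simp add: diff_divide_distrib)
  qed simp
  also have "\<dots> \<le> real N powr y * (1 / y + 1 / real N)" by (simp add: algebra_simps)
  finally show ?thesis .
next
  case False
  have N1: "1 \<le> N" using N by simp
  have "(\<Sum>n=1..<N. real n powr (y - 1)) \<le> real N powr y / y" using N1
  proof (induction N rule: dec_induct)
    case base
    show ?case using y by simp
  next
    case (step N)
    have "\<exists>z. real N < z \<and> z < real (Suc N) \<and> real (Suc N) powr y - real N powr y = (real (Suc N) - real N) * (y * z powr (y - 1))"
      using step.hyps by (intro MVT2) (auto intro!: derivative_eq_intros simp: powr_diff)
    then obtain z where z: "real N < z" "z < real (Suc N)" "real (Suc N) powr y - real N powr y = y * z powr (y - 1)" by auto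
    have "real N powr (y - 1) \<le> z powr (y - 1)" using z False by (intro powr_mono2) auto
    hence "real N powr (y - 1) \<le> (real (Suc N) powr y - real N powr y) / y" using z y by (simp add: field_simps)
    with step.IH step.hyps show ?case by (simp add: diff_divide_distrib)
  qed
  moreover have "{1..N} = insert N {1..<N}" using N by auto
  hence "(\<Sum>n=1..N. real n powr (y - 1)) = real N powr (y - 1) + (\<Sum>n=1..<N. real n powr (y - 1))" by simp
  moreover have "real N powr (y - 1) = real N powr y / real N" using N by (simp add: powr_diff)
  ultimately show ?thesis by (simp add: algebra_simps)
qed

lemma norm_of_real_le_moebius: "norm (complex_of_real (moebius n) * z) \<le> norm z"
  using abs_moebius_le[of n] by (simp add: norm_mult mult_left_le_one_le)

text \<open>The shift by 1 places the sum of \<open>moebius n / n\<close> at \<open>z = 0\<close>.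
  As a finite sum this is entire in \<open>z\<close>, so it can be integrated over the whole circle,
  unlike 1 / zeta.\<close>

definition moebius_psum :: "nat \<Rightarrow> complex \<Rightarrow> complex" where
  "moebius_psum N z = (\<Sum>n=1..N. of_real (moebius n) * of_nat n powr (- (1 + z)))"

text \<open>\<open>z / zeta1 (1 + z)\<close> is 1 / zeta at \<open>1 + z\<close>, so the difference
  is the tail of its series, bounded termwise by a telescoping comparison. The loss
  \<open>1 / Re z\<close> near the imaginary axis is what \<open>newman_kernel_norm\<close>
  compensates.\<close>

lemma moebius_tail_bound:
  assumes z: "Re z > 0" and N: "N > 0"
  shows "norm (z / zeta1 (1 + z) - moebius_psum N z) \<le> real N powr (- Re z) / Re z"
proof -
  define x where "x = Re z"
  define f where "f = (\<lambda>n. of_real (moebius n) * of_nat n powr (- (1 + z)) :: complex)"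
  have re: "Re (1 + z) > 1" using z by simp
  have sm: "summable (\<lambda>n. norm (f n))" using moebius_zeta_sum(2)[OF re] by (simp add: f_def)
  have z0: "z \<noteq> 0" using z by auto
  have "suminf f * (zeta1 (1 + z) / z) = 1"
    using moebius_zeta_sum(1)[OF re] z0 unfolding zeta1_conv_suminf[OF re] f_def by simp
  hence 1: "z / zeta1 (1 + z) = suminf f" using z0 zeta1_nonzero[of "1 + z"] z by (simp add: field_simps)
  have "(\<Sum>n<N + 1. f n) = moebius_psum N z"
  proof -
    have "{..<N + 1} = insert 0 {1..N}" by auto
    thus ?thesis by (simp add: moebius_psum_def f_def)
  qed
  hence 2: "z / zeta1 (1 + z) - moebius_psum N z = (\<Sum>n. f (n + (N + 1)))"
    using suminf_minus_initial_segment[OF summable_norm_cancel[OF sm], of "N + 1"] 1 by simp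
  have sm': "summable (\<lambda>n. norm (f (n + (N + 1))))" using sm by (rule summable_ignore_initial_segment)
  define b where "b = (\<lambda>n. (real (n + N) powr (- x) - real (Suc n + N) powr (- x)) / x)"
  have b_sums: "b sums ((real (0 + N) powr (- x) - 0) / x)" unfolding b_def
  proof (intro sums_divide telescope_sums')
    show "(\<lambda>n. real (n + N) powr (- x)) \<longlonglongrightarrow> 0" using z unfolding x_def by real_asymp
  qed
  have "norm (\<Sum>n. f (n + (N + 1))) \<le> (\<Sum>n. norm (f (n + (N + 1))))"
    by (rule summable_norm[OF sm'])
  also have "\<dots> \<le> (\<Sum>n. b n)"
  proof (rule suminf_le[OF _ sm' sums_summable[OF b_sums]])
    fix n
    have "norm (f (n + (N + 1))) \<le> norm (of_nat (n + (N + 1)) powr (- (1 + z)) :: complex)"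
      unfolding f_def by (rule norm_of_real_le_moebius)
    also have "\<dots> = real (n + (N + 1)) powr (- x - 1)"
    proof -
      have "- x - 1 = Re (- (1 + z))" by (simp add: x_def)
      thus ?thesis by (simp only: norm_powr_real_powr Reals_of_nat complex_Re_of_nat of_nat_0_le_iff)
    qed
    also have "\<dots> \<le> b n" using powr_diff_bound[of "real (n + N)" x] z N unfolding b_def x_def by (simp add: add_ac)
    finally show "norm (f (n + (N + 1))) \<le> b n" .
  qed
  also have "\<dots> = real N powr (- x) / x" using b_sums by (simp add: sums_iff)
  finally show ?thesis unfolding 2 x_def .
qed

text \<open>The trivial bound suffices on the left: its growth is undone by \<open>N powr z\<close>,
  and its factor \<open>1 / (- Re z)\<close> by the kernel.\<close>

lemma moebius_psum_bound:
  assumes z: "Re z < 0" and N: "N > 0"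
  shows "norm (moebius_psum N z) \<le> real N powr (- Re z) * (1 / (- Re z) + 1 / real N)"
proof -
  have "norm (moebius_psum N z) \<le> (\<Sum>n=1..N. norm (of_nat n powr (- (1 + z)) :: complex))"
    unfolding moebius_psum_def by (rule sum_norm_le) (rule norm_of_real_le_moebius)
  also have "\<dots> = (\<Sum>n=1..N. real n powr ((- Re z) - 1))"
  proof (rule sum.cong)
    fix n
    have "- Re z - 1 = Re (- (1 + z))" by simp
    thus "norm (of_nat n powr (- (1 + z)) :: complex) = real n powr (- Re z - 1)"
      by (simp only: norm_powr_real_powr Reals_of_nat complex_Re_of_nat of_nat_0_le_iff)
  qed simp
  also have "\<dots> \<le> real N powr (- Re z) * (1 / (- Re z) + 1 / real N)"
    using z N by (intro sum_powr_bound) auto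
  finally show ?thesis .
qed

text \<open>\<open>circlepath\<close> starts at angle 0, so the right half circle appears as two
  separate arcs, the first and the third.\<close>

lemma has_contour_integral_circlepath_split:
  fixes f :: "complex \<Rightarrow> complex"
  assumes R: "R > 0" and cont: "continuous_on (sphere 0 R) f" and int: "(f has_contour_integral I) (circlepath 0 R)"
  obtains i1 i2 i3 where "(f has_contour_integral i1) (part_circlepath 0 R 0 (pi/2))"
    "(f has_contour_integral i2) (part_circlepath 0 R (pi/2) (3/2*pi))"
    "(f has_contour_integral i3) (part_circlepath 0 R (3/2*pi) (2*pi))" "I = i1 + i2 + i3"
proof -
  have ex: "\<exists>i. (f has_contour_integral i) (part_circlepath 0 R a b)" if "a < b" for a b
  proof -
    have "f contour_integrable_on (part_circlepath 0 R a b)"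
      using R that by (intro contour_integrable_continuous_part_circlepath continuous_on_subset[OF cont] path_image_part_circlepath_subset) auto
    thus ?thesis by (auto simp: contour_integrable_on_def)
  qed
  obtain i1 where i1: "(f has_contour_integral i1) (part_circlepath 0 R 0 (pi/2))" using ex[of 0 "pi/2"] by auto
  obtain i2 where i2: "(f has_contour_integral i2) (part_circlepath 0 R (pi/2) (3/2*pi))" using ex[of "pi/2" "3/2*pi"] by auto
  obtain i3 where i3: "(f has_contour_integral i3) (part_circlepath 0 R (3/2*pi) (2*pi))" using ex[of "3/2*pi" "2*pi"] by auto
  let ?g = "\<lambda>t. f (0 + R * cis t) * R * \<i> * cis t"
  have "(?g has_integral i1) {0..pi/2}" "(?g has_integral i2) {pi/2..3/2*pi}" "(?g has_integral i3) {3/2*pi..2*pi}"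
    using i1 i2 i3 by (simp_all add: has_contour_integral_part_circlepath_iff)
  hence "(?g has_integral (i1 + i2 + i3)) {0..2*pi}"
    by (intro has_integral_combine[of 0 "3/2*pi" "2*pi"] has_integral_combine[of 0 "pi/2" "3/2*pi"]) auto
  moreover have "(?g has_integral I) {0..2*pi}"
    using int by (simp add: circlepath_def has_contour_integral_part_circlepath_iff)
  ultimately have "I = i1 + i2 + i3" by (rule has_integral_unique[symmetric])
  thus ?thesis using that i1 i2 i3 by blast
qed

abbreviation newman_weight :: "real \<Rightarrow> complex \<Rightarrow> complex" where
  "newman_weight R z \<equiv> 1 + z\<^sup>2 / (of_real R)\<^sup>2"

text \<open>On the circle 1 / z = conj z / R^2, hence 1 / z + z / R^2 = 2 Re z / R^2. This factor
  \<open>Re z\<close> is the purpose of the weight.\<close>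

lemma newman_kernel_norm:
  assumes z: "norm z = R" and R: "R > 0" and N: "N > 0"
  shows "norm (of_nat N powr z * newman_weight R z / z) = real N powr Re z * (2 * \<bar>Re z\<bar>) / R\<^sup>2"
proof -
  have z0: "z \<noteq> 0" using z R by auto
  have "z * cnj z = (of_real R)\<^sup>2" using z by (metis complex_norm_square of_real_power)
  hence "newman_weight R z / z = (cnj z + z) / (of_real R)\<^sup>2"
    using z0 R by (simp add: field_simps power2_eq_square)
  also have "norm \<dots> = 2 * \<bar>Re z\<bar> / R\<^sup>2"
    by (simp add: complex_add_cnj add.commute norm_divide norm_power norm_mult)
  finally show ?thesis
    by (simp add: norm_mult norm_divide norm_powr_real_powr times_divide_eq_right[symmetric] del: times_divide_eq_right)
qed

lemma norm_eq_Re_nonzero: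
  assumes "norm z = R" "z \<noteq> \<i> * of_real R" "z \<noteq> - \<i> * of_real R"
  shows "Re z \<noteq> 0"
proof
  assume r0: "Re z = 0"
  hence "\<bar>Im z\<bar> = R" using assms(1) by (simp add: cmod_def)
  hence "Im z = R \<or> Im z = - R" by auto
  thus False using assms(2,3) r0 by (auto simp: complex_eq_iff)
qed

text \<open>
  Let \<open>G z = z / zeta1 (1 + z)\<close>, so that \<open>G 0 = 0\<close>, and weight everything with
  \<open>N powr z * newman_weight R z / z\<close>. Cauchy's formula on the full circle represents the partial sum
  at \<open>0\<close>; on the right half circle it is compared with \<open>G\<close>, whose integral there equals, up to sign,
  the one along the diameter. The latter is \<open>O(1 / ln N)\<close> by partial integration.
\<close>
lemma moebius_psum_newman_bound:
  assumes R: "R > 0"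
  shows "\<exists>M. \<forall>N\<ge>2. norm (moebius_psum N 0) \<le> 2 / R + 1 / real N + M / ln (real N)"
proof -
  define U where "U = {z. Re z > - 1 \<and> zeta1 (1 + z) \<noteq> 0}"
  \<comment> \<open>This is \<open>G z * newman_weight R z / z\<close> with the factor
    \<open>z\<close> cancelled. The integrand \<open>P\<close> below is therefore regular at 0, and
    the closed contour around the right half disc encloses no residue.\<close>
  define H where "H = (\<lambda>z. newman_weight R z / zeta1 (1 + z))"
  have h1: "(\<lambda>z. zeta1 (1 + z)) holomorphic_on {z. Re z > -1}"
    using holomorphic_on_compose_gen[of "\<lambda>z. 1 + z" "{z. Re z > -1}" zeta1 "{z. Re z > 0}"] zeta1_holomorphic
    by (force simp: o_def intro: holomorphic_intros)
  have opU: "open U"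
  proof -
    have "open ({z. Re z > -1} \<inter> (\<lambda>z. zeta1 (1 + z)) -` (- {0}))"
      by (intro continuous_open_preimage holomorphic_on_imp_continuous_on[OF h1] open_halfspace_Re_gt) auto
    also have "\<dots> = U" by (auto simp: U_def)
    finally show ?thesis .
  qed
  have subU: "z \<in> U" if "Re z \<ge> 0" for z using that zeta1_nonzero[of "1 + z"] by (simp add: U_def)
  have hH: "H holomorphic_on U" unfolding H_def
    by (intro holomorphic_intros holomorphic_on_subset[OF h1]) (use R in \<open>auto simp: U_def\<close>)
  have hdH: "deriv H holomorphic_on U" by (rule holomorphic_deriv[OF hH opU])
  let ?arc1 = "part_circlepath 0 R 0 (pi/2)" and ?arc2 = "part_circlepath 0 R (pi/2) (3/2*pi)"
    and ?arc3 = "part_circlepath 0 R (3/2*pi) (2*pi)"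
  let ?path = "linepath (\<i> * of_real R) (- \<i> * of_real R)"
  let ?seg = "closed_segment (\<i> * of_real R) (- \<i> * of_real R)"
  have segRe: "Re z = 0" if "z \<in> ?seg" for z
    using that by (auto simp: closed_segment_def)
  have segU: "?seg \<subseteq> U" using segRe subU by (metis order_refl subsetI)
  have "compact (deriv H ` ?seg)"
    by (intro compact_continuous_image continuous_on_subset[OF holomorphic_on_imp_continuous_on[OF hdH] segU]) auto
  hence "bounded (deriv H ` ?seg)" by (rule compact_imp_bounded)
  then obtain M where M: "M > 0" "\<And>z. z \<in> ?seg \<Longrightarrow> norm (deriv H z) \<le> M"
    unfolding bounded_pos by auto
  have "norm (moebius_psum N 0) \<le> 2 / R + 1 / real N + (R * M / pi) / ln (real N)" if N2: "N \<ge> 2" for N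
  proof -
    have N: "N > 0" and lnN: "ln (real N) > 0" using N2 by auto
    have N0: "(of_nat N :: complex) \<noteq> 0" using N by simp
    define P where "P = (\<lambda>z. H z * of_nat N powr z)"
    define T where "T = (\<lambda>z. moebius_psum N z * of_nat N powr z * newman_weight R z / z)"
    have hP: "P holomorphic_on U" unfolding P_def by (intro holomorphic_intros hH)
    have hS: "(\<lambda>z. moebius_psum N z * of_nat N powr z * newman_weight R z) holomorphic_on A" for A
      unfolding moebius_psum_def using R by (intro holomorphic_intros) auto
    have contT: "continuous_on (sphere 0 R) T" unfolding T_def
      by (intro continuous_on_divide holomorphic_on_imp_continuous_on[OF hS] continuous_intros) (use R in auto)
    have "(T has_contour_integral (2 * of_real pi * \<i> * (moebius_psum N 0 * of_nat N powr 0 * newman_weight R 0))) (circlepath 0 R)"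
      using Cauchy_integral_circlepath_simple[OF hS, of 0 0 R] R by (simp add: T_def)
    hence intT: "(T has_contour_integral (2 * of_real pi * \<i> * moebius_psum N 0)) (circlepath 0 R)"
      using N0 by simp
    obtain t1 t2 t3 where t: "(T has_contour_integral t1) ?arc1"
      "(T has_contour_integral t2) ?arc2"
      "(T has_contour_integral t3) ?arc3" "2 * of_real pi * \<i> * moebius_psum N 0 = t1 + t2 + t3"
      by (rule has_contour_integral_circlepath_split[OF R contT intT]) (rule that)
    have im: "z \<in> sphere 0 R \<and> Re z \<ge> 0" if "z \<in> path_image ?arc1 \<or> z \<in> path_image ?arc3" for z
    proof -
      from that obtain x where x: "z = of_real R * cis x" "(0 \<le> x \<and> x \<le> pi/2) \<or> (3/2*pi \<le> x \<and> x \<le> 2*pi)"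
        using R by (auto simp: path_image_part_circlepath cis_conv_exp)
      have "cos x \<ge> 0"
      proof (cases "x \<le> pi/2")
        case True thus ?thesis using x by (intro cos_ge_zero) auto
      next
        case False
        have "cos x = cos (x - 2 * pi)" by (simp add: cos_diff)
        also have "\<dots> \<ge> 0" using x False by (intro cos_ge_zero) auto
        finally show ?thesis .
      qed
      thus ?thesis using x R by (simp add: norm_mult)
    qed
    have im2: "z \<in> sphere 0 R \<and> Re z \<le> 0" if "z \<in> path_image ?arc2" for z
    proof -
      from that obtain x where x: "z = of_real R * cis x" "pi/2 \<le> x \<and> x \<le> 3/2*pi"
        using R by (auto simp: path_image_part_circlepath cis_conv_exp)
      have "cos x = - cos (x - pi)" by (simp add: cos_diff)
      also have "\<dots> \<le> 0" using x cos_ge_zero[of "x - pi"] by auto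
      finally show ?thesis using x R by (simp add: norm_mult mult_nonneg_nonpos)
    qed
    have exP: "\<exists>p. (P has_contour_integral p) (part_circlepath 0 R a b)"
      if "path_image (part_circlepath 0 R a b) \<subseteq> U" for a b
      using contour_integrable_continuous_part_circlepath[OF holomorphic_on_imp_continuous_on[OF holomorphic_on_subset[OF hP that]]]
      by (auto simp: contour_integrable_on_def)
    have sub1: "path_image ?arc1 \<subseteq> U" and sub3: "path_image ?arc3 \<subseteq> U"
      using im subU by blast+
    obtain p1 where p1: "(P has_contour_integral p1) ?arc1" using exP[OF sub1] by auto
    obtain p3 where p3: "(P has_contour_integral p3) ?arc3" using exP[OF sub3] by auto
    have "P contour_integrable_on ?path"
      by (intro contour_integrable_continuous_linepath continuous_on_subset[OF holomorphic_on_imp_continuous_on[OF hP] segU])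
    then obtain q where q: "(P has_contour_integral q) ?path"
      by (auto simp: contour_integrable_on_def)
    have cis32: "cis (3/2*pi) = - \<i>" using cos_3over2_pi sin_3over2_pi by (simp add: complex_eq_iff)
    let ?g = "?arc3 +++ ?arc1 +++ ?path"
    let ?D = "cball 0 R \<inter> {z. Re z \<ge> 0}"
    have PF: "pathfinish (part_circlepath 0 R a b) = of_real R * cis b"
      and PS: "pathstart (part_circlepath 0 R a b) = of_real R * cis a" for a b
      by (simp_all add: cis_conv_exp)
    have e1: "pathfinish ?arc3 = of_real R"
      and e2: "pathstart ?arc1 = of_real R"
      and e3: "pathfinish ?arc1 = \<i> * of_real R"
      and e4: "pathstart ?arc3 = - \<i> * of_real R"
      unfolding PF PS cis32 by simp_all
    have "valid_path ?g" using e1 e2 e3 by (intro valid_path_join) auto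
    have "(P has_contour_integral 0) ?g"
    proof (rule Cauchy_theorem_convex[of ?D P "{}"])
      show "continuous_on ?D P" using subU by (intro continuous_on_subset[OF holomorphic_on_imp_continuous_on[OF hP]]) auto
      show "convex ?D" by (intro convex_Int convex_cball convex_halfspace_Re_ge)
      show "P field_differentiable at x" if "x \<in> interior ?D - {}" for x
        using that interior_subset[of ?D] subU[of x] by (intro holomorphic_on_imp_differentiable_at[OF hP opU]) auto
      show "valid_path ?g" by fact
      have "?seg \<subseteq> ?D"
        using R by (intro closed_segment_subset convex_Int convex_cball convex_halfspace_Re_ge) (auto simp: norm_mult)
      moreover have "path_image ?arc1 \<subseteq> ?D"
        by (intro subsetI) (drule im[OF disjI1], simp)
      moreover have "path_image ?arc3 \<subseteq> ?D"
        by (intro subsetI) (drule im[OF disjI2], simp)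
      ultimately show "path_image ?g \<subseteq> ?D"
        by (intro subset_path_image_join) auto
      show "pathfinish ?g = pathstart ?g" using e4 by simp
    qed simp
    moreover have "(P has_contour_integral (p3 + (p1 + q))) ?g"
      using p1 p3 q e1 e2 e3 by (intro has_contour_integral_join valid_path_join) auto
    ultimately have pq: "p3 + (p1 + q) = 0" by (rule has_contour_integral_unique[symmetric])
    \<comment> \<open>Partial integration of \<open>N powr z\<close> gains \<open>1 / ln N\<close>.
      The boundary terms vanish because the weight is 0 at both ends of the diameter, and
      \<open>N powr z\<close> has norm 1 on the segment.\<close>
    have bq: "norm q \<le> 2 * R * M / ln (real N)"
    proof -
      have der: "(P has_field_derivative (deriv H z * of_nat N powr z + Ln (of_nat N) * P z)) (at z within ?seg)" if "z \<in> ?seg" for z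
      proof (rule has_field_derivative_at_within)
        have "z \<in> U" using that segU by blast
        from DERIV_mult[OF holomorphic_derivI[OF hH opU this] has_field_derivative_powr_right[OF N0]]
        show "(P has_field_derivative (deriv H z * of_nat N powr z + Ln (of_nat N) * P z)) (at z)"
          unfolding P_def by (simp only: mult_ac)
      qed
      have "((\<lambda>z. deriv H z * of_nat N powr z + Ln (of_nat N) * P z) has_contour_integral
          (P (pathfinish ?path) - P (pathstart ?path)))
            ?path"
        by (rule contour_integral_primitive[OF der]) auto
      moreover have "P (- \<i> * of_real R) = 0" "P (\<i> * of_real R) = 0"
        using R by (simp_all add: P_def H_def power_mult_distrib)
      ultimately have "((\<lambda>z. deriv H z * of_nat N powr z + Ln (of_nat N) * P z) has_contour_integral 0) ?path"
        by simp
      from has_contour_integral_diff[OF this has_contour_integral_lmul[OF q, of "Ln (of_nat N)"]]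
      have "((\<lambda>z. deriv H z * of_nat N powr z) has_contour_integral (0 - Ln (of_nat N) * q)) ?path"
        by simp
      hence "norm (0 - Ln (of_nat N) * q) \<le> M * norm (- \<i> * of_real R - \<i> * of_real R)"
      proof (rule has_contour_integral_bound_linepath)
        fix z assume z: "z \<in> ?seg"
        show "norm (deriv H z * of_nat N powr z) \<le> M"
          using M(2)[OF z] segRe[OF z] N by (simp add: norm_mult norm_powr_real_powr)
      qed (use M in auto)
      also have "norm (- \<i> * of_real R - \<i> * of_real R) = 2 * R"
      proof -
        have "- \<i> * of_real R - \<i> * of_real R = - (2 * R) * \<i>" by (simp add: algebra_simps)
        thus ?thesis using R by (simp add: norm_mult)
      qed
      finally have "ln (real N) * norm q \<le> M * (2 * R)"
        using lnN N by (simp add: norm_mult Ln_of_nat)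
      thus ?thesis using lnN by (simp add: field_simps)
    qed
    have bd: "norm (p - t) \<le> 2 / R\<^sup>2 * R * (b - a)"
      if int: "(P has_contour_integral p) (part_circlepath 0 R a b)" "(T has_contour_integral t) (part_circlepath 0 R a b)"
        and ab: "a \<le> b" and im: "\<And>z. z \<in> path_image (part_circlepath 0 R a b) \<Longrightarrow> z \<in> sphere 0 R \<and> Re z \<ge> 0" for p t a b
    \<comment> \<open>The tail bound carries \<open>1 / Re z\<close>, which fails at the two points
      on the imaginary axis; leaving out finitely many points does not affect the bound of the
      integral. Elsewhere \<open>1 / Re z\<close> cancels against the kernel.\<close>
    proof (rule has_contour_integral_bound_part_circlepath_strong[OF has_contour_integral_diff[OF int], of "{\<i> * of_real R, - \<i> * of_real R}"])
      fix z assume "z \<in> path_image (part_circlepath 0 R a b) - {\<i> * of_real R, - \<i> * of_real R}"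
      hence z: "norm z = R" "Re z \<ge> 0" "z \<noteq> \<i> * of_real R" "z \<noteq> - \<i> * of_real R" using im[of z] by auto
      have "Re z \<noteq> 0" using z(1,3,4) by (rule norm_eq_Re_nonzero)
      hence rz: "Re z > 0" using z by auto
      have z0: "z \<noteq> 0" using rz by auto
      have "P z - T z = (z / zeta1 (1 + z) - moebius_psum N z) * (of_nat N powr z * newman_weight R z / z)"
      proof -
        have "k * w / Y - m * w * k / z = (z / Y - m) * (w * k / z)" if "Y \<noteq> 0" for k w Y m
          using z0 that by (simp add: field_simps)
        from this[OF zeta1_nonzero[of "1 + z"]] show ?thesis using rz by (simp add: P_def T_def H_def)
      qed
      hence "norm (P z - T z) = norm (z / zeta1 (1 + z) - moebius_psum N z) * (real N powr Re z * (2 * \<bar>Re z\<bar>) / R\<^sup>2)"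
        by (simp only: newman_kernel_norm[OF z(1) R N] norm_mult)
      also have "\<dots> \<le> (real N powr (- Re z) / Re z) * (real N powr Re z * (2 * \<bar>Re z\<bar>) / R\<^sup>2)"
        by (intro mult_right_mono moebius_tail_bound rz N) auto
      also have "\<dots> = (real N powr (- Re z) * real N powr Re z) * (2 / R\<^sup>2)" using rz by simp
      also have "real N powr (- Re z) * real N powr Re z = 1" using N by (simp flip: powr_add)
      finally show "norm (P z - T z) \<le> 2 / R\<^sup>2" by simp
    qed (use R ab in auto)
    have b1: "norm (p1 - t1) \<le> pi / R"
      using bd[OF p1 t(1)] im R by (simp add: power2_eq_square)
    have b3: "norm (p3 - t3) \<le> pi / R"
      using bd[OF p3 t(3)] im R by (simp add: power2_eq_square)
    have b2: "norm t2 \<le> (2 / R\<^sup>2 + 2 / (R * real N)) * R * (3/2*pi - pi/2)"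
    proof (rule has_contour_integral_bound_part_circlepath_strong[OF t(2), of "{\<i> * of_real R, - \<i> * of_real R}"])
      fix z assume "z \<in> path_image ?arc2 - {\<i> * of_real R, - \<i> * of_real R}"
      hence z: "norm z = R" "Re z \<le> 0" "z \<noteq> \<i> * of_real R" "z \<noteq> - \<i> * of_real R" using im2[of z] by auto
      have "Re z \<noteq> 0" using z(1,3,4) by (rule norm_eq_Re_nonzero)
      hence rz: "Re z < 0" using z by auto
      define y where "y = - Re z"
      have y: "y > 0" "y \<le> R" using rz abs_Re_le_cmod[of z] z(1) by (auto simp: y_def)
      have "norm (T z) = norm (moebius_psum N z) * (real N powr Re z * (2 * \<bar>Re z\<bar>) / R\<^sup>2)"
      proof -
        have "T z = moebius_psum N z * (of_nat N powr z * newman_weight R z / z)" by (simp add: T_def)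
        thus ?thesis by (simp only: newman_kernel_norm[OF z(1) R N] norm_mult)
      qed
      also have "\<dots> \<le> (real N powr (- Re z) * (1 / (- Re z) + 1 / real N)) * (real N powr Re z * (2 * \<bar>Re z\<bar>) / R\<^sup>2)"
        by (intro mult_right_mono moebius_psum_bound rz N) auto
      also have "\<dots> = (real N powr y * real N powr (- y)) * ((1 / y + 1 / real N) * (2 * y) / R\<^sup>2)"
        using y by (simp add: y_def)
      also have "real N powr y * real N powr (- y) = 1" using N by (simp flip: powr_add)
      also have "1 * ((1 / y + 1 / real N) * (2 * y) / R\<^sup>2) = 2 / R\<^sup>2 + (2 * y) / (R\<^sup>2 * real N)"
        using y R N by (simp add: field_simps)
      also have "\<dots> \<le> 2 / R\<^sup>2 + (2 * R) / (R\<^sup>2 * real N)"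
        using y by (intro add_left_mono divide_right_mono) auto
      also have "(2 * R) / (R\<^sup>2 * real N) = 2 / (R * real N)" using R by (simp add: power2_eq_square)
      finally show "norm (T z) \<le> 2 / R\<^sup>2 + 2 / (R * real N)" .
    qed (use R in auto)
    \<comment> \<open>Subtracting \<open>p3 + (p1 + q) = 0\<close> replaces \<open>t1 + t3\<close>
      by differences on the right half circle and the integral \<open>q\<close> along the
      diameter.\<close>
    have "2 * of_real pi * \<i> * moebius_psum N 0 = t2 - (p1 - t1) - (p3 - t3) - q"
      using t(4) pq by (simp add: algebra_simps eq_neg_iff_add_eq_0)
    hence "2 * pi * norm (moebius_psum N 0) = norm (t2 - (p1 - t1) - (p3 - t3) - q)"
      by (metis (no_types, opaque_lifting) abs_of_pos mult.right_neutral norm_ii norm_mult norm_numeral norm_of_real pi_gt_zero)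
    also have "\<dots> \<le> norm t2 + norm (p1 - t1) + norm (p3 - t3) + norm q"
      by (smt (verit) norm_triangle_ineq4)
    also have "\<dots> \<le> (2 / R\<^sup>2 + 2 / (R * real N)) * R * (3/2*pi - pi/2) + pi / R + pi / R + 2 * R * M / ln (real N)"
      using b1 b2 b3 bq by linarith
    also have "\<dots> = 2 * pi * (2 / R + 1 / real N + (R * M / pi) / ln (real N))"
      using R N lnN by (simp add: field_simps power2_eq_square)
    finally show ?thesis by simp
  qed
  thus ?thesis by blast
qed

theorem sum_moebius_over_n: "(\<lambda>N. \<Sum>n=1..N. moebius n / real n) \<longlonglongrightarrow> 0"
proof -
  have eq: "norm (moebius_psum N 0) = \<bar>\<Sum>n=1..N. moebius n / real n\<bar>" for N
  proof -
    have "moebius_psum N 0 = of_real (\<Sum>n=1..N. moebius n / real n)"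
      unfolding moebius_psum_def of_real_sum
      by (intro sum.cong) (auto simp: powr_def exp_minus divide_inverse exp_of_real)
    thus ?thesis by (simp only: norm_of_real)
  qed
  show ?thesis
  proof (rule tendstoI)
    fix e :: real assume e: "e > 0"
    \<comment> \<open>The radius is fixed first, so that \<open>2 / R = e / 2\<close>. The constant
      \<open>M\<close> depends on \<open>R\<close> without any control, but its contribution is
      divided by \<open>ln N\<close>.\<close>
    define R where "R = 4 / e"
    have R: "R > 0" using e by (simp add: R_def)
    obtain M where M: "\<forall>N\<ge>2. norm (moebius_psum N 0) \<le> 2 / R + 1 / real N + M / ln (real N)"
      using moebius_psum_newman_bound[OF R] ..
    have MN: "\<bar>\<Sum>n=1..N. moebius n / real n\<bar> \<le> 2 / R + 1 / real N + M / ln (real N)" if "N \<ge> 2" for N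
      using M that unfolding eq by blast
    have "(\<lambda>N. 1 / real N + M / ln (real N)) \<longlonglongrightarrow> 0" by real_asymp
    hence "eventually (\<lambda>N. 1 / real N + M / ln (real N) < e / 2) sequentially"
      using e by (intro order_tendstoD) auto
    thus "eventually (\<lambda>N. dist (\<Sum>n=1..N. moebius n / real n) 0 < e) sequentially"
      using eventually_ge_at_top[of 2]
    proof eventually_elim
      case (elim N)
      have "2 / R = e / 2" using e by (simp add: R_def)
      thus ?case using MN[OF elim(2)] elim(1) unfolding dist_real_def diff_0_right by linarith
    qed
  qed
qed

section \<open>The prime number theorem and the mean number of carries\<close>

text \<open>This is f(n) = o(n), phrased with an additive constant so that the bound holds for every
  \<open>n\<close>. It can then be applied at once to all arguments up to \<open>x\<close>, such as
  \<open>x div b\<close>, however small.\<close>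

definition sublinear :: "(nat \<Rightarrow> real) \<Rightarrow> bool" where
  "sublinear f \<longleftrightarrow> (\<forall>e>0. \<exists>C. \<forall>n. \<bar>f n\<bar> \<le> e * real n + C)"

lemma sublinearD:
  assumes "sublinear f" "e > 0"
  shows "\<exists>C. C \<ge> 0 \<and> (\<forall>n. \<bar>f n\<bar> \<le> e * real n + C)"
proof -
  obtain C where C: "\<forall>n. \<bar>f n\<bar> \<le> e * real n + C" using assms unfolding sublinear_def by blast
  moreover have "C \<ge> 0" using spec[OF C, of 0] by simp
  ultimately show ?thesis by blast
qed

lemma sublinear_add:
  assumes "sublinear f" "sublinear g"
  shows "sublinear (\<lambda>n. f n + g n)"
  unfolding sublinear_def
proof (intro allI impI)
  fix e :: real assume "e > 0"
  hence e: "e / 2 > 0" by simp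
  obtain C where C: "C \<ge> 0" "\<forall>n. \<bar>f n\<bar> \<le> e / 2 * real n + C" using sublinearD[OF assms(1) e] by blast
  obtain D where D: "D \<ge> 0" "\<forall>n. \<bar>g n\<bar> \<le> e / 2 * real n + D" using sublinearD[OF assms(2) e] by blast
  have "\<bar>f n + g n\<bar> \<le> e * real n + (C + D)" for n
    using spec[OF C(2), of n] spec[OF D(2), of n] by (simp add: algebra_simps)
  thus "\<exists>C. \<forall>n. \<bar>f n + g n\<bar> \<le> e * real n + C" by blast
qed

lemma sublinear_minus: "sublinear f \<Longrightarrow> sublinear (\<lambda>n. - f n)"
  by (simp add: sublinear_def)

lemma sublinear_diff: "sublinear f \<Longrightarrow> sublinear g \<Longrightarrow> sublinear (\<lambda>n. f n - g n)"
  using sublinear_add[OF _ sublinear_minus, of f g] by simp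

lemma sublinear_bounded: "(\<And>n. \<bar>f n\<bar> \<le> C) \<Longrightarrow> sublinear f"
  unfolding sublinear_def
proof (intro allI impI)
  fix e :: real assume e: "e > 0" and f: "\<And>n. \<bar>f n\<bar> \<le> C"
  have "\<bar>f n\<bar> \<le> e * real n + C" for n
    using f[of n] e by (intro order_trans[OF f]) auto
  thus "\<exists>C. \<forall>n. \<bar>f n\<bar> \<le> e * real n + C" by blast
qed

lemma sublinear_of_tendsto:
  assumes "(\<lambda>n. f n / real n) \<longlonglongrightarrow> 0"
  shows "sublinear f"
  unfolding sublinear_def
proof (intro allI impI)
  fix e :: real assume e: "e > 0"
  obtain N where N: "\<And>n. n \<ge> N \<Longrightarrow> \<bar>f n / real n\<bar> < e"
    using tendstoD[OF assms e] unfolding eventually_sequentially dist_real_def by auto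
  have "\<bar>f n\<bar> \<le> e * real n + (\<Sum>k\<le>N. \<bar>f k\<bar>)" for n
  proof (cases "n \<le> N")
    case True
    hence "\<bar>f n\<bar> \<le> (\<Sum>k\<le>N. \<bar>f k\<bar>)" by (intro member_le_sum) auto
    thus ?thesis using e by (simp add: add_increasing)
  next
    case False
    hence "\<bar>f n\<bar> \<le> e * real n" using N[of n] by (simp add: field_simps)
    thus ?thesis by (simp add: add_increasing2 sum_nonneg)
  qed
  thus "\<exists>C. \<forall>n. \<bar>f n\<bar> \<le> e * real n + C" by blast
qed

lemma sublinear_sqrt_bound:
  assumes "\<And>n. \<bar>f n\<bar> \<le> C * sqrt (real n) + D"
  shows "sublinear f"
proof (rule sublinear_of_tendsto)
  have "(\<lambda>n. (C * sqrt (real n) + D) / real n) \<longlonglongrightarrow> 0" by real_asymp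
  moreover have "norm (f n / real n) \<le> (C * sqrt (real n) + D) / real n" for n
    using assms[of n] by (simp add: divide_right_mono)
  hence "eventually (\<lambda>n. norm (f n / real n) \<le> (C * sqrt (real n) + D) / real n) sequentially"
    by (intro always_eventually allI)
  ultimately show "(\<lambda>n. f n / real n) \<longlonglongrightarrow> 0"
    by (rule Lim_null_comparison[rotated])
qed

lemma sublinear_partial_sum:
  assumes "a \<longlonglongrightarrow> (0::real)"
  shows "sublinear (\<lambda>n. \<Sum>k<n. a k)"
  unfolding sublinear_def
proof (intro allI impI)
  fix e :: real assume e: "e > 0"
  obtain N where N: "\<And>n. n \<ge> N \<Longrightarrow> \<bar>a n\<bar> < e"
    using tendstoD[OF assms e] unfolding eventually_sequentially dist_real_def by auto
  have "\<bar>\<Sum>k<n. a k\<bar> \<le> e * real n + (\<Sum>k<N. \<bar>a k\<bar>)" for n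
  proof -
    have "\<bar>\<Sum>k<n. a k\<bar> \<le> (\<Sum>k<n. \<bar>a k\<bar>)" by (rule sum_abs)
    also have "\<dots> \<le> (\<Sum>k<n. e + (if k < N then \<bar>a k\<bar> else 0))"
      using N e by (intro sum_mono) (auto simp: not_less less_imp_le)
    also have "\<dots> = e * real n + (\<Sum>k\<in>{..<n} \<inter> {..<N}. \<bar>a k\<bar>)"
      by (simp add: sum.distrib sum.If_cases lessThan_def)
    also have "(\<Sum>k\<in>{..<n} \<inter> {..<N}. \<bar>a k\<bar>) \<le> (\<Sum>k<N. \<bar>a k\<bar>)" by (intro sum_mono2) auto
    finally show ?thesis by simp
  qed
  thus "\<exists>C. \<forall>n. \<bar>\<Sum>k<n. a k\<bar> \<le> e * real n + C" by blast
qed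

text \<open>Partial summation: with \<open>A\<close> tending to 0, the term \<open>N * A N\<close>
  is o(N), and so is the sum of the earlier \<open>A n\<close>, by Cesaro.\<close>

lemma sublinear_sum_moebius: "sublinear (\<lambda>N. \<Sum>n=1..N. moebius n)"
proof -
  define A where "A = (\<lambda>N. \<Sum>n=1..N. moebius n / real n)"
  have A: "A \<longlonglongrightarrow> 0" unfolding A_def by (rule sum_moebius_over_n)
  have eq: "(\<Sum>n=1..N. moebius n) = real N * A N - (\<Sum>n<N. A n)" for N
  proof (induction N)
    case (Suc N)
    have "A (Suc N) = A N + moebius (Suc N) / real (Suc N)" by (simp add: A_def)
    hence "real (Suc N) * A (Suc N) = real (Suc N) * A N + moebius (Suc N)" by (simp add: field_simps)
    with Suc show ?case by (simp add: algebra_simps)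
  qed simp
  have "sublinear (\<lambda>N. real N * A N)"
  proof (rule sublinear_of_tendsto)
    have "eventually (\<lambda>n. A n = real n * A n / real n) sequentially"
      using eventually_gt_at_top[of 0] by eventually_elim simp
    thus "(\<lambda>n. real n * A n / real n) \<longlonglongrightarrow> 0" by (rule Lim_transform_eventually[OF A])
  qed
  from sublinear_diff[OF this sublinear_partial_sum[OF A]] show ?thesis unfolding eq .
qed

section \<open>Elementary asymptotics of harmonic numbers, factorials and divisor sums\<close>

lemma harm_bounds_euler:
  assumes n: "n > 0"
  shows "harm n - ln (real n) \<ge> euler_mascheroni" "harm n - ln (real n) \<le> euler_mascheroni + 1 / real n"
proof -
  have "eventually (\<lambda>m. harm m - ln (real m) \<le> harm n - ln (real n)) sequentially"
    using eventually_ge_at_top[of n] by eventually_elim (use n euler_mascheroni_sequence_decreasing in auto)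
  thus "harm n - ln (real n) \<ge> euler_mascheroni"
    by (intro tendsto_upperbound[OF euler_mascheroni_LIMSEQ]) auto
  \<comment> \<open>Subtracting \<open>1 / n\<close> turns the decreasing sequence into an
    increasing one with the same limit, which gives the upper bound.\<close>
  define c where "c = (\<lambda>n. harm (Suc n) - ln (real (Suc n)) - 1 / real (Suc n) :: real)"
  have "incseq c"
  proof (rule incseq_SucI)
    fix m
    have "ln (real (Suc (Suc m)) / real (Suc m)) \<le> real (Suc (Suc m)) / real (Suc m) - 1" by (intro ln_le_minus_one) auto
    also have "\<dots> = 1 / real (Suc m)" by (simp add: field_simps)
    finally show "c m \<le> c (Suc m)" unfolding c_def
      by (simp add: ln_div harm_Suc[of "Suc m"] inverse_eq_divide del: of_nat_Suc)
  qed
  moreover have "c \<longlonglongrightarrow> euler_mascheroni - 0" unfolding c_def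
    by (intro tendsto_diff LIMSEQ_Suc[OF euler_mascheroni_LIMSEQ]) real_asymp
  ultimately have "c (n - 1) \<le> euler_mascheroni" by (intro incseq_le) auto
  thus "harm n - ln (real n) \<le> euler_mascheroni + 1 / real n" using n by (simp add: c_def)
qed

text \<open>A weak Stirling formula. Passing from \<open>n\<close> to \<open>n + 1\<close> changes
  the error by 1 - n ln (1 + 1/n), which lies between 0 and 1 / (n + 1); at \<open>n = 1\<close> the
  error equals \<open>harm 1\<close>.\<close>

lemma ln_fact_bounds:
  assumes "n > 0"
  shows "ln (fact n) - (real n * ln (real n) - real n) \<ge> 0" "ln (fact n) - (real n * ln (real n) - real n) \<le> harm n"
proof -
  have "ln (fact n) - (real n * ln (real n) - real n) \<ge> 0 \<and> ln (fact n) - (real n * ln (real n) - real n) \<le> harm n"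
    using assms
  proof (induction n rule: nat_induct_non_zero)
    case (Suc n)
    define u where "u = ln (real (Suc n)) - ln (real n)"
    have "u = ln (real (Suc n) / real n)" using Suc by (simp add: u_def ln_div)
    also have "\<dots> \<le> real (Suc n) / real n - 1" using Suc by (intro ln_le_minus_one) auto
    also have "\<dots> = 1 / real n" using Suc by (simp add: field_simps)
    finally have u1: "real n * u \<le> 1" using Suc by (simp add: field_simps)
    have "- u = ln (real n / real (Suc n))" using Suc by (simp add: u_def ln_div)
    also have "\<dots> \<le> real n / real (Suc n) - 1" using Suc by (intro ln_le_minus_one) auto
    also have "\<dots> = - (1 / real (Suc n))" by (simp add: field_simps)
    finally have "real n * (1 / real (Suc n)) \<le> real n * u" by (intro mult_left_mono) auto
    moreover have "1 - real n * (1 / real (Suc n)) = 1 / real (Suc n)" by (simp add: field_simps)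
    ultimately have u2: "1 - real n * u \<le> 1 / real (Suc n)" by linarith
    have "ln (fact (Suc n) :: real) = ln (real (Suc n)) + ln (fact n)" 
      by (simp add: ln_mult del: of_nat_Suc)
    hence "ln (fact (Suc n)) - (real (Suc n) * ln (real (Suc n)) - real (Suc n)) = (ln (fact n) - (real n * ln (real n) - real n)) + (1 - real n * u)"
      by (simp add: u_def algebra_simps)
    thus ?case using Suc.IH u1 u2 by (simp add: harm_Suc inverse_eq_divide)
  qed (simp add: harm_def)
  thus "ln (fact n) - (real n * ln (real n) - real n) \<ge> 0" "ln (fact n) - (real n * ln (real n) - real n) \<le> harm n" by auto
qed

text \<open>Both sides count lattice points with a b at most \<open>y\<close>. Since (s + 1)^2 > y,
  each has a coordinate at most \<open>s\<close>; the two symmetric regions \<open>A\<close> and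
  \<open>B\<close> overlap in the full square of side \<open>s\<close>.\<close>

lemma dirichlet_hyperbola:
  fixes y s :: nat
  assumes s: "s * s \<le> y" "y < Suc s * Suc s"
  shows "(\<Sum>m=1..y. y div m) + s * s = 2 * (\<Sum>m=1..s. y div m)"
proof -
  define A where "A = (SIGMA a:{1..s}. {1..y div a})"
  define B where "B = (\<lambda>(a,b). (b,a)) ` A"
  have "s \<le> y" using s(1) by (metis le_square le_trans)
  have memA: "(a,b) \<in> A \<longleftrightarrow> 1 \<le> a \<and> a \<le> s \<and> 1 \<le> b \<and> a * b \<le> y" for a b
    by (auto simp: A_def less_eq_div_iff_mult_less_eq mult.commute)
  have memB: "(a,b) \<in> B \<longleftrightarrow> 1 \<le> b \<and> b \<le> s \<and> 1 \<le> a \<and> a * b \<le> y" for a b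
    using memA[of b a] by (force simp: B_def mult.commute)
  have P: "(SIGMA a:{1..y}. {1..y div a}) = A \<union> B"
  proof (rule Set.set_eqI)
    fix z :: "nat \<times> nat"
    obtain a b where z: "z = (a, b)" by (cases z)
    have "(a, b) \<in> (SIGMA a:{1..y}. {1..y div a}) \<longleftrightarrow> 1 \<le> a \<and> 1 \<le> b \<and> a \<le> y \<and> a * b \<le> y"
      by (auto simp: less_eq_div_iff_mult_less_eq mult.commute)
    also have "\<dots> \<longleftrightarrow> (a, b) \<in> A \<union> B"
    proof -
      have "a \<le> y" if "1 \<le> b" "a * b \<le> y" using that by (metis mult_le_mono2 mult.right_neutral le_trans)
      moreover have "a \<le> s \<or> b \<le> s" if "a * b \<le> y"
      proof (rule ccontr)
        assume "\<not> (a \<le> s \<or> b \<le> s)"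
        hence "Suc s * Suc s \<le> a * b" by (intro mult_le_mono) auto
        thus False using that s by simp
      qed
      ultimately show ?thesis by (auto simp: memA memB)
    qed
    finally show "z \<in> (SIGMA a:{1..y}. {1..y div a}) \<longleftrightarrow> z \<in> A \<union> B" unfolding z .
  qed
  have AB: "A \<inter> B = {1..s} \<times> {1..s}"
  proof (rule Set.set_eqI)
    fix z :: "nat \<times> nat"
    obtain a b where z: "z = (a, b)" by (cases z)
    have "a * b \<le> y" if "a \<le> s" "b \<le> s" using mult_le_mono[OF that] s(1) by linarith
    thus "z \<in> A \<inter> B \<longleftrightarrow> z \<in> {1..s} \<times> {1..s}" unfolding z by (auto simp: memA memB)
  qed
  have finA: "finite A" by (simp add: A_def)
  have finB: "finite B" using finA by (simp add: B_def)
  have cardA: "card A = (\<Sum>m=1..s. y div m)" by (simp add: A_def)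
  have cardB: "card B = card A" unfolding B_def by (intro card_image) (auto simp: inj_on_def)
  have "(\<Sum>m=1..y. y div m) = card (A \<union> B)" by (simp flip: P)
  moreover have "card (A \<union> B) + card (A \<inter> B) = card A + card B" using card_Un_Int[OF finA finB] by simp
  ultimately show ?thesis using cardA cardB by (simp add: AB)
qed

text \<open>
  The summatory function of \<open>ln - d + 2 \<gamma>\<close>, where \<open>d\<close> counts divisors. This is the Dirichlet
  convolution of \<open>1\<close> with \<open>\<Lambda> - 1\<close> (plus \<open>2 \<gamma>\<close> at \<open>n = 1\<close>), so inverting it with \<open>\<mu>\<close> gives
  the error term of \<open>\<psi>\<close>.
\<close>
definition div_error :: "nat \<Rightarrow> real" where
  "div_error y = ln (fact y) - real (\<Sum>m=1..y. y div m) + 2 * euler_mascheroni * real y"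

text \<open>With \<open>s\<close> the integer square root, ln y! is y ln y - y + O(s) and the
  divisor sum is 2 y (ln s + gamma) - s^2 + O(s). The main terms cancel because y - s^2 and y (ln y
  - 2 ln s) are both O(s).\<close>

lemma div_error_bound: "\<exists>C. C \<ge> 0 \<and> (\<forall>y. \<bar>div_error y\<bar> \<le> C * sqrt (real y))"
proof (intro exI[of _ 30] conjI allI)
  fix y :: nat
  define \<gamma> where "\<gamma> = (euler_mascheroni :: real)"
  show "\<bar>div_error y\<bar> \<le> 30 * sqrt (real y)"
  proof (cases "y = 0")
    case False
    define s where "s = floor_sqrt y"
    have s: "s * s \<le> y" "y < Suc s * Suc s"
      using floor_sqrt_power2_le[of y] Suc_floor_sqrt_power2_gt[of y] by (simp_all add: s_def power2_eq_square)
    have s0: "s > 0" using s(2) False by (cases s) auto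
    have srt: "real s \<le> sqrt (real y)" using s(1) by (intro real_le_rsqrt) (simp add: power2_eq_square flip: of_nat_mult)
    have y4: "real y \<le> real s * real s + 2 * real s"
    proof -
      have "y \<le> s * s + 2 * s" using s(2) by simp
      thus ?thesis by (metis of_nat_add of_nat_le_iff of_nat_mult of_nat_numeral)
    qed
    have ys: "real s * real s \<le> real y" using s(1) by (metis of_nat_le_iff of_nat_mult)
    have lny1: "2 * ln (real s) \<le> ln (real y)"
      using ys s0 False ln_mono[of "real s * real s" "real y"] by (simp add: ln_mult)
    have lny2: "real y * (ln (real y) - 2 * ln (real s)) \<le> 6 * real s"
    proof -
      have "ln (real y) - 2 * ln (real s) = ln (real y / (real s * real s))" using False s0 by (simp add: ln_div ln_mult)
      also have "\<dots> \<le> real y / (real s * real s) - 1" using False s0 by (intro ln_le_minus_one) auto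
      also have "\<dots> \<le> (real s * real s + 2 * real s) / (real s * real s) - 1" using y4 by (intro diff_right_mono divide_right_mono) auto
      also have "\<dots> = 2 / real s" using s0 by (simp add: field_simps)
      finally have "real y * (ln (real y) - 2 * ln (real s)) \<le> real y * (2 / real s)" by (intro mult_left_mono) auto
      also have "\<dots> \<le> (real s * real s + 2 * real s) * (2 / real s)" using y4 by (intro mult_right_mono) auto
      also have "\<dots> = 2 * real s + 4" using s0 by (simp add: field_simps)
      also have "\<dots> \<le> 6 * real s" using s0 by simp
      finally show ?thesis .
    qed
    have "real (\<Sum>m=1..y. y div m) + real s * real s = 2 * (\<Sum>m=1..s. real (y div m))"
      using dirichlet_hyperbola[OF s] by (metis (no_types, lifting) of_nat_add of_nat_mult of_nat_numeral of_nat_sum sum.cong)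
    hence D: "real (\<Sum>m=1..y. y div m) = 2 * (\<Sum>m=1..s. real (y div m)) - real s * real s" by linarith
    have d1: "(\<Sum>m=1..s. real (y div m)) \<le> real y * harm s"
    proof -
      have "(\<Sum>m=1..s. real (y div m)) \<le> (\<Sum>m=1..s. real y / real m)"
        by (intro sum_mono of_nat_div_le_of_nat)
      thus ?thesis by (simp add: harm_def sum_distrib_left divide_inverse)
    qed
    have d2: "(\<Sum>m=1..s. real (y div m)) \<ge> real y * harm s - real s"
    proof -
      have "real y / real m - 1 \<le> real (y div m)" for m
      proof (cases "m = 0")
        case False
        have "real (y mod m) / real m \<le> 1" using False by simp
        thus ?thesis using of_nat_of_nat_div_aux[of y m, where ?'a = real] by linarith
      qed simp
      hence "(\<Sum>m=1..s. real y / real m - 1) \<le> (\<Sum>m=1..s. real (y div m))"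
        by (intro sum_mono) 
      thus ?thesis by (simp add: harm_def sum_distrib_left divide_inverse sum_subtractf)
    qed
    have h1: "real y * (ln (real s) + \<gamma>) \<le> real y * harm s"
      using harm_bounds_euler(1)[OF s0] by (intro mult_left_mono) (auto simp: \<gamma>_def)
    have h2: "real y * harm s \<le> real y * (ln (real s) + \<gamma>) + 3 * real s"
    proof -
      have "real y * harm s \<le> real y * (ln (real s) + \<gamma> + 1 / real s)"
        using harm_bounds_euler(2)[OF s0] by (intro mult_left_mono) (auto simp: \<gamma>_def)
      also have "\<dots> = real y * (ln (real s) + \<gamma>) + real y * (1 / real s)" by (simp add: algebra_simps)
      also have "real y * (1 / real s) \<le> (real s * real s + 2 * real s) * (1 / real s)" using y4 by (intro mult_right_mono) auto
      also have "\<dots> = real s + 2" using s0 by (simp add: field_simps)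
      also have "\<dots> \<le> 3 * real s" using s0 by simp
      finally show ?thesis by simp
    qed
    have y0: "y > 0" using False by simp
    have harm_y: "harm y \<le> 6 * real s"
    proof -
      have "ln (real y) \<le> 2 * ln (real s + 1)"
      proof -
        have "real y \<le> (real s + 1) * (real s + 1)" using y4 by (simp add: algebra_simps)
        hence "ln (real y) \<le> ln ((real s + 1) * (real s + 1))" using y0 by (intro ln_mono) auto
        thus ?thesis by (simp add: ln_mult)
      qed
      moreover have "ln (real s + 1) \<le> real s" using ln_le_minus_one[of "real s + 1"] by simp
      moreover have "harm y \<le> ln (real y) + \<gamma> + 1 / real y" using harm_bounds_euler(2)[OF y0] by (simp add: \<gamma>_def)
      moreover have "1 / real y \<le> 1" using y0 by simp
      moreover have "\<gamma> \<le> 1" using euler_mascheroni_less_13_over_22 by (simp add: \<gamma>_def)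
      moreover have "real s \<ge> 1" using s0 by simp
      ultimately show ?thesis by linarith
    qed
    define T where "T = ln (fact y) - (real y * ln (real y) - real y)"
    have T: "0 \<le> T" "T \<le> 6 * real s" using ln_fact_bounds[OF y0] harm_y unfolding T_def by linarith+
    define W where "W = (\<Sum>m=1..s. real (y div m))"
    define L where "L = real y * (ln (real y) - 2 * ln (real s))"
    have L: "0 \<le> L" "L \<le> 6 * real s" using lny1 lny2 by (simp_all add: L_def)
    have "div_error y = T + real y * ln (real y) - real y - 2 * W + real s * real s + 2 * \<gamma> * real y"
      unfolding div_error_def D T_def W_def \<gamma>_def by simp
    also have "\<dots> = T + L - (real y - real s * real s) - 2 * (W - real y * (ln (real s) + \<gamma>))"
      by (simp add: L_def algebra_simps)
    finally have E: "div_error y = T + L - (real y - real s * real s) - 2 * (W - real y * (ln (real s) + \<gamma>))" .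
    have "\<bar>div_error y\<bar> \<le> 30 * real s"
    proof -
      define X where "X = real y * (ln (real s) + \<gamma>)"
      have "- real s \<le> W - X" "W - X \<le> 3 * real s"
        using d1 d2 h1 h2 unfolding W_def X_def by linarith+
      moreover have "0 \<le> real y - real s * real s" "real y - real s * real s \<le> 2 * real s" using ys y4 by linarith+
      moreover have "real s \<ge> 0" by simp
      \<comment> \<open>The three inputs give a value between -8 r and 14 r; 30 is a generous
        constant.\<close>
      moreover have "\<bar>t + l - v - 2 * w\<bar> \<le> 30 * r"
        if "- r \<le> w" "w \<le> 3 * r" "0 \<le> v" "v \<le> 2 * r" "0 \<le> r" "0 \<le> t" "t \<le> 6 * r" "0 \<le> l" "l \<le> 6 * r" for t l v w r :: real
        using that by linarith
      ultimately show ?thesis using T L unfolding E X_def[symmetric] by blast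
    qed
    thus ?thesis using srt by linarith
  qed (simp add: div_error_def)
qed simp

section \<open>Moebius inversion and the prime number theorem for psi\<close>

lemma sum_divisors_conv_pairs:
  fixes h :: "nat \<Rightarrow> nat \<Rightarrow> 'a :: comm_monoid_add"
  shows "(\<Sum>n=1..y. \<Sum>d | d dvd n. h d (n div d)) = (\<Sum>a=1..y. \<Sum>b=1..y div a. h a b)"
proof -
  have aux: "b \<le> y" if "0 < k" "b * k \<le> y" for b k
    using that by (metis One_nat_def Suc_leI le_trans mult.right_neutral mult_le_mono2)
  have "(\<Sum>n=1..y. \<Sum>d | d dvd n. h d (n div d)) = (\<Sum>(n,d)\<in>(SIGMA n:{1..y}. {d. d dvd n}). h d (n div d))"
    by (intro sum.Sigma) auto
  also have "\<dots> = (\<Sum>(a,b)\<in>(SIGMA a:{1..y}. {1..y div a}). h a b)"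
    by (rule sum.reindex_bij_witness[where i = "\<lambda>(a,b). (a * b, a)" and j = "\<lambda>(n,d). (d, n div d)"])
       (auto simp: less_eq_div_iff_mult_less_eq mult.commute div_le_mono Suc_le_eq dvd_div_eq_0_iff intro: aux dest: dvd_imp_le elim!: dvdE)
  also have "\<dots> = (\<Sum>a=1..y. \<Sum>b=1..y div a. h a b)"
    by (intro sum.Sigma[symmetric]) auto
  finally show ?thesis .
qed

text \<open>Works for arbitrary \<open>F\<close> because nested integer quotients compose:
  \<open>x div a div c = x div (a * c)\<close>. Collecting terms by the product leaves only index
  1.\<close>

lemma moebius_inversion_sum:
  fixes F G :: "nat \<Rightarrow> real"
  assumes G: "\<And>y. G y = (\<Sum>c=1..y. F (y div c))"
  shows "x > 0 \<Longrightarrow> F x = (\<Sum>a=1..x. moebius a * G (x div a))"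
proof -
  assume x: "x > 0"
  have "(\<Sum>a=1..x. moebius a * G (x div a)) = (\<Sum>a=1..x. \<Sum>c=1..x div a. moebius a * F (x div (a * c)))"
    by (simp add: G sum_distrib_left div_mult2_eq)
  also have "\<dots> = (\<Sum>n=1..x. \<Sum>d | d dvd n. moebius d * F (x div (d * (n div d))))"
    by (rule sum_divisors_conv_pairs[symmetric])
  also have "\<dots> = (\<Sum>n=1..x. (\<Sum>d | d dvd n. moebius d) * F (x div n))"
    by (auto simp: sum_distrib_right intro!: sum.cong)
  also have "\<dots> = (\<Sum>n=1..x. if n = 1 then F (x div n) else 0)"
    by (intro sum.cong) (auto simp: sum_moebius_divisors)
  also have "\<dots> = F x" using x by (simp add: sum.delta)
  finally show ?thesis ..
qed

definition psi :: "nat \<Rightarrow> real" where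
  "psi x = (\<Sum>n=1..x. mangoldt n)"

lemma sum_psi_div: "(\<Sum>c=1..y. psi (y div c)) = ln (fact y)"
proof -
  have "(\<Sum>n=1..y. \<Sum>d | d dvd n. mangoldt (n div d)) = (\<Sum>c=1..y. \<Sum>b=1..y div c. mangoldt b :: real)"
    by (rule sum_divisors_conv_pairs[of "\<lambda>d e. mangoldt e"])
  moreover have "(\<Sum>d | d dvd n. mangoldt (n div d)) = ln (real n)" if "n \<in> {1..y}" for n
  proof -
    have "(\<Sum>d | d dvd n. mangoldt (n div d)) = (\<Sum>d | d dvd n. mangoldt d :: real)"
      using that by (intro sum.reindex_bij_witness[where i = "\<lambda>d. n div d" and j = "\<lambda>d. n div d"]) auto
    thus ?thesis using that by (simp add: mangoldt_sum)
  qed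
  ultimately have "(\<Sum>c=1..y. psi (y div c)) = (\<Sum>n=1..y. ln (real n))" by (simp add: psi_def)
  also have "\<dots> = ln (fact y)"
    by (induction y) (simp_all add: ln_mult add.commute del: of_nat_Suc)
  finally show ?thesis .
qed

lemma sum_inverse_sqrt_le: "(\<Sum>a=1..n. 1 / sqrt (real a)) \<le> 2 * sqrt (real n)"
proof (induction n)
  case (Suc n)
  have "(sqrt (real (Suc n)) - sqrt (real n)) * (sqrt (real (Suc n)) + sqrt (real n)) = 1"
    by (simp add: algebra_simps flip: power2_eq_square)
  moreover have "(sqrt (real (Suc n)) - sqrt (real n)) * (sqrt (real (Suc n)) + sqrt (real n))
     \<le> (sqrt (real (Suc n)) - sqrt (real n)) * (2 * sqrt (real (Suc n)))"
    by (intro mult_left_mono) auto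
  ultimately have "1 \<le> (sqrt (real (Suc n)) - sqrt (real n)) * (2 * sqrt (real (Suc n)))" by linarith
  hence "1 / sqrt (real (Suc n)) \<le> 2 * (sqrt (real (Suc n)) - sqrt (real n))"
    by (simp add: field_simps del: of_nat_Suc)
  with Suc show ?case by simp
qed simp

text \<open>Inversion gives F(x) as the sum of \<open>moebius a * div_error (x div a)\<close>,
  estimated by the hyperbola method. For \<open>a\<close> up to \<open>x div B\<close> the square
  root bound gives about x / sqrt B; for larger \<open>a\<close> the quotient \<open>x div a\<close>
  takes fewer than \<open>B\<close> values, and summing over \<open>a\<close> first leaves finitely
  many differences of the Mertens function \<open>M\<close>, each o(x).\<close>

lemma sublinear_psi: "sublinear (\<lambda>x. psi x - real x)"
proof -
  \<comment> \<open>The constant \<open>2 * euler_mascheroni\<close>, summed over all c up to y,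
    produces the linear term of \<open>div_error\<close>; every quotient \<open>y div c\<close>
    occurring there is positive.\<close>
  define F where "F = (\<lambda>x. psi x - real x + (if x > 0 then 2 * euler_mascheroni else 0))"
  define M where "M = (\<lambda>N. \<Sum>n=1..N. moebius n)"
  define g where "g = (\<lambda>b. div_error b - div_error (b - 1))"
  have M: "sublinear M" unfolding M_def by (rule sublinear_sum_moebius)
  have G: "div_error y = (\<Sum>c=1..y. F (y div c))" for y
  proof -
    have "(\<Sum>c=1..y. F (y div c)) = (\<Sum>c=1..y. psi (y div c)) - (\<Sum>c=1..y. real (y div c))
       + (\<Sum>c=1..y. (if y div c > 0 then 2 * euler_mascheroni else 0))"
      by (simp add: F_def sum.distrib sum_subtractf)
    also have "(\<Sum>c=1..y. (if y div c > 0 then 2 * euler_mascheroni else 0)) = (\<Sum>c=1..y. 2 * euler_mascheroni :: real)"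
      by (intro sum.cong) (auto simp: div_greater_zero_iff)
    finally show ?thesis unfolding sum_psi_div div_error_def by simp
  qed
  have G_sum: "div_error n = (\<Sum>b=1..n. g b)" for n
    by (induction n) (simp_all add: g_def div_error_def)
  obtain C where C: "C \<ge> 0" "\<And>y. \<bar>div_error y\<bar> \<le> C * sqrt (real y)" using div_error_bound by blast
  have split: "F x = (\<Sum>a=1..x div B. moebius a * div_error (x div a)) + (\<Sum>b\<in>{1..<B}. g b * (M (x div b) - M (x div B)))"
    if x: "x > 0" and B: "B > 0" for x B
  proof -
    let ?k = "x div B"
    have kx: "?k \<le> x" by simp
    have "F x = (\<Sum>a=1..x. moebius a * div_error (x div a))"
      using moebius_inversion_sum[of div_error F, OF G x] .
    also have "{1..x} = {1..?k} \<union> {?k<..x}" by (auto dest: order_trans[OF _ kx])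
    also have "(\<Sum>a\<in>{1..?k} \<union> {?k<..x}. moebius a * div_error (x div a))
       = (\<Sum>a=1..?k. moebius a * div_error (x div a)) + (\<Sum>a\<in>{?k<..x}. moebius a * div_error (x div a))"
      by (intro sum.union_disjoint) auto
    also have "(\<Sum>a\<in>{?k<..x}. moebius a * div_error (x div a)) = (\<Sum>a\<in>{?k<..x}. \<Sum>b=1..x div a. moebius a * g b)"
      by (simp add: G_sum sum_distrib_left)
    also have "\<dots> = (\<Sum>(a,b)\<in>(SIGMA a:{?k<..x}. {1..x div a}). moebius a * g b)"
      by (intro sum.Sigma) auto
    also have "\<dots> = (\<Sum>(b,a)\<in>(SIGMA b:{1..<B}. {?k<..x div b}). moebius a * g b)"
    \<comment> \<open>Exchanging the order: \<open>x div B < a\<close> means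
      \<open>x < a * B\<close>, and together with \<open>a * b <= x\<close> it forces
      \<open>b < B\<close>.\<close>
    proof (rule sum.reindex_bij_witness[where i = "\<lambda>(b,a). (a,b)" and j = "\<lambda>(a,b). (b,a)"])
      have *: "(a \<in> {?k<..x} \<and> b \<in> {1..x div a}) \<longleftrightarrow> (b \<in> {1..<B} \<and> a \<in> {?k<..x div b})" for a b
      proof (cases "a > 0 \<and> b > 0")
        case True
        have 1: "b \<le> x div a \<longleftrightarrow> a * b \<le> x" "a \<le> x div b \<longleftrightarrow> a * b \<le> x"
          using True by (simp_all add: less_eq_div_iff_mult_less_eq mult.commute)
        have 2: "?k < a \<longleftrightarrow> x < a * B" using B by (simp add: div_less_iff_less_mult)
        have 3: "a \<le> x" if "a * b \<le> x" using that True by (metis Suc_leI le_trans mult.right_neutral mult_le_mono2 One_nat_def)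
        have 4: "b < B" if "a * b \<le> x" "x < a * B" using that by (metis le_less_trans mult_less_cancel1)
        show ?thesis using True 1 2 3 4 by auto
      next
        case False
        thus ?thesis by auto
      qed
      show "(case z of (a, b) \<Rightarrow> (b, a)) \<in> (SIGMA b:{1..<B}. {?k<..x div b})" if "z \<in> (SIGMA a:{?k<..x}. {1..x div a})" for z
        using that *[of "fst z" "snd z"] by (cases z) simp
      show "(case z of (b, a) \<Rightarrow> (a, b)) \<in> (SIGMA a:{?k<..x}. {1..x div a})" if "z \<in> (SIGMA b:{1..<B}. {?k<..x div b})" for z
        using that *[of "snd z" "fst z"] by (cases z) simp
    qed auto
    also have "\<dots> = (\<Sum>b\<in>{1..<B}. \<Sum>a\<in>{?k<..x div b}. moebius a * g b)"
      by (intro sum.Sigma[symmetric]) auto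
    also have "\<dots> = (\<Sum>b\<in>{1..<B}. g b * (M (x div b) - M ?k))"
    proof (rule sum.cong)
      fix b assume b: "b \<in> {1..<B}"
      have "?k \<le> x div b" using b by (intro div_le_mono2) auto
      hence "{1..x div b} = {1..?k} \<union> {?k<..x div b}" by auto
      hence "M (x div b) = (\<Sum>a\<in>{1..?k} \<union> {?k<..x div b}. moebius a)" by (simp only: M_def)
      also have "\<dots> = M ?k + (\<Sum>a\<in>{?k<..x div b}. moebius a)" unfolding M_def
        by (intro sum.union_disjoint) auto
      finally show "(\<Sum>a\<in>{?k<..x div b}. moebius a * g b) = g b * (M (x div b) - M ?k)"
        by (simp add: sum_distrib_right[symmetric] mult.commute)
    qed simp
    finally show ?thesis .
  qed
  have "sublinear F" unfolding sublinear_def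
  proof (intro allI impI)
    fix e :: real assume e: "e > 0"
    \<comment> \<open>Large enough that the first part, 2 C x / sqrt B, is at most (e / 2)
      x.\<close>
    define B where "B = nat \<lceil>(4 * C / e)\<^sup>2\<rceil> + 1"
    have B0: "B > 0" by (simp add: B_def)
    have "(4 * C / e)\<^sup>2 \<le> real B" unfolding B_def by linarith
    hence "4 * C / e \<le> sqrt (real B)" by (rule real_le_rsqrt)
    hence CB: "2 * C \<le> e / 2 * sqrt (real B)" using e by (simp add: field_simps)
    define W where "W = (\<Sum>b\<in>{1..<B}. \<bar>g b\<bar>)"
    have W: "W \<ge> 0" unfolding W_def by (intro sum_nonneg) auto
    \<comment> \<open>Chosen after \<open>B\<close>: the total weight \<open>W\<close> of the
      increments is fixed by now, and \<open>2 * W * e' <= e / 2\<close>.\<close>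
    define e' where "e' = e / (4 * (W + 1))"
    have e': "e' > 0" using e W by (simp add: e'_def)
    obtain D where D: "D \<ge> 0" "\<forall>n. \<bar>M n\<bar> \<le> e' * real n + D" using sublinearD[OF M e'] by blast
    have "\<bar>F x\<bar> \<le> e * real x + (W * (2 * D) + \<bar>F 0\<bar>)" for x
    proof (cases "x = 0")
      case True
      thus ?thesis using W D(1) by simp
    next
      case False
      hence x: "x > 0" by simp
      let ?S1 = "\<Sum>a=1..x div B. moebius a * div_error (x div a)"
      let ?S2 = "\<Sum>b\<in>{1..<B}. g b * (M (x div b) - M (x div B))"
      have "\<bar>?S1\<bar> \<le> (\<Sum>a=1..x div B. C * sqrt (real x) * (1 / sqrt (real a)))"
      proof (intro sum_abs[THEN order_trans] sum_mono)
        fix a assume a: "a \<in> {1..x div B}"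
        have "\<bar>moebius a * div_error (x div a)\<bar> \<le> 1 * \<bar>div_error (x div a)\<bar>"
          unfolding abs_mult by (intro mult_right_mono abs_moebius_le) auto
        also have "\<dots> \<le> C * sqrt (real (x div a))" using C(2)[of "x div a"] by simp
        also have "\<dots> \<le> C * sqrt (real x / real a)" using C(1)
          by (intro mult_left_mono real_sqrt_le_mono of_nat_div_le_of_nat)
        finally show "\<bar>moebius a * div_error (x div a)\<bar> \<le> C * sqrt (real x) * (1 / sqrt (real a))"
          by (simp add: real_sqrt_divide)
      qed
      also have "\<dots> = C * sqrt (real x) * (\<Sum>a=1..x div B. 1 / sqrt (real a))" by (simp add: sum_distrib_left)
      also have "\<dots> \<le> C * sqrt (real x) * (2 * sqrt (real (x div B)))"
        using C(1) by (intro mult_left_mono sum_inverse_sqrt_le) auto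
      also have "\<dots> \<le> C * sqrt (real x) * (2 * sqrt (real x / real B))"
        using C(1) by (intro mult_left_mono real_sqrt_le_mono of_nat_div_le_of_nat) auto
      also have "\<dots> = (2 * C) * (sqrt (real x) * sqrt (real x)) / sqrt (real B)" by (simp add: real_sqrt_divide)
      also have "\<dots> = (2 * C) * real x / sqrt (real B)" by simp
      also have "\<dots> \<le> (e / 2 * sqrt (real B)) * real x / sqrt (real B)" using CB by (intro divide_right_mono mult_right_mono) auto
      also have "\<dots> = e / 2 * real x" using B0 by simp
      finally have part1: "\<bar>?S1\<bar> \<le> e / 2 * real x" .
      have Mx: "\<bar>M (x div b)\<bar> \<le> e' * real x + D" for b
      proof -
        have "\<bar>M (x div b)\<bar> \<le> e' * real (x div b) + D" using D(2) by blast
        also have "\<dots> \<le> e' * real x + D" using e' by (intro add_right_mono mult_left_mono) auto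
        finally show ?thesis .
      qed
      have "\<bar>?S2\<bar> \<le> (\<Sum>b\<in>{1..<B}. \<bar>g b\<bar> * (2 * (e' * real x + D)))"
      proof (intro sum_abs[THEN order_trans] sum_mono)
        fix b
        have "\<bar>u - v\<bar> \<le> 2 * w" if "\<bar>u\<bar> \<le> w" "\<bar>v\<bar> \<le> w" for u v w :: real using that by linarith
        from this[OF Mx Mx] have "\<bar>M (x div b) - M (x div B)\<bar> \<le> 2 * (e' * real x + D)" .
        thus "\<bar>g b * (M (x div b) - M (x div B))\<bar> \<le> \<bar>g b\<bar> * (2 * (e' * real x + D))"
          unfolding abs_mult by (intro mult_left_mono) auto
      qed
      also have "\<dots> = W * (2 * e' * real x) + W * (2 * D)" 
        unfolding sum_distrib_right[symmetric] W_def[symmetric] by (simp add: algebra_simps)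
      also have "W * (2 * e' * real x) \<le> (e / 2) * real x"
      proof -
        have "W * (2 * e') \<le> e / 2" using W e by (simp add: e'_def field_simps)
        from mult_right_mono[OF this, of "real x"] show ?thesis by (simp add: mult_ac)
      qed
      finally have part2: "\<bar>?S2\<bar> \<le> e / 2 * real x + W * (2 * D)" by simp
      have "e * real x = e / 2 * real x + e / 2 * real x" by simp
      thus ?thesis using part1 part2 abs_triangle_ineq[of ?S1 ?S2]
        unfolding split[OF x B0] by linarith
    qed
    thus "\<exists>C. \<forall>n. \<bar>F n\<bar> \<le> e * real n + C" by blast
  qed
  moreover have "sublinear (\<lambda>x. if x > 0 then 2 * euler_mascheroni else 0)"
    by (rule sublinear_bounded[where C = "2 * euler_mascheroni"]) (use euler_mascheroni_pos in auto)
  ultimately have "sublinear (\<lambda>x. F x - (if x > 0 then 2 * euler_mascheroni else 0))" by (rule sublinear_diff)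
  thus ?thesis by (simp add: F_def)
qed

lemma summation_by_parts:
  fixes a w :: "nat \<Rightarrow> real"
  assumes "k \<le> x"
  shows "(\<Sum>n\<in>{k<..x}. a n * w n) = (\<Sum>n=1..x. a n) * w x - (\<Sum>n=1..k. a n) * w k + (\<Sum>n=k..<x. (\<Sum>m=1..n. a m) * (w n - w (Suc n)))"
  using assms
proof (induction x rule: dec_induct)
  case (step x)
  have "{k<..Suc x} = insert (Suc x) {k<..x}" using step.hyps by auto
  thus ?case using step by (simp add: algebra_simps)
qed simp

text \<open>Axer's theorem for the sawtooth weight. Up to \<open>x div B\<close> the weight is
  bounded by 1 and the sum of absolute values is O(x / B). Beyond it, \<open>(x mod n) / n\<close>
  is a difference of two decreasing functions of \<open>n\<close> with total variation at most 2 B,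
  so partial summation against the o(x) partial sums suffices.\<close>

lemma axer:
  fixes a :: "nat \<Rightarrow> real"
  assumes S: "sublinear (\<lambda>x. \<Sum>n=1..x. a n)"
    and abs: "\<And>x. (\<Sum>n=1..x. \<bar>a n\<bar>) \<le> C * real x + D" and C: "C \<ge> 0"
  shows "sublinear (\<lambda>x. \<Sum>n=1..x. a n * (real (x mod n) / real n))"
  unfolding sublinear_def
proof (intro allI impI)
  fix e :: real assume e: "e > 0"
  define B where "B = nat \<lceil>2 * C / e\<rceil> + 1"
  have B0: "B > 0" by (simp add: B_def)
  have "2 * C / e \<le> real B" unfolding B_def by linarith
  hence CB: "C \<le> e / 2 * real B" using e by (simp add: field_simps)
  define T where "T = (\<lambda>x. \<Sum>n=1..x. a n)"
  define e' where "e' = e / (2 * (2 * real B + 4))"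
  have e': "e' > 0" using e by (simp add: e'_def add_nonneg_pos)
  obtain K where K: "K \<ge> 0" "\<forall>n. \<bar>T n\<bar> \<le> e' * real n + K" using sublinearD[OF S e'] unfolding T_def by blast
  have "\<bar>\<Sum>n=1..x. a n * (real (x mod n) / real n)\<bar> \<le> e * real x + (\<bar>D\<bar> + K * (2 * real B + 4))" for x
  proof (cases "x = 0")
    case False
    define k where "k = x div B"
    define w where "w = (\<lambda>n. real (x mod n) / real n)"
    define Q where "Q = e' * real x + K"
    have Q: "Q \<ge> 0" using e' K by (simp add: Q_def)
    have TQ: "\<bar>T n\<bar> \<le> Q" if "n \<le> x" for n
    proof -
      have "\<bar>T n\<bar> \<le> e' * real n + K" using K by blast
      also have "\<dots> \<le> Q" unfolding Q_def using that e' by (intro add_right_mono mult_left_mono) auto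
      finally show ?thesis .
    qed
    have kx: "k \<le> x" by (simp add: k_def)
    have w01: "0 \<le> w n" "w n \<le> 1" for n
    proof -
      show "0 \<le> w n" by (simp add: w_def)
      show "w n \<le> 1"
      proof (cases "n = 0")
        case False
        thus ?thesis by (simp add: w_def less_imp_le)
      qed (simp add: w_def)
    qed
    have weq: "w n = real x / real n - real (x div n)" for n
      using of_nat_of_nat_div_aux[of x n, where ?'a = real] by (simp add: w_def)
    have "{1..x} = {1..k} \<union> {k<..x}" by (auto dest: order_trans[OF _ kx])
    hence "(\<Sum>n=1..x. a n * w n) = (\<Sum>n\<in>{1..k} \<union> {k<..x}. a n * w n)" by simp
    also have "\<dots> = (\<Sum>n=1..k. a n * w n) + (\<Sum>n\<in>{k<..x}. a n * w n)"
      by (intro sum.union_disjoint) auto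
    finally have split: "(\<Sum>n=1..x. a n * w n) = (\<Sum>n=1..k. a n * w n) + (\<Sum>n\<in>{k<..x}. a n * w n)" .
    have "\<bar>\<Sum>n=1..k. a n * w n\<bar> \<le> (\<Sum>n=1..k. \<bar>a n\<bar>)"
      using w01 by (intro sum_abs[THEN order_trans] sum_mono) (simp add: abs_mult mult_left_le)
    also have "\<dots> \<le> C * real k + D" by (rule abs)
    also have "C * real k \<le> C * (real x / real B)" unfolding k_def using C by (intro mult_left_mono of_nat_div_le_of_nat)
    also have "C * (real x / real B) \<le> (e / 2 * real B) * (real x / real B)" using CB by (intro mult_right_mono) auto
    also have "\<dots> = e / 2 * real x" using B0 by simp
    finally have part1: "\<bar>\<Sum>n=1..k. a n * w n\<bar> \<le> e / 2 * real x + \<bar>D\<bar>" by simp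
    have part2: "\<bar>\<Sum>n\<in>{k<..x}. a n * w n\<bar> \<le> Q * (2 * real B + 4)"
    proof (cases "k < x")
      case True
      have "Suc k \<le> x" using True by simp
      \<comment> \<open>The sum of the two decreasing parts of the weight; its decrements dominate
        those of \<open>w\<close> in absolute value and telescope.\<close>
      define G where "G = (\<lambda>n. real x / real n + real (x div n))"
      \<comment> \<open>The first term is split off so that \<open>G\<close> is evaluated at
        \<open>Suc k\<close>, where \<open>x / Suc k\<close> is at most \<open>B\<close>;
        \<open>k\<close> itself may be 0.\<close>
      have "{k<..x} = insert (Suc k) {Suc k<..x}" using True by auto
      hence "(\<Sum>n\<in>{k<..x}. a n * w n) = a (Suc k) * w (Suc k) + (\<Sum>n\<in>{Suc k<..x}. a n * w n)" by simp
      also have "a (Suc k) = T (Suc k) - T k" by (simp add: T_def)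
      also have "(\<Sum>n\<in>{Suc k<..x}. a n * w n) = T x * w x - T (Suc k) * w (Suc k) + (\<Sum>n=Suc k..<x. T n * (w n - w (Suc n)))"
        unfolding T_def by (rule summation_by_parts) fact
      finally have eq: "(\<Sum>n\<in>{k<..x}. a n * w n) = T x * w x - T k * w (Suc k) + (\<Sum>n=Suc k..<x. T n * (w n - w (Suc n)))"
        by (simp add: algebra_simps)
      have b1: "\<bar>T x * w x\<bar> \<le> Q" "\<bar>T k * w (Suc k)\<bar> \<le> Q"
        using TQ[of x] TQ[OF kx] w01 Q unfolding abs_mult by (auto intro!: mult_left_le[THEN order_trans])
      have "\<bar>\<Sum>n=Suc k..<x. T n * (w n - w (Suc n))\<bar>
          \<le> (\<Sum>n=Suc k..<x. Q * (G n - G (Suc n)))"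
      proof (intro sum_abs[THEN order_trans] sum_mono)
        fix n assume n: "n \<in> {Suc k..<x}"
        have "x div Suc n \<le> x div n" using n by (intro div_le_mono2) auto
        moreover have "real x / real (Suc n) \<le> real x / real n" using n by (intro divide_left_mono) auto
        ultimately have "\<bar>w n - w (Suc n)\<bar> \<le> G n - G (Suc n)"
          unfolding weq G_def by linarith
        thus "\<bar>T n * (w n - w (Suc n))\<bar> \<le> Q * (G n - G (Suc n))"
          unfolding abs_mult using TQ[of n] n Q by (intro mult_mono) auto
      qed
      also have "\<dots> = Q * (\<Sum>n=Suc k..<x. G n - G (Suc n))"
        by (simp only: sum_distrib_left)
      also have "(\<Sum>n=Suc k..<x. G n - G (Suc n))
         = (G (Suc k) - G x)"
        using sum_Suc_diff'[OF \<open>Suc k \<le> x\<close>, of "\<lambda>n. - G n"] by (simp only: minus_diff_minus minus_diff_eq diff_minus_eq_add uminus_add_conv_diff)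
      also have "Q * \<dots> \<le> Q * (2 * real B)"
      proof (intro mult_left_mono Q)
        have "x < Suc k * B" unfolding k_def using B0 dividend_less_times_div[of B x] by (simp add: mult.commute)
        hence "real x \<le> real (Suc k) * real B" by (metis less_imp_le of_nat_le_iff of_nat_mult)
        hence 1: "real x / real (Suc k) \<le> real B" by (simp add: field_simps)
        have 2: "real (x div Suc k) \<le> real x / real (Suc k)" by (rule of_nat_div_le_of_nat)
        have 3: "real x / real x + real (x div x) \<ge> 0" by simp
        show "G (Suc k) - G x \<le> 2 * real B"
          using 1 2 3 unfolding G_def by linarith
      qed
      finally have "\<bar>\<Sum>n=Suc k..<x. T n * (w n - w (Suc n))\<bar> \<le> Q * (2 * real B)" .
      moreover have "Q * (2 * real B + 4) = Q * (2 * real B) + 4 * Q" by (simp add: algebra_simps)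
      ultimately show ?thesis unfolding eq using b1 Q by linarith
    next
      case False
      thus ?thesis using Q by simp
    qed
    have "Q * (2 * real B + 4) = e / 2 * real x + K * (2 * real B + 4)"
    proof -
      have "e' * (2 * real B + 4) = e / 2" by (simp add: e'_def field_simps)
      thus ?thesis unfolding Q_def by (metis (no_types, opaque_lifting) distrib_right mult.assoc mult.commute)
    qed
    moreover have "e * real x = e / 2 * real x + e / 2 * real x" by simp
    ultimately show ?thesis using part1 part2 split unfolding w_def by linarith
  qed (use e K in \<open>simp add: add_nonneg_nonneg\<close>)
  thus "\<exists>C. \<forall>x. \<bar>\<Sum>n=1..x. a n * (real (x mod n) / real n)\<bar> \<le> e * real x + C" by blast
qed

section \<open>Passing from prime powers to primes, and the mean of the last-digit carries\<close>

abbreviation primes_le :: "nat \<Rightarrow> nat set" where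
  "primes_le k \<equiv> {p. prime p \<and> p \<le> k}"

abbreviation prime_power_weight :: "nat \<Rightarrow> nat \<Rightarrow> real" where
  "prime_power_weight K J \<equiv> \<Sum>p\<in>primes_le K. \<Sum>j=2..J. ln (real p) * (real K / real p ^ j) powr (3/4)"

lemma ln_prime_nonneg: "prime (p::nat) \<Longrightarrow> 0 \<le> ln (real p)"
  using prime_ge_1_nat[of p] by simp

text \<open>
  The exponent \<open>3/4\<close> bounds \<open>min 1 x\<close> by \<open>x powr (3/4)\<close>, which treats \<open>p ^ j \<le> K\<close> and \<open>p ^ j > K\<close>
  at the same time; any exponent strictly between \<open>1/2\<close> and \<open>1\<close> would do.
\<close>
lemma prime_power_sum_bound:
  "\<exists>C\<ge>0. \<forall>K J. K > 0 \<longrightarrow> prime_power_weight K J \<le> C * (real K powr (3/4) * ln (real K))"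
proof -
  define Z where "Z = (\<Sum>n. real n powr (-3/2))"
  have sm: "summable (\<lambda>n. real n powr (-3/2))" by (simp add: summable_real_powr_iff)
  have "prime_power_weight K J \<le> 4 * Z * (real K powr (3/4) * ln (real K))"
    if K: "K > 0" for K J
  proof -
    have "prime_power_weight K J
       \<le> (\<Sum>p\<in>primes_le K. (4 * (real K powr (3/4) * ln (real K))) * real p powr (-3/2))"
    proof (rule sum_mono)
      fix p assume "p \<in> primes_le K"
      hence p: "prime p" "p \<le> K" by auto
      have p2: "p \<ge> 2" using p prime_ge_2_nat by blast
      \<comment> \<open>Each \<open>j\<close> contributes a power of \<open>x\<close>, and the
        series from \<open>j = 2\<close> is at most 4 x^2, that is 4 p^(-3/2), summable over all
        integers. The factor 4 is 1 / (1 - 3/4); \<open>x <= 3/4\<close> follows from p = 2 by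
        comparing fourth powers, 1/8 with 81/256.\<close>
      define x where "x = real p powr (-3/4)"
      have x: "x > 0" "x \<le> 3/4"
      proof -
        show "x > 0" using p2 by (simp add: x_def)
        have "x \<le> 2 powr (-3/4)" unfolding x_def using p2 by (intro powr_mono2') auto
        also have "\<dots> \<le> 3/4"
        proof (rule power_le_imp_le_base[of _ 3])
          have "(2 powr (-3/4)) ^ Suc 3 = 2 powr (-3 :: real)"
            by (subst powr_realpow[symmetric]) (simp_all add: powr_powr)
          also have "\<dots> = 1 / 8" using powr_minus[of 2 "3::real"] by simp
          also have "\<dots> \<le> (3/4 :: real) ^ Suc 3" by (simp add: power_divide)
          finally show "(2 powr (-3/4)) ^ Suc 3 \<le> (3/4 :: real) ^ Suc 3" .
        qed auto
        finally show "x \<le> 3/4" .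
      qed
      have pterm: "(real K / real p ^ j) powr (3/4) = real K powr (3/4) * x ^ j" for j
      proof -
        have "real p ^ j = real p powr real j" using p2 by (simp add: powr_realpow)
        hence "(real p ^ j) powr (3/4) = (real p powr (3/4)) ^ j"
          using p2 by (simp only: powr_powr) (simp add: powr_power mult.commute)
        moreover have "x = 1 / real p powr (3/4)" by (simp add: x_def powr_minus_divide)
        ultimately show ?thesis using p2 K by (simp add: powr_divide power_one_over)
      qed
      have "(\<Sum>j=2..J. x ^ j) \<le> 4 * x\<^sup>2"
      proof -
        have "(\<Sum>j=2..J. x ^ j) = (\<Sum>j\<in>{2..J}. x\<^sup>2 * x ^ (j - 2))"
        proof (rule sum.cong)
          fix j assume "j \<in> {2..J}"
          hence "2 + (j - 2) = j" by auto
          thus "x ^ j = x\<^sup>2 * x ^ (j - 2)" by (metis power_add)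
        qed simp
        also have "\<dots> = x\<^sup>2 * (\<Sum>j\<in>{2..J}. x ^ (j - 2))" by (simp add: sum_distrib_left)
        also have "(\<Sum>j\<in>{2..J}. x ^ (j - 2)) \<le> (\<Sum>i<J. x ^ i)"
        proof -
          have "(\<Sum>j\<in>{2..J}. x ^ (j - 2)) = (\<Sum>i\<in>(\<lambda>j. j - 2) ` {2..J}. x ^ i)"
            by (subst sum.reindex) (auto simp: inj_on_def)
          also have "\<dots> \<le> (\<Sum>i<J. x ^ i)" using x by (intro sum_mono2) auto
          finally show ?thesis .
        qed
        also have "(\<Sum>i<J. x ^ i) = (1 - x ^ J) / (1 - x)" using x by (subst sum_gp_strict) auto
        also have "\<dots> \<le> 1 / (1 - x)" using x by (intro divide_right_mono) auto
        also have "\<dots> \<le> 4" using x by (simp add: field_simps)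
        finally show ?thesis using x by (simp add: mult_left_mono mult.commute)
      qed
      moreover have "x\<^sup>2 = real p powr (-3/2)" using p2 by (simp add: x_def powr_power)
      ultimately have s: "(\<Sum>j=2..J. x ^ j) \<le> 4 * real p powr (-3/2)" by simp
      have "(\<Sum>j=2..J. ln (real p) * (real K / real p ^ j) powr (3/4)) = ln (real p) * (real K powr (3/4) * (\<Sum>j=2..J. x ^ j))"
        by (simp add: pterm sum_distrib_left)
      also have "\<dots> \<le> ln (real K) * (real K powr (3/4) * (4 * real p powr (-3/2)))"
        using p p2 s x by (intro mult_mono mult_left_mono) (auto intro!: sum_nonneg mult_nonneg_nonneg)
      finally show "(\<Sum>j=2..J. ln (real p) * (real K / real p ^ j) powr (3/4)) \<le> (4 * (real K powr (3/4) * ln (real K))) * real p powr (-3/2)"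
        by (simp add: mult_ac)
    qed
    also have "\<dots> = (4 * (real K powr (3/4) * ln (real K))) * (\<Sum>p\<in>primes_le K. real p powr (-3/2))"
      by (simp only: sum_distrib_left)
    also have "\<dots> \<le> (4 * (real K powr (3/4) * ln (real K))) * Z"
      unfolding Z_def using K by (intro mult_left_mono sum_le_suminf sm) auto
    finally show ?thesis by (simp add: mult_ac)
  qed
  moreover have "Z \<ge> 0" unfolding Z_def by (intro suminf_nonneg sm) auto
  ultimately show ?thesis by (intro exI[of _ "4 * Z"]) auto
qed

definition theta :: "nat \<Rightarrow> real" where
  "theta x = (\<Sum>p\<in>primes_le x. ln (real p))"

abbreviation nonprimes_le :: "nat \<Rightarrow> nat set" where
  "nonprimes_le x \<equiv> {n. n \<in> {1..x} \<and> \<not> prime n}"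

text \<open>A proper prime power \<open>p ^ j\<close> up to \<open>K\<close> has
  \<open>K / p ^ j >= 1\<close>, so its factor in \<open>prime_power_weight\<close> is at least 1
  and the previous bound applies.\<close>

lemma primepow_part_bound:
  "\<exists>C\<ge>0. \<forall>K>0. (\<Sum>n\<in>nonprimes_le K. mangoldt n :: real) \<le> C * (real K powr (3/4) * ln (real K))"
proof -
  obtain C where C: "C \<ge> 0" "\<And>K J. K > 0 \<Longrightarrow> prime_power_weight K J \<le> C * (real K powr (3/4) * ln (real K))"
    using prime_power_sum_bound by blast
  have "(\<Sum>n\<in>nonprimes_le K. mangoldt n :: real) \<le> C * (real K powr (3/4) * ln (real K))" if K: "K > 0" for K
  proof -
    define T where "T = {(p,j). prime p \<and> p \<le> K \<and> j \<in> {2..K} \<and> p ^ j \<le> K}"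
    have Tsub: "T \<subseteq> primes_le K \<times> {2..K}" by (auto simp: T_def)
    have finP: "finite (primes_le K)" by simp
    have finT: "finite T" by (rule finite_subset[OF Tsub]) auto
    have "(\<Sum>n\<in>nonprimes_le K. mangoldt n :: real) = (\<Sum>n | n \<in> {1..K} \<and> \<not> prime n \<and> primepow n. mangoldt n)"
      by (intro sum.mono_neutral_right) (auto simp: mangoldt_def)
    also have "\<dots> \<le> (\<Sum>n\<in>(\<lambda>(p,j). p ^ j) ` T. mangoldt n)"
    proof (rule sum_mono2)
      show "{n. n \<in> {1..K} \<and> \<not> prime n \<and> primepow n} \<subseteq> (\<lambda>(p,j). p ^ j) ` T"
      proof
        fix n assume n: "n \<in> {n. n \<in> {1..K} \<and> \<not> prime n \<and> primepow n}"
        then obtain p j where pj: "prime p" "j > 0" "n = p ^ j" by (auto simp: primepow_def)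
        have "j \<noteq> 1" using n pj by auto
        hence j2: "j \<ge> 2" using pj by simp
        have "p \<le> p ^ j" using pj by (simp add: self_le_power prime_gt_0_nat Suc_leI)
        moreover have "j < p ^ j" using pj prime_gt_1_nat by (simp add: power_gt_expt)
        ultimately have "(p, j) \<in> T" using n pj j2 by (auto simp: T_def)
        thus "n \<in> (\<lambda>(p,j). p ^ j) ` T" using pj by force
      qed
    qed (use finT in \<open>auto simp: mangoldt_nonneg\<close>)
    also have "\<dots> \<le> (\<Sum>z\<in>T. mangoldt (case z of (p,j) \<Rightarrow> p ^ j))"
      by (rule order_trans[OF sum_image_le[OF finT]]) (auto simp: mangoldt_nonneg o_def)
    also have "\<dots> \<le> (\<Sum>(p,j)\<in>T. ln (real p) * (real K / real p ^ j) powr (3/4))"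
    proof (rule sum_mono, clarify)
      fix p j assume "(p, j) \<in> T"
      hence pj: "prime p" "j \<ge> 2" "p ^ j \<le> K" by (auto simp: T_def)
      have p2: "p \<ge> 2" using pj prime_ge_2_nat by blast
      have "real p ^ j \<le> real K" using pj(3) by (metis of_nat_le_iff of_nat_power)
      hence "1 \<le> (real K / real p ^ j) powr (3/4)" using p2 by (intro ge_one_powr_ge_zero) auto
      hence "ln (real p) * 1 \<le> ln (real p) * (real K / real p ^ j) powr (3/4)" using p2 by (intro mult_left_mono) auto
      thus "mangoldt (p ^ j) \<le> ln (real p) * (real K / real p ^ j) powr (3/4)" using pj by simp
    qed
    also have "\<dots> \<le> (\<Sum>(p,j)\<in>primes_le K \<times> {2..K}. ln (real p) * (real K / real p ^ j) powr (3/4))"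
      using finP by (intro sum_mono2 Tsub) (auto dest: prime_gt_0_nat simp: Suc_le_eq)
    also have "\<dots> = prime_power_weight K K"
      by (intro sum.cartesian_product[symmetric])
    also have "\<dots> \<le> C * (real K powr (3/4) * ln (real K))" by (rule C(2)[OF K])
    finally show ?thesis .
  qed
  thus ?thesis using C(1) by blast
qed

lemma sublinear_primepow_part: "sublinear (\<lambda>K. \<Sum>n\<in>nonprimes_le K. mangoldt n)"
proof (rule sublinear_of_tendsto)
  obtain C where C: "C \<ge> 0" "\<And>K. K > 0 \<Longrightarrow> (\<Sum>n\<in>nonprimes_le K. mangoldt n :: real) \<le> C * (real K powr (3/4) * ln (real K))"
    using primepow_part_bound by blast
  have lim: "(\<lambda>K. C * (real K powr (3/4) * ln (real K)) / real K) \<longlonglongrightarrow> 0" by real_asymp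
  have "eventually (\<lambda>K. norm ((\<Sum>n\<in>nonprimes_le K. mangoldt n) / real K) \<le> C * (real K powr (3/4) * ln (real K)) / real K) sequentially"
    using eventually_gt_at_top[of 0]
  proof eventually_elim
    case (elim K)
    have "0 \<le> (\<Sum>n\<in>nonprimes_le K. mangoldt n :: real)" by (intro sum_nonneg mangoldt_nonneg)
    thus ?case using C(2)[OF elim] elim by (simp add: divide_right_mono)
  qed
  thus "(\<lambda>K. (\<Sum>n\<in>nonprimes_le K. mangoldt n) / real K) \<longlonglongrightarrow> 0"
    by (rule Lim_null_comparison[OF _ lim])
qed

lemma sum_mangoldt_split:
  "(\<Sum>n=1..x. mangoldt n * w n) = (\<Sum>p\<in>primes_le x. ln (real p) * w p) + (\<Sum>n\<in>nonprimes_le x. mangoldt n * (w n :: real))"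
proof -
  have eq: "{1..x} = primes_le x \<union> nonprimes_le x"
    by (auto simp: prime_gt_0_nat Suc_leI)
  have "(\<Sum>n=1..x. mangoldt n * w n) = (\<Sum>n\<in>primes_le x \<union> nonprimes_le x. mangoldt n * w n)"
    by (rule sum.cong[OF eq refl])
  also have "\<dots> = (\<Sum>p\<in>primes_le x. mangoldt p * w p) + (\<Sum>n\<in>nonprimes_le x. mangoldt n * w n)"
    by (intro sum.union_disjoint) auto
  finally show ?thesis by simp
qed

theorem sublinear_theta: "sublinear (\<lambda>x. theta x - real x)"
proof -
  have "psi x = theta x + (\<Sum>n\<in>nonprimes_le x. mangoldt n)" for x
    using sum_mangoldt_split[of "\<lambda>_. 1" x] by (simp add: psi_def theta_def)
  hence eq: "theta x - real x = (psi x - real x) - (\<Sum>n\<in>nonprimes_le x. mangoldt n)" for x by simp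
  show ?thesis unfolding eq by (rule sublinear_diff[OF sublinear_psi sublinear_primepow_part])
qed

text \<open>\<open>(k mod p) / p\<close> is the density of the \<open>n\<close> with
  \<open>n mod p < k mod p\<close>, so this is the expected contribution of the last-digit carries
  to ln u(n,k).\<close>

definition carry_sum :: "nat \<Rightarrow> real" where
  "carry_sum k = (\<Sum>p\<in>primes_le k. ln (real p) * (real (k mod p) / real p))"

text \<open>The weight ln p on primes is written as (\<open>mangoldt\<close> - 1) + 1 minus the
  proper prime powers. The first part is o(k) by \<open>axer\<close>, the second gives the main term
  through \<open>div_error\<close>, and the third is bounded without using the sawtooth.\<close>

theorem sublinear_carry_sum: "sublinear (\<lambda>k. carry_sum k - (1 - euler_mascheroni) * real k)"
proof -
  obtain C where C: "C \<ge> 0" "\<forall>x. \<bar>psi x - real x\<bar> \<le> 1 * real x + C" using sublinearD[OF sublinear_psi, of 1] by auto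
  have psi_le: "psi x \<le> 2 * real x + C" for x using spec[OF C(2), of x] by linarith
  have 1: "sublinear (\<lambda>x. \<Sum>n=1..x. (mangoldt n - 1) * (real (x mod n) / real n))"
  proof (rule axer)
    show "sublinear (\<lambda>x. \<Sum>n=1..x. mangoldt n - 1)"
      using sublinear_psi by (simp add: psi_def sum_subtractf)
    show "(\<Sum>n=1..x. \<bar>mangoldt n - 1\<bar>) \<le> 3 * real x + C" for x
    proof -
      have "(\<Sum>n=1..x. \<bar>mangoldt n - 1\<bar>) \<le> (\<Sum>n=1..x. mangoldt n + 1 :: real)"
      proof (rule sum_mono)
        fix n show "\<bar>mangoldt n - 1\<bar> \<le> (mangoldt n + 1 :: real)" using mangoldt_nonneg[of n] by linarith
      qed
      also have "\<dots> = psi x + real x" by (simp add: psi_def sum.distrib)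
      finally show ?thesis using psi_le[of x] by linarith
    qed
  qed simp
  have 2: "sublinear (\<lambda>x. (\<Sum>n=1..x. real (x mod n) / real n) - (1 - euler_mascheroni) * real x)"
  proof -
    obtain D where D: "D \<ge> 0" "\<And>y. \<bar>div_error y\<bar> \<le> D * sqrt (real y)" using div_error_bound by blast
    have "\<bar>(\<Sum>n=1..x. real (x mod n) / real n) - (1 - euler_mascheroni) * real x\<bar> \<le> (D + 6) * sqrt (real x) + 6" for x
    proof (cases "x = 0")
      case False
      hence x: "x > 0" by simp
      have "(\<Sum>n=1..x. real (x mod n) / real n) = (\<Sum>n=1..x. real x / real n - real (x div n))"
        using of_nat_of_nat_div_aux[of x _, where ?'a = real] by (intro sum.cong) (simp_all add: algebra_simps)
      also have "\<dots> = real x * harm x - real (\<Sum>n=1..x. x div n)"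
        by (simp add: sum_subtractf harm_def sum_distrib_left divide_inverse)
      also have "\<dots> = real x * harm x - (ln (fact x) + 2 * euler_mascheroni * real x - div_error x)"
        by (simp add: div_error_def)
      finally have eq: "(\<Sum>n=1..x. real (x mod n) / real n) = real x * harm x - (ln (fact x) + 2 * euler_mascheroni * real x - div_error x)" .
      have h1: "real x * harm x \<ge> real x * (ln (real x) + euler_mascheroni)"
        using harm_bounds_euler(1)[OF x] by (intro mult_left_mono) auto
      have h2: "real x * harm x \<le> real x * (ln (real x) + euler_mascheroni) + 1"
      proof -
        have "real x * harm x \<le> real x * (ln (real x) + euler_mascheroni + 1 / real x)"
          using harm_bounds_euler(2)[OF x] by (intro mult_left_mono) auto
        thus ?thesis using x by (simp add: algebra_simps)
      qed
      have hx: "harm x \<le> 4 * sqrt (real x) + 4"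
      proof -
        have "ln (sqrt (real x)) \<le> sqrt (real x) - 1" using x by (intro ln_le_minus_one) auto
        hence "ln (real x) \<le> 2 * sqrt (real x)" using x by (simp add: ln_sqrt)
        moreover have "1 / real x \<le> 1" using x by simp
        moreover have "sqrt (real x) \<ge> 0" by simp
        ultimately show ?thesis using harm_bounds_euler(2)[OF x] euler_mascheroni_less_13_over_22 by linarith
      qed
      define X where "X = real x * ln (real x)"
      define Y where "Y = euler_mascheroni * real x"
      have e1: "real x * (ln (real x) + euler_mascheroni) = X + Y" by (simp add: X_def Y_def algebra_simps)
      have e2: "(1 - euler_mascheroni) * real x = real x - Y" by (simp add: Y_def algebra_simps)
      have f: "0 \<le> ln (fact x) - (X - real x)" "ln (fact x) - (X - real x) \<le> harm x"
        using ln_fact_bounds[OF x] unfolding X_def by auto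
      have g: "- (D * sqrt (real x)) \<le> div_error x" "div_error x \<le> D * sqrt (real x)" using D(2)[of x] by linarith+
      have s: "(D + 6) * sqrt (real x) = D * sqrt (real x) + 6 * sqrt (real x)" "sqrt (real x) \<ge> 0" by (simp_all add: algebra_simps)
      have d: "0 \<le> D * sqrt (real x)" using D(1) by simp
      have z: "2 * euler_mascheroni * real x = 2 * Y" by (simp add: Y_def)
      define H where "H = real x * harm x"
      show ?thesis
        using h1 h2 hx f g s d unfolding eq e1 e2 z H_def[symmetric] by linarith
    qed (use D in auto)
    thus ?thesis by (rule sublinear_sqrt_bound)
  qed
  have 3: "sublinear (\<lambda>k. \<Sum>n\<in>nonprimes_le k. mangoldt n * (real (k mod n) / real n))"
    unfolding sublinear_def
  proof (intro allI impI)
    fix e :: real assume e: "e > 0"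
    obtain D where D: "D \<ge> 0" "\<forall>k. \<bar>\<Sum>n\<in>nonprimes_le k. mangoldt n\<bar> \<le> e * real k + D"
      using sublinearD[OF sublinear_primepow_part e] by blast
    have "\<bar>\<Sum>n\<in>nonprimes_le k. mangoldt n * (real (k mod n) / real n)\<bar> \<le> e * real k + D" for k
    proof -
      have "\<bar>\<Sum>n\<in>nonprimes_le k. mangoldt n * (real (k mod n) / real n)\<bar> \<le> (\<Sum>n\<in>nonprimes_le k. mangoldt n :: real)"
      proof (intro sum_abs[THEN order_trans] sum_mono)
        fix n assume "n \<in> nonprimes_le k"
        hence "n > 0" by auto
        hence "real (k mod n) / real n \<le> 1" by (simp add: less_imp_le)
        thus "\<bar>mangoldt n * (real (k mod n) / real n)\<bar> \<le> mangoldt n"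
          unfolding abs_mult using mangoldt_nonneg[of n] mult_left_mono[of "real (k mod n) / real n" 1 "mangoldt n"] by simp
      qed
      also have "\<dots> \<le> e * real k + D" using spec[OF D(2), of k] by linarith
      finally show ?thesis .
    qed
    thus "\<exists>C. \<forall>k. \<bar>\<Sum>n\<in>nonprimes_le k. mangoldt n * (real (k mod n) / real n)\<bar> \<le> e * real k + C" by blast
  qed
  have eq: "carry_sum k - (1 - euler_mascheroni) * real k =
     ((\<Sum>n=1..k. (mangoldt n - 1) * (real (k mod n) / real n)) + ((\<Sum>n=1..k. real (k mod n) / real n) - (1 - euler_mascheroni) * real k))
       - (\<Sum>n\<in>nonprimes_le k. mangoldt n * (real (k mod n) / real n))" for k
  proof -
    have "(\<Sum>n=1..k. (mangoldt n - 1) * (real (k mod n) / real n)) = (\<Sum>n=1..k. mangoldt n * (real (k mod n) / real n)) - (\<Sum>n=1..k. real (k mod n) / real n)"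
      by (simp only: left_diff_distrib mult_1 sum_subtractf)
    thus ?thesis using sum_mangoldt_split[of "\<lambda>n. real (k mod n) / real n" k] unfolding carry_sum_def by linarith
  qed
  show ?thesis unfolding eq by (rule sublinear_diff[OF sublinear_add[OF 1 2] 3])
qed

section \<open>Carries in a fixed base and their second moment\<close>

lemma multiplicity_conv_sum:
  fixes p m :: nat
  assumes p: "prime p" and m: "m > 0" "m \<le> J"
  shows "multiplicity p m = (\<Sum>j=1..J. if p ^ j dvd m then 1 else 0)"
proof -
  have "p ^ multiplicity p m dvd m" by (rule multiplicity_dvd)
  hence "p ^ multiplicity p m \<le> m" using m by (intro dvd_imp_le) auto
  moreover have "multiplicity p m < p ^ multiplicity p m"
    using prime_gt_1_nat[OF p] by (simp add: power_gt_expt)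
  ultimately have le: "multiplicity p m \<le> J" using m by linarith
  have "(\<Sum>j=1..J. if p ^ j dvd m then 1 else 0) = card {j\<in>{1..J}. p ^ j dvd m}"
    by (simp add: sum.If_cases Int_def)
  also have "{j\<in>{1..J}. p ^ j dvd m} = {1..multiplicity p m}"
    using le m p by (auto simp: power_dvd_iff_le_multiplicity prime_nat_iff)
  finally show ?thesis by simp
qed

text \<open>Legendre's formula. The upper limit \<open>J\<close> is left free so that
  \<open>kummer\<close> can use one common range for n!, k! and (n - k)!.\<close>

lemma multiplicity_fact_nat:
  fixes p :: nat
  assumes p: "prime p" and n: "n \<le> J"
  shows "multiplicity p (fact n) = (\<Sum>j=1..J. n div p ^ j)"
  using n
proof (induction n)
  case (Suc n)
  have "multiplicity p (fact (Suc n) :: nat) = multiplicity p (Suc n * fact n)" by simp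
  also have "\<dots> = multiplicity p (Suc n) + multiplicity p (fact n)"
    using p by (intro prime_elem_multiplicity_mult_distrib) auto
  also have "multiplicity p (fact n) = (\<Sum>j=1..J. n div p ^ j)" using Suc by simp
  also have "multiplicity p (Suc n) = (\<Sum>j=1..J. if p ^ j dvd Suc n then 1 else 0)"
    using Suc.prems p by (intro multiplicity_conv_sum) auto
  also have "\<dots> + (\<Sum>j=1..J. n div p ^ j) = (\<Sum>j=1..J. Suc n div p ^ j)"
    by (simp add: sum.distrib[symmetric] div_Suc dvd_eq_mod_eq_0 cong: if_cong) (rule sum.cong; simp)
  finally show ?case .
qed simp

text \<open>Adding \<open>k\<close> and \<open>n - k\<close> modulo \<open>q\<close> carries exactly
  when the residue of the sum falls below that of a summand.\<close>

lemma div_eq_add_carry: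
  fixes n k q :: nat
  assumes "k \<le> n" "q > 0"
  shows "n div q = k div q + (n - k) div q + (if n mod q < k mod q then 1 else 0)"
proof -
  define m where "m = n - k"
  have n: "n = k + m" using assms by (simp add: m_def)
  have lt: "k mod q < q" "m mod q < q" using assms by auto
  have nm: "n mod q = (k mod q + m mod q) mod q" unfolding n by (simp add: mod_add_eq)
  have nd: "n div q = k div q + m div q + (k mod q + m mod q) div q" unfolding n by (rule div_add1_eq)
  show ?thesis
  proof (cases "k mod q + m mod q < q")
    case True
    thus ?thesis using nm nd by (simp add: m_def)
  next
    case False
    have "k mod q + m mod q < q + q" using lt by (rule add_strict_mono)
    note lt2 = this
    hence "(k mod q + m mod q) div q = 1" using False by (intro div_nat_eqI) auto
    moreover have "(k mod q + m mod q) mod q = k mod q + m mod q - q"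
      using False lt2 le_mod_geq[of q "k mod q + m mod q"] mod_less[of "k mod q + m mod q - q" q] by linarith
    moreover from this have "n mod q < k mod q" unfolding nm using False lt by arith
    ultimately show ?thesis using nd by (simp add: m_def)
  qed
qed

abbreviation carry :: "nat \<Rightarrow> nat \<Rightarrow> nat \<Rightarrow> 'a :: zero_neq_one" where
  "carry n k q \<equiv> if n mod q < k mod q then 1 else 0"

lemma kummer:
  fixes p :: nat
  assumes p: "prime p" and k: "k \<le> n"
  shows "multiplicity p (n choose k) = (\<Sum>j=1..n. carry n k (p ^ j))"
proof -
  have p0: "p ^ j > 0" for j using p prime_gt_0_nat by simp
  have "fact k * fact (n - k) * (n choose k) = (fact n :: nat)" by (rule binomial_fact_lemma[OF k])
  hence "multiplicity p (fact n :: nat) = multiplicity p (fact k * fact (n - k) * (n choose k))" by simp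
  also have "\<dots> = multiplicity p (fact k * fact (n - k) :: nat) + multiplicity p (n choose k)"
    using p k by (intro prime_elem_multiplicity_mult_distrib) auto
  also have "multiplicity p (fact k * fact (n - k) :: nat) = multiplicity p (fact k :: nat) + multiplicity p (fact (n - k) :: nat)"
    using p by (intro prime_elem_multiplicity_mult_distrib) auto
  finally have "(\<Sum>j=1..n. n div p ^ j) = (\<Sum>j=1..n. k div p ^ j) + (\<Sum>j=1..n. (n - k) div p ^ j) + multiplicity p (n choose k)"
    using multiplicity_fact_nat[OF p, of n n] multiplicity_fact_nat[OF p, of k n] multiplicity_fact_nat[OF p, of "n - k" n] k by simp
  moreover have "(\<Sum>j=1..n. n div p ^ j) = (\<Sum>j=1..n. k div p ^ j + (n - k) div p ^ j + carry n k (p ^ j))"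
    by (intro sum.cong refl div_eq_add_carry k p0)
  ultimately show ?thesis by (simp add: sum.distrib)
qed

text \<open>Complete periods cancel; what remains has fewer than \<open>M\<close> terms, each at
  most 1 in absolute value.\<close>

lemma abs_sum_periodic_le:
  fixes f :: "nat \<Rightarrow> real"
  assumes M: "M > 0" and per: "\<And>n. f (M + n) = f n" and zero: "(\<Sum>n<M. f n) = 0" and le: "\<And>n. \<bar>f n\<bar> \<le> 1"
  shows "\<bar>\<Sum>n<N. f n\<bar> \<le> real M"
proof (induction N rule: less_induct)
  case (less N)
  show ?case
  proof (cases "N < M")
    case True
    have "\<bar>\<Sum>n<N. f n\<bar> \<le> (\<Sum>n<N. \<bar>f n\<bar>)" by (rule sum_abs)
    also have "\<dots> \<le> (\<Sum>n<N. 1)" by (intro sum_mono le)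
    finally show ?thesis using True by simp
  next
    case False
    have add: "(\<Sum>n<M + r. f n) = (\<Sum>n<M. f n) + (\<Sum>n<r. f n)" for r
      by (induction r) (simp_all add: per)
    have "(\<Sum>n<N. f n) = (\<Sum>n<N - M. f n)" using add[of "N - M"] False zero by simp
    thus ?thesis using less.IH[of "N - M"] False M by simp
  qed
qed

text \<open>Chinese remainder theorem: over a full period the two residues run independently through
  all pairs.\<close>

lemma sum_mod_product:
  fixes g h :: "nat \<Rightarrow> 'a :: comm_semiring_0"
  assumes cop: "coprime p q" and pq: "p > 0" "q > (0::nat)"
  shows "(\<Sum>n<p * q. g (n mod p) * h (n mod q)) = (\<Sum>r<p. g r) * (\<Sum>s<q. h s)"
proof -
  have inj: "inj_on (\<lambda>n. (n mod p, n mod q)) {..<p * q}"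
  proof (rule inj_onI)
    fix m n assume mn: "m \<in> {..<p * q}" "n \<in> {..<p * q}" "(m mod p, m mod q) = (n mod p, n mod q)"
    hence "[m = n] (mod p)" "[m = n] (mod q)" by (auto simp: cong_def)
    hence "[m = n] (mod p * q)" using cop by (rule coprime_cong_mult_nat)
    thus "m = n" using mn by (simp add: cong_def)
  qed
  have "(\<lambda>n. (n mod p, n mod q)) ` {..<p * q} = {..<p} \<times> {..<q}"
    using pq inj by (intro card_subset_eq) (auto simp: card_image)
  hence bij: "bij_betw (\<lambda>n. (n mod p, n mod q)) {..<p * q} ({..<p} \<times> {..<q})" using inj by (simp add: bij_betw_def)
  have "(\<Sum>r<p. g r) * (\<Sum>s<q. h s) = (\<Sum>(r,s)\<in>{..<p} \<times> {..<q}. g r * h s)"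
    by (simp add: sum_product sum.cartesian_product)
  also have "\<dots> = (\<Sum>n<p * q. g (n mod p) * h (n mod q))"
    using sum.reindex_bij_betw[OF bij, of "\<lambda>(r,s). g r * h s"] by simp
  finally show ?thesis ..
qed

text \<open>The interval lengths \<open>a p\<close> are arbitrary, so that one variance bound covers
  both the exact carries (\<open>a p = k mod p\<close>) and the enlarged intervals shared by all
  \<open>k\<close> of a grid cell.\<close>

definition residue_sum :: "nat set \<Rightarrow> (nat \<Rightarrow> nat) \<Rightarrow> nat \<Rightarrow> real" where
  "residue_sum P a n = (\<Sum>p\<in>P. ln (real p) * (if n mod p < a p then 1 else 0))"

definition residue_mean :: "nat set \<Rightarrow> (nat \<Rightarrow> nat) \<Rightarrow> real" where
  "residue_mean P a = (\<Sum>p\<in>P. ln (real p) * (real (a p) / real p))"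

text \<open>After centring each indicator, a product for two distinct primes is periodic modulo
  \<open>p * q\<close> with sum 0 over a period, so its sum over \<open>n < N\<close> is at most
  \<open>K ^ 2\<close> whatever \<open>N\<close> is. Only the diagonal terms grow with
  \<open>N\<close>.\<close>

lemma residue_sum_second_moment:
  assumes fin: "finite P" and P: "\<And>p. p \<in> P \<Longrightarrow> prime p \<and> p \<le> K" and a: "\<And>p. p \<in> P \<Longrightarrow> a p \<le> p"
  shows "(\<Sum>n<N. (residue_sum P a n - residue_mean P a)\<^sup>2) \<le> real N * (\<Sum>p\<in>P. (ln (real p))\<^sup>2) + real K ^ 2 * (\<Sum>p\<in>P. ln (real p))\<^sup>2"
proof -
  define d where "d = (\<lambda>p n. (if n mod p < a p then 1 else 0) - real (a p) / real p)"
  have d1: "\<bar>d p n\<bar> \<le> 1" if "p \<in> P" for p n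
  proof -
    have "0 \<le> real (a p) / real p" "real (a p) / real p \<le> 1" using a[OF that] P[OF that] prime_gt_0_nat by auto
    thus ?thesis by (auto simp: d_def)
  qed
  have lnp: "ln (real p) \<ge> 0" if "p \<in> P" for p using P[OF that] prime_ge_1_nat[of p] by simp
  have dsum: "(\<Sum>r<p. d p r) = 0" if "p \<in> P" for p
  proof -
    have p0: "p > 0" using P[OF that] prime_gt_0_nat by auto
    have "(\<Sum>r<p. d p r) = (\<Sum>r<p. if r < a p then 1 else 0) - (\<Sum>r<p. real (a p) / real p)"
      unfolding sum_subtractf[symmetric] by (intro sum.cong) (auto simp: d_def)
    also have "(\<Sum>r<p. if r < a p then 1 else (0::real)) = (\<Sum>r\<in>{..<p} \<inter> {..<a p}. 1)"
      by (simp add: sum.If_cases lessThan_def)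
    also have "{..<p} \<inter> {..<a p} = {..<a p}" using a[OF that] by auto
    finally show ?thesis using p0 by simp
  qed
  have dmod: "d p (n mod p) = d p n" for p n by (simp add: d_def)
  have cross: "(\<Sum>n<N. d p n * d q n) \<le> (if p = q then real N else 0) + real K ^ 2" if "p \<in> P" "q \<in> P" for p q
  proof (cases "p = q")
    case True
    have "(\<Sum>n<N. d p n * d q n) \<le> (\<Sum>n<N. 1)"
    proof (rule sum_mono)
      fix n have "\<bar>d p n * d q n\<bar> \<le> 1 * 1" unfolding abs_mult by (intro mult_mono d1 that) auto
      thus "d p n * d q n \<le> 1" by simp
    qed
    thus ?thesis using True by (simp add: add_increasing2)
  next
    case False
    have pr: "prime p" "prime q" using P that by auto
    hence p0: "p > 0" "q > 0" using prime_gt_0_nat by auto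
    have cop: "coprime p q" using pr False by (rule primes_coprime)
    have "\<bar>\<Sum>n<N. d p n * d q n\<bar> \<le> real (p * q)"
    proof (rule abs_sum_periodic_le)
      show "p * q > 0" using p0 by simp
      show "d p (p * q + n) * d q (p * q + n) = d p n * d q n" for n by (simp add: d_def)
      have "(\<Sum>n<p * q. d p (n mod p) * d q (n mod q)) = (\<Sum>r<p. d p r) * (\<Sum>s<q. d q s)"
        by (rule sum_mod_product[OF cop p0])
      thus "(\<Sum>n<p * q. d p n * d q n) = 0" using dsum that by (simp add: dmod)
      show "\<bar>d p n * d q n\<bar> \<le> 1" for n
      proof -
        have "\<bar>d p n * d q n\<bar> \<le> 1 * 1" unfolding abs_mult by (intro mult_mono d1 that) auto
        thus ?thesis by simp
      qed
    qed
    also have "real (p * q) \<le> real K ^ 2"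
      using P[OF that(1)] P[OF that(2)] by (simp add: power2_eq_square mult_mono)
    finally show ?thesis using False by simp
  qed
  have "(\<Sum>n<N. (residue_sum P a n - residue_mean P a)\<^sup>2) = (\<Sum>n<N. (\<Sum>p\<in>P. ln (real p) * d p n)\<^sup>2)"
    by (simp add: residue_sum_def residue_mean_def d_def right_diff_distrib sum_subtractf)
  also have "\<dots> = (\<Sum>n<N. \<Sum>p\<in>P. \<Sum>q\<in>P. ln (real p) * ln (real q) * (d p n * d q n))"
    by (simp add: power2_eq_square sum_product mult_ac)
  also have "\<dots> = (\<Sum>p\<in>P. \<Sum>n<N. \<Sum>q\<in>P. ln (real p) * ln (real q) * (d p n * d q n))"
    by (rule sum.swap)
  also have "\<dots> = (\<Sum>p\<in>P. \<Sum>q\<in>P. \<Sum>n<N. ln (real p) * ln (real q) * (d p n * d q n))"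
    by (intro sum.cong refl sum.swap)
  also have "\<dots> = (\<Sum>p\<in>P. \<Sum>q\<in>P. ln (real p) * ln (real q) * (\<Sum>n<N. d p n * d q n))"
    by (simp add: sum_distrib_left)
  also have "\<dots> \<le> (\<Sum>p\<in>P. \<Sum>q\<in>P. ln (real p) * ln (real q) * ((if p = q then real N else 0) + real K ^ 2))"
    by (intro sum_mono mult_left_mono cross mult_nonneg_nonneg lnp)
  also have "\<dots> = (\<Sum>p\<in>P. \<Sum>q\<in>P. (if p = q then real N * (ln (real p))\<^sup>2 else 0) + ln (real p) * ln (real q) * real K ^ 2)"
    by (intro sum.cong) (auto simp: power2_eq_square algebra_simps)
  also have "\<dots> = real N * (\<Sum>p\<in>P. (ln (real p))\<^sup>2) + (\<Sum>p\<in>P. \<Sum>q\<in>P. ln (real p) * ln (real q)) * real K ^ 2"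
    using fin by (simp add: sum.distrib sum.delta sum_distrib_left sum_distrib_right)
  also have "(\<Sum>p\<in>P. \<Sum>q\<in>P. ln (real p) * ln (real q)) = (\<Sum>p\<in>P. ln (real p))\<^sup>2"
    by (simp add: power2_eq_square sum_product)
  finally show ?thesis by (simp add: mult.commute)
qed

section \<open>Sets of exceptional integers: counting and moment bounds\<close>

lemma card_mod_less:
  assumes q: "q > (0::nat)"
  shows "card {n\<in>{..<N}. n mod q < K} \<le> (N div q + 1) * K"
proof -
  have "inj_on (\<lambda>n. (n div q, n mod q)) {n\<in>{..<N}. n mod q < K}"
    by (rule inj_onI) (metis div_mult_mod_eq prod.inject)
  moreover have "(\<lambda>n. (n div q, n mod q)) ` {n\<in>{..<N}. n mod q < K} \<subseteq> {..N div q} \<times> {..<K}"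
    by (auto intro: div_le_mono)
  ultimately have "card {n\<in>{..<N}. n mod q < K} \<le> card ({..N div q} \<times> {..<K})"
    by (intro card_inj_on_le) auto
  thus ?thesis by simp
qed

lemma markov_card:
  fixes f :: "nat \<Rightarrow> real"
  assumes "\<And>n. f n \<ge> 0"
  shows "t * real (card {n\<in>{..<N}. f n \<ge> t}) \<le> (\<Sum>n<N. f n)"
proof -
  have "t * real (card {n\<in>{..<N}. f n \<ge> t}) = (\<Sum>n\<in>{n\<in>{..<N}. f n \<ge> t}. t)" by simp
  also have "\<dots> \<le> (\<Sum>n\<in>{n\<in>{..<N}. f n \<ge> t}. f n)" by (intro sum_mono) auto
  also have "\<dots> \<le> (\<Sum>n<N. f n)" using assms by (intro sum_mono2) auto
  finally show ?thesis .
qed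

text \<open>The event may depend on \<open>N\<close> as well as on \<open>n\<close>, because primes
  and interval lengths are chosen through ln N.\<close>

definition negligible_events :: "(nat \<Rightarrow> nat \<Rightarrow> bool) \<Rightarrow> bool" where
  "negligible_events B \<longleftrightarrow> (\<lambda>N. real (card {n\<in>{..<N}. B N n}) / real N) \<longlonglongrightarrow> 0"

lemma negligible_events_comparison:
  assumes "eventually (\<lambda>N. real (card {n\<in>{..<N}. B N n}) \<le> real N * g N) sequentially" "g \<longlonglongrightarrow> 0"
  shows "negligible_events B"
  unfolding negligible_events_def
proof (rule Lim_null_comparison[OF _ assms(2)])
  show "eventually (\<lambda>N. norm (real (card {n\<in>{..<N}. B N n}) / real N) \<le> g N) sequentially"
    using assms(1) eventually_gt_at_top[of 0] by eventually_elim (simp add: field_simps)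
qed

lemma negligible_events_mono:
  assumes "negligible_events B" "eventually (\<lambda>N. \<forall>n<N. B' N n \<longrightarrow> B N n) sequentially"
  shows "negligible_events B'"
proof (rule negligible_events_comparison)
  show "(\<lambda>N. real (card {n\<in>{..<N}. B N n}) / real N) \<longlonglongrightarrow> 0" using assms(1) by (simp add: negligible_events_def)
  show "eventually (\<lambda>N. real (card {n\<in>{..<N}. B' N n}) \<le> real N * (real (card {n\<in>{..<N}. B N n}) / real N)) sequentially"
    using assms(2) eventually_gt_at_top[of 0]
  proof eventually_elim
    case (elim N)
    have "card {n\<in>{..<N}. B' N n} \<le> card {n\<in>{..<N}. B N n}" using elim by (intro card_mono) auto
    thus ?case using elim by simp
  qed
qed

lemma negligible_events_disj:
  assumes "negligible_events A" "negligible_events B"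
  shows "negligible_events (\<lambda>N n. A N n \<or> B N n)"
proof (rule negligible_events_comparison)
  show "(\<lambda>N. real (card {n\<in>{..<N}. A N n}) / real N + real (card {n\<in>{..<N}. B N n}) / real N) \<longlonglongrightarrow> 0"
    using tendsto_add[OF assms[unfolded negligible_events_def]] by simp
  show "eventually (\<lambda>N. real (card {n\<in>{..<N}. A N n \<or> B N n}) \<le> real N * (real (card {n\<in>{..<N}. A N n}) / real N + real (card {n\<in>{..<N}. B N n}) / real N)) sequentially"
    using eventually_gt_at_top[of 0]
  proof eventually_elim
    case (elim N)
    have "{n\<in>{..<N}. A N n \<or> B N n} = {n\<in>{..<N}. A N n} \<union> {n\<in>{..<N}. B N n}" by auto
    hence "card {n\<in>{..<N}. A N n \<or> B N n} \<le> card {n\<in>{..<N}. A N n} + card {n\<in>{..<N}. B N n}" by (simp add: card_Un_le)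
    thus ?case using elim by (simp add: algebra_simps)
  qed
qed

lemma negligible_events_bex:
  fixes I :: nat
  assumes "\<And>i. negligible_events (B i)"
  shows "negligible_events (\<lambda>N n. \<exists>i<I. B i N n)"
proof (induction I)
  case 0
  show ?case by (simp add: negligible_events_def)
next
  case (Suc I)
  have "negligible_events (\<lambda>N n. (\<exists>i<I. B i N n) \<or> B I N n)" by (rule negligible_events_disj[OF Suc assms])
  thus ?case by (simp add: less_Suc_eq ex_disj_distrib conj_disj_distribR disj_commute cong: conj_cong) 
qed

text \<open>Outside this event ln n lies between (1 - tau) ln N and ln N, which lets thresholds in
  ln N stand for thresholds in ln n.\<close>

lemma negligible_events_small:
  assumes "0 < \<tau>" "\<tau> < 1"
  shows "negligible_events (\<lambda>N n. real n < real N powr (1 - \<tau>))"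
proof (rule negligible_events_comparison)
  show "(\<lambda>N. (real N powr (1 - \<tau>) + 1) / real N) \<longlonglongrightarrow> 0" using assms by real_asymp
  show "eventually (\<lambda>N. real (card {n\<in>{..<N}. real n < real N powr (1 - \<tau>)}) \<le> real N * ((real N powr (1 - \<tau>) + 1) / real N)) sequentially"
    using eventually_gt_at_top[of 0]
  proof eventually_elim
    case (elim N)
    have "{n\<in>{..<N}. real n < real N powr (1 - \<tau>)} \<subseteq> {..<nat \<lceil>real N powr (1 - \<tau>)\<rceil>}"
      by (auto simp: less_ceiling_iff zless_nat_conj) linarith
    hence "card {n\<in>{..<N}. real n < real N powr (1 - \<tau>)} \<le> nat \<lceil>real N powr (1 - \<tau>)\<rceil>"
      using card_mono[of "{..<nat \<lceil>real N powr (1 - \<tau>)\<rceil>}"] by fastforce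
    also have "real \<dots> \<le> real N powr (1 - \<tau>) + 1" using powr_ge_zero[of "real N" "1 - \<tau>"] by linarith
    finally show ?case using elim by simp
  qed
qed

text \<open>Chebyshev's inequality. For K = O(ln N) the mean square is at most K (ln K)^2 + K^4 (ln
  K)^2 / N, which is o((ln N)^2).\<close>

lemma negligible_events_residue_sum:
  fixes a :: "nat \<Rightarrow> nat \<Rightarrow> nat"
  assumes e: "e > 0" and C: "C > 0"
    and K: "eventually (\<lambda>N. real (K N) \<le> C * ln (real N)) sequentially"
    and P: "\<And>N. finite (P N)" "\<And>N p. p \<in> P N \<Longrightarrow> prime p \<and> p \<le> K N"
    and a: "\<And>N p. p \<in> P N \<Longrightarrow> a N p \<le> p"
  shows "negligible_events (\<lambda>N n. \<bar>residue_sum (P N) (a N) n - residue_mean (P N) (a N)\<bar> \<ge> e * ln (real N))"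
proof (rule negligible_events_comparison)
  define g where "g = (\<lambda>N. (C * ln (real N) * (ln (C * ln (real N)))\<^sup>2 + (C * ln (real N)) ^ 4 * (ln (C * ln (real N)))\<^sup>2 / real N) / (e * ln (real N))\<^sup>2)"
  show "g \<longlonglongrightarrow> 0" unfolding g_def using e C by real_asymp
  have big: "eventually (\<lambda>N. C * ln (real N) > 1) sequentially" using C by real_asymp
  show "eventually (\<lambda>N. real (card {n\<in>{..<N}. \<bar>residue_sum (P N) (a N) n - residue_mean (P N) (a N)\<bar> \<ge> e * ln (real N)}) \<le> real N * g N) sequentially"
    using K big eventually_gt_at_top[of 1]
  proof eventually_elim
    case (elim N)
    define L where "L = ln (real N)"
    define U where "U = C * L"
    define l where "l = ln U"
    have U: "U > 1" "real (K N) \<le> U" using elim by (simp_all add: U_def L_def)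
    have l0: "l \<ge> 0" using U by (simp add: l_def)
    have L0: "L > 0" using elim by (simp add: L_def)
    have N0: "real N > 0" using elim by simp
    have lnp: "0 \<le> ln (real p) \<and> ln (real p) \<le> l" if "p \<in> P N" for p
    proof -
      have p: "prime p" "p \<le> K N" using P(2)[OF that] by auto
      have "real p \<ge> 1" using prime_ge_1_nat[OF p(1)] by simp
      moreover have "real p \<le> U" using p U by linarith
      ultimately show ?thesis unfolding l_def using ln_mono[of "real p" U] by simp
    qed
    have "P N \<subseteq> {1..K N}" using P(2) prime_ge_1_nat by fastforce
    hence "card (P N) \<le> K N" using card_mono[of "{1..K N}" "P N"] by simp
    hence cardP: "real (card (P N)) \<le> U" using U by linarith
    have s1: "(\<Sum>p\<in>P N. ln (real p)) \<le> U * l"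
    proof -
      have "(\<Sum>p\<in>P N. ln (real p)) \<le> (\<Sum>p\<in>P N. l)" using lnp by (intro sum_mono) auto
      also have "\<dots> = real (card (P N)) * l" by simp
      also have "\<dots> \<le> U * l" using cardP l0 by (intro mult_right_mono) auto
      finally show ?thesis .
    qed
    have s2: "(\<Sum>p\<in>P N. (ln (real p))\<^sup>2) \<le> U * l\<^sup>2"
    proof -
      have "(\<Sum>p\<in>P N. (ln (real p))\<^sup>2) \<le> (\<Sum>p\<in>P N. l\<^sup>2)" using lnp by (intro sum_mono power_mono) auto
      also have "\<dots> = real (card (P N)) * l\<^sup>2" by simp
      also have "\<dots> \<le> U * l\<^sup>2" using cardP by (intro mult_right_mono) auto
      finally show ?thesis .
    qed
    have s0: "(\<Sum>p\<in>P N. ln (real p)) \<ge> 0" using lnp by (intro sum_nonneg) auto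
    define f where "f = (\<lambda>n. residue_sum (P N) (a N) n - residue_mean (P N) (a N))"
    have "{n\<in>{..<N}. \<bar>f n\<bar> \<ge> e * L} \<subseteq> {n\<in>{..<N}. (f n)\<^sup>2 \<ge> (e * L)\<^sup>2}"
    proof safe
      fix n assume "e * L \<le> \<bar>f n\<bar>"
      hence "(e * L)\<^sup>2 \<le> \<bar>f n\<bar>\<^sup>2" using e L0 by (intro power_mono) auto
      thus "(e * L)\<^sup>2 \<le> (f n)\<^sup>2" by simp
    qed
    hence "card {n\<in>{..<N}. \<bar>f n\<bar> \<ge> e * L} \<le> card {n\<in>{..<N}. (f n)\<^sup>2 \<ge> (e * L)\<^sup>2}" by (intro card_mono) auto
    hence "(e * L)\<^sup>2 * real (card {n\<in>{..<N}. \<bar>f n\<bar> \<ge> e * L}) \<le> (e * L)\<^sup>2 * real (card {n\<in>{..<N}. (f n)\<^sup>2 \<ge> (e * L)\<^sup>2})"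
      by (intro mult_left_mono) auto
    also have "\<dots> \<le> (\<Sum>n<N. (f n)\<^sup>2)" by (rule markov_card) simp
    also have "\<dots> \<le> real N * (\<Sum>p\<in>P N. (ln (real p))\<^sup>2) + real (K N) ^ 2 * (\<Sum>p\<in>P N. ln (real p))\<^sup>2"
      unfolding f_def by (rule residue_sum_second_moment) (use P a in auto)
    also have "\<dots> \<le> real N * (U * l\<^sup>2) + U ^ 2 * (U * l)\<^sup>2"
      using s1 s2 s0 U by (intro add_mono mult_mono power_mono) (auto intro!: sum_nonneg)
    also have "\<dots> = real N * (U * l\<^sup>2 + U ^ 4 * l\<^sup>2 / real N)" using N0 by (simp add: field_simps power2_eq_square eval_nat_numeral)
    finally have "real (card {n\<in>{..<N}. \<bar>f n\<bar> \<ge> e * L}) \<le> real N * (U * l\<^sup>2 + U ^ 4 * l\<^sup>2 / real N) / (e * L)\<^sup>2"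
      using e L0 by (simp add: pos_le_divide_eq mult.commute)
    thus ?case by (simp add: f_def g_def U_def l_def L_def)
  qed
qed

text \<open>\<open>n mod p ^ j < K\<close> is implied by a carry for any \<open>k <= K\<close>, so
  this bounds the higher carries for all such \<open>k\<close> simultaneously. Powers above
  \<open>N\<close> are left out: there both residues are the numbers themselves, and
  \<open>k <= n\<close> excludes a carry.\<close>

definition higher_carries :: "nat \<Rightarrow> nat \<Rightarrow> nat \<Rightarrow> real" where
  "higher_carries N K n = (\<Sum>p\<in>primes_le K. \<Sum>j=2..N. ln (real p) * (if p ^ j \<le> N \<and> n mod p ^ j < K then 1 else 0))"

text \<open>Markov's inequality. For q = p^j up to \<open>N\<close> there are at most (N / q + 1) k,
  hence 2 N k / q, integers \<open>n < N\<close> with \<open>n mod q < k\<close>; the restriction to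
  q up to \<open>N\<close> absorbs the rounding. The mean is then O(K^(3/4) ln K), which is o(ln
  N).\<close>

lemma negligible_events_higher_carries:
  assumes e: "e > 0" and C: "C > 0"
    and K: "eventually (\<lambda>N. real (K N) \<le> C * ln (real N)) sequentially"
  shows "negligible_events (\<lambda>N n. higher_carries N (K N) n \<ge> e * ln (real N))"
proof -
  let ?U = "\<lambda>N. (C * ln (real N)) powr (3/4) * ln (C * ln (real N))"
  obtain D where D: "D \<ge> 0" "\<forall>K J. K > 0 \<longrightarrow> prime_power_weight K J \<le> D * (real K powr (3/4) * ln (real K))"
    using prime_power_sum_bound by blast
  define g where "g = (\<lambda>N. 2 * D * ?U N / (e * ln (real N)))"
  have g: "g \<longlonglongrightarrow> 0" unfolding g_def using e C by real_asymp
  have big: "eventually (\<lambda>N. C * ln (real N) > 1) sequentially" using C by real_asymp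
  have "eventually (\<lambda>N. real (card {n\<in>{..<N}. higher_carries N (K N) n \<ge> e * ln (real N)}) \<le> real N * g N) sequentially"
    using K big eventually_gt_at_top[of 1]
  proof eventually_elim
    case (elim N)
    define k where "k = K N"
    let ?b = "\<lambda>p j n. if p ^ j \<le> N \<and> n mod p ^ j < k then 1 else 0 :: real"
    have L0: "ln (real N) > 0" using elim by simp
    note lnp = ln_prime_nonneg
    have nonneg: "higher_carries N k n \<ge> 0" for n
      unfolding higher_carries_def using lnp by (intro sum_nonneg mult_nonneg_nonneg) auto
    have count: "(\<Sum>n<N. ?b p j n) \<le> 2 * real N * (real k / real p ^ j) powr (3/4)"
      if p: "prime p" for p j
    proof (cases "p ^ j \<le> N \<and> k > 0")
      case False
      have "?b p j n = 0" for n using False by auto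
      thus ?thesis by simp
    next
      case True
      define q where "q = p ^ j"
      have q: "q > 0" "q \<le> N" "k > 0" using p prime_gt_0_nat True by (auto simp: q_def)
      have "(\<Sum>n<N. ?b p j n) = real (card {n\<in>{..<N}. n mod q < k})"
        using q unfolding q_def by (simp add: sum.If_cases Int_def)
      also have "\<dots> \<le> 2 * real N * (real k / real q) powr (3/4)"
      proof (cases "q \<le> k")
        case True
        have "card {n\<in>{..<N}. n mod q < k} \<le> card {..<N}" by (intro card_mono) auto
        hence "real (card {n\<in>{..<N}. n mod q < k}) \<le> real N * 1" by simp
        also have "\<dots> \<le> real N * (real k / real q) powr (3/4)"
          using True q by (intro mult_left_mono ge_one_powr_ge_zero) auto
        also have "\<dots> \<le> 2 * real N * (real k / real q) powr (3/4)" by (intro mult_right_mono) auto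
        finally show ?thesis .
      next
        case False
        have "real (card {n\<in>{..<N}. n mod q < k}) \<le> (real (N div q) + 1) * real k"
        proof -
          have "real (card {n\<in>{..<N}. n mod q < k}) \<le> real ((N div q + 1) * k)"
            using card_mod_less[OF q(1), of N k] by (simp only: of_nat_le_iff)
          thus ?thesis by (simp only: of_nat_mult of_nat_add of_nat_1)
        qed
        also have "real (N div q) \<le> real N / real q" by (rule of_nat_div_le_of_nat)
        hence "(real (N div q) + 1) * real k \<le> (real N / real q + real N / real q) * real k"
          using q by (intro mult_right_mono add_mono) auto
        also have "\<dots> = 2 * real N * (real k / real q)" by simp
        also have "\<dots> \<le> 2 * real N * (real k / real q) powr (3/4)"
        proof (intro mult_left_mono)
          have "(real k / real q) powr 1 \<le> (real k / real q) powr (3/4)"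
            using q False by (intro powr_mono') auto
          thus "real k / real q \<le> (real k / real q) powr (3/4)" using q by simp
        qed auto
        finally show ?thesis .
      qed
      finally show ?thesis by (simp add: q_def)
    qed
    have "(\<Sum>n<N. higher_carries N k n) = (\<Sum>p\<in>primes_le k. \<Sum>j=2..N. ln (real p) * (\<Sum>n<N. ?b p j n))"
    proof -
      have "(\<Sum>n<N. higher_carries N k n) = (\<Sum>p\<in>primes_le k. \<Sum>n<N. \<Sum>j=2..N. ln (real p) * ?b p j n)"
        unfolding higher_carries_def by (rule sum.swap)
      also have "\<dots> = (\<Sum>p\<in>primes_le k. \<Sum>j=2..N. \<Sum>n<N. ln (real p) * ?b p j n)"
        by (intro sum.cong refl sum.swap)
      finally show ?thesis by (simp only: sum_distrib_left)
    qed
    also have "\<dots> \<le> (\<Sum>p\<in>primes_le k. \<Sum>j=2..N. ln (real p) * (2 * real N * (real k / real p ^ j) powr (3/4)))"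
      using lnp count by (intro sum_mono mult_left_mono) auto
    also have "\<dots> = 2 * real N * prime_power_weight k N"
      by (simp add: sum_distrib_left mult_ac)
    also have "\<dots> \<le> 2 * real N * (D * ?U N)"
    proof (intro mult_left_mono)
      show "prime_power_weight k N \<le> D * ?U N"
      proof (cases "k = 0")
        case True
        have eq: "primes_le k = {}" using True by (auto dest: prime_gt_0_nat)
        show ?thesis unfolding eq using D(1) elim by simp
      next
        case False
        hence "prime_power_weight k N \<le> D * (real k powr (3/4) * ln (real k))"
          using D(2) by blast
        also have "\<dots> \<le> D * ?U N"
          using D(1) False elim unfolding k_def by (intro mult_left_mono mult_mono powr_mono2 ln_mono) auto
        finally show ?thesis .
      qed
    qed auto
    finally have tot: "(\<Sum>n<N. higher_carries N k n) \<le> 2 * real N * (D * ?U N)" .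
    have "e * ln (real N) * real (card {n\<in>{..<N}. higher_carries N k n \<ge> e * ln (real N)}) \<le> (\<Sum>n<N. higher_carries N k n)"
      by (rule markov_card) (rule nonneg)
    also note tot
    finally have "real (card {n\<in>{..<N}. higher_carries N k n \<ge> e * ln (real N)}) \<le> 2 * real N * (D * ?U N) / (e * ln (real N))"
      using e L0 by (simp add: pos_le_divide_eq mult.commute)
    thus ?case by (simp add: g_def k_def mult_ac)
  qed
  thus ?thesis using g by (rule negligible_events_comparison)
qed

section \<open>Almost all integers\<close>

abbreviation grid_step :: "real \<Rightarrow> nat \<Rightarrow> nat" where
  "grid_step \<delta> K \<equiv> Suc (nat \<lfloor>\<delta>\<^sup>2 * real K\<rfloor>)"

text \<open>
  Enlarging the residue intervals by \<open>grid_step \<delta> K\<close> costs \<open>O(\<delta> K)\<close>: it is at most \<open>1\<close> for the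
  primes up to \<open>\<delta> K\<close> and \<open>O(\<delta>)\<close> in density for the larger ones.
\<close>
lemma residue_mean_le:
  assumes \<delta>: "0 < \<delta>" "\<delta> \<le> 1 / 2"
  shows "\<exists>C K\<^sub>0. \<forall>K\<ge>K\<^sub>0. \<forall>k\<le>K. residue_mean (primes_le (k + grid_step \<delta> K)) (\<lambda>p. min p (k mod p + grid_step \<delta> K))
     \<le> (1 - euler_mascheroni) * real K + 15 * \<delta> * real K + C"
proof -
  obtain C1 where C1: "C1 \<ge> 0" "\<forall>z. \<bar>theta z - real z\<bar> \<le> \<delta> * real z + C1"
    using sublinearD[OF sublinear_theta \<delta>(1)] by blast
  obtain C2 where C2: "C2 \<ge> 0" "\<forall>z. \<bar>carry_sum z - (1 - euler_mascheroni) * real z\<bar> \<le> \<delta> * real z + C2"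
    using sublinearD[OF sublinear_carry_sum \<delta>(1)] by blast
  have theta_le: "theta z \<le> 2 * real z + C1" for z
  proof -
    have "\<delta> * real z \<le> 1 * real z" using \<delta> by (intro mult_right_mono) auto
    thus ?thesis using spec[OF C1(2), of z] by linarith
  qed
  \<comment> \<open>The factor 15 collects 4 from the primes between k and k + s, 2 from the primes
    up to y, 8 from the enlargement at larger primes and 1 from the error of
    \<open>carry_sum\<close>; the constant collects 2 + 1 + 2 copies of \<open>C1\<close>.\<close>
  have "residue_mean (primes_le (k + grid_step \<delta> K)) (\<lambda>p. min p (k mod p + grid_step \<delta> K))
     \<le> (1 - euler_mascheroni) * real K + 15 * \<delta> * real K + (C2 + 5 * C1)"
    if K: "K \<ge> nat \<lceil>2 / \<delta>\<^sup>2\<rceil>" and k: "k \<le> K" for K k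
  proof -
    define s where "s = grid_step \<delta> K"
    define y where "y = nat \<lfloor>\<delta> * real K\<rfloor>"
    \<comment> \<open>Once \<open>\<delta>\<^sup>2 * K\<close> is at least 2, rounding in the grid
      step costs at most a factor 2.\<close>
    have "2 / \<delta>\<^sup>2 \<le> real K" using K by linarith
    hence dK2: "2 \<le> \<delta>\<^sup>2 * real K" using \<delta> by (simp add: field_simps)
    have dsq: "\<delta>\<^sup>2 \<le> \<delta> / 2"
    proof -
      have "\<delta> * \<delta> \<le> \<delta> * (1 / 2)" using \<delta> by (intro mult_left_mono) auto
      thus ?thesis by (simp add: power2_eq_square)
    qed
    have dsqK: "\<delta>\<^sup>2 * real K \<le> \<delta> / 2 * real K" using dsq by (intro mult_right_mono) auto
    have dK: "4 \<le> \<delta> * real K" using dK2 dsqK by linarith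
    have dKK: "\<delta> * real K \<le> 1 / 2 * real K" using \<delta> by (intro mult_right_mono) auto
    have s_le: "real s \<le> 2 * (\<delta>\<^sup>2 * real K)" using dK2 unfolding s_def by linarith
    have s_le': "real s \<le> \<delta> * real K" using s_le dsqK by linarith
    have y_ge: "real y \<ge> \<delta> * real K / 2" "real y \<le> \<delta> * real K" using dK unfolding y_def by linarith+
    have y0: "real y > 0" using y_ge dK by linarith
    have "s \<le> K" using s_le' dKK by linarith
    \<comment> \<open>The step is at most twice \<open>\<delta>\<^sup>2 * K\<close> and the cutoff
      at least half of \<open>\<delta> * K\<close>; the quotient gives 4.\<close>
    have sy: "real s / real y \<le> 4 * \<delta>"
    proof -
      have "real s \<le> 4 * \<delta> * (\<delta> * real K / 2)" using s_le by (simp add: power2_eq_square mult_ac)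
      also have "\<dots> \<le> 4 * \<delta> * real y" using y_ge \<delta> by (intro mult_left_mono) auto
      finally show ?thesis using y0 by (simp add: field_simps)
    qed
    note lnp = ln_prime_nonneg
    let ?w = "\<lambda>p. ln (real p) * (real (min p (k mod p + s)) / real p)"
    let ?P1 = "primes_le k" and ?P2 = "{p. prime p \<and> k < p \<and> p \<le> k + s}"
    have fin: "finite ?P1" "finite ?P2" by simp_all
    have Pun: "primes_le (k + s) = ?P1 \<union> ?P2" by auto
    have disj: "?P1 \<inter> ?P2 = {}" by auto
    have "residue_mean (primes_le (k + s)) (\<lambda>p. min p (k mod p + s))
       = (\<Sum>p\<in>?P1. ?w p) + (\<Sum>p\<in>?P2. ?w p)"
      unfolding residue_mean_def Pun by (rule sum.union_disjoint[OF fin disj])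
    also have "(\<Sum>p\<in>?P2. ?w p) \<le> (\<Sum>p\<in>?P2. ln (real p))"
    proof (rule sum_mono)
      fix p assume "p \<in> ?P2"
      hence p: "prime p" "real p > 0" using prime_gt_0_nat by auto
      have "real (min p (k mod p + s)) / real p \<le> 1" using p by simp
      from mult_left_mono[OF this lnp[OF p(1)]]
      show "?w p \<le> ln (real p)" by simp
    qed
    also have "(\<Sum>p\<in>?P2. ln (real p)) = theta (k + s) - theta k"
      unfolding theta_def Pun sum.union_disjoint[OF fin disj] by simp
    \<comment> \<open>The primes in this short interval are counted by the prime number theorem:
      length \<open>s\<close> plus the errors at both ends, each O(\<open>\<delta> * K\<close>) up
      to a constant.\<close>
    also have "theta (k + s) - theta k \<le> 4 * \<delta> * real K + 2 * C1"
    proof -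
      have "\<delta> * real (k + s) \<le> \<delta> * real (2 * K)" using k \<open>s \<le> K\<close> \<delta> by (intro mult_left_mono) auto
      moreover have "\<delta> * real k \<le> \<delta> * real K" using k \<delta> by (intro mult_left_mono) auto
      moreover have "\<delta> * real (2 * K) = 2 * (\<delta> * real K)" by simp
      moreover have "theta (k + s) \<le> real (k + s) + \<delta> * real (k + s) + C1" using spec[OF C1(2), of "k + s"] by linarith
      moreover have "theta k \<ge> real k - \<delta> * real k - C1" using spec[OF C1(2), of k] by linarith
      ultimately show ?thesis using s_le' by simp
    qed
    also have "(\<Sum>p\<in>?P1. ?w p)
        \<le> (\<Sum>p\<in>?P1. ln (real p) * (real (k mod p) / real p) + ((if p \<le> y then ln (real p) else 0) + ln (real p) * (real s / real y)))"
    proof (rule sum_mono)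
      fix p assume "p \<in> ?P1"
      hence p: "prime p" "real p > 0" using prime_gt_0_nat by auto
      have "real (min p (k mod p + s)) \<le> real (k mod p) + real (min p s)" by linarith
      hence "real (min p (k mod p + s)) / real p \<le> real (k mod p) / real p + real (min p s) / real p"
        using p by (simp add: divide_right_mono flip: add_divide_distrib)
      from mult_left_mono[OF this lnp[OF p(1)]]
      have "?w p \<le> ln (real p) * (real (k mod p) / real p) + ln (real p) * (real (min p s) / real p)"
        by (simp add: distrib_left)
      moreover have "ln (real p) * (real (min p s) / real p) \<le> (if p \<le> y then ln (real p) else 0) + ln (real p) * (real s / real y)"
      proof (cases "p \<le> y")
        case True
        have "real (min p s) / real p \<le> 1" using p by simp
        from mult_left_mono[OF this lnp[OF p(1)]] have "ln (real p) * (real (min p s) / real p) \<le> ln (real p)" by simp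
        moreover have "ln (real p) * (real s / real y) \<ge> 0" using lnp[OF p(1)] by (intro mult_nonneg_nonneg) auto
        ultimately show ?thesis using True by simp
      next
        case False
        have "real (min p s) / real p \<le> real s / real y" using False y0 by (intro frac_le) auto
        from mult_left_mono[OF this lnp[OF p(1)]] show ?thesis using False by simp
      qed
      ultimately show "?w p
         \<le> ln (real p) * (real (k mod p) / real p) + ((if p \<le> y then ln (real p) else 0) + ln (real p) * (real s / real y))" by linarith
    qed
    also have "\<dots> = carry_sum k + (\<Sum>p\<in>?P1. if p \<le> y then ln (real p) else 0) + theta k * (real s / real y)"
      by (simp only: sum.distrib carry_sum_def theta_def sum_distrib_right add.assoc)
    also have "(\<Sum>p\<in>?P1. if p \<le> y then ln (real p) else 0) \<le> theta y"
    proof -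
      have "(\<Sum>p\<in>?P1. if p \<le> y then ln (real p) else 0) = (\<Sum>p\<in>?P1 \<inter> {p. p \<le> y}. ln (real p))"
        by (simp add: sum.If_cases)
      also have "\<dots> \<le> theta y" unfolding theta_def using lnp by (intro sum_mono2) auto
      finally show ?thesis .
    qed
    also have "theta y \<le> 2 * (\<delta> * real K) + C1" using theta_le[of y] y_ge by linarith
    also have "theta k * (real s / real y) \<le> 8 * \<delta> * real K + 2 * C1"
    proof -
      have "theta k * (real s / real y) \<le> (2 * real K + C1) * (4 * \<delta>)"
        using theta_le[of k] k sy C1(1) by (intro mult_mono) auto
      also have "\<dots> = 8 * \<delta> * real K + C1 * (4 * \<delta>)" by (simp add: algebra_simps)
      also have "C1 * (4 * \<delta>) \<le> C1 * 2" using \<delta> C1 by (intro mult_left_mono) auto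
      finally show ?thesis by simp
    qed
    also have "carry_sum k \<le> (1 - euler_mascheroni) * real K + \<delta> * real K + C2"
    proof -
      have "(1 - euler_mascheroni) * real k \<le> (1 - euler_mascheroni) * real K"
        using k euler_mascheroni_less_13_over_22 by (intro mult_left_mono) auto
      moreover have "\<delta> * real k \<le> \<delta> * real K" using k \<delta> by (intro mult_left_mono) auto
      ultimately show ?thesis using spec[OF C2(2), of k] by linarith
    qed
    finally show ?thesis unfolding s_def by (simp add: algebra_simps)
  qed
  thus ?thesis by blast
qed

section \<open>Bounds for u(n,k) by carries and the two halves of the threshold estimate\<close>

abbreviation exceeds :: "real \<Rightarrow> nat \<Rightarrow> nat \<Rightarrow> bool" where
  "exceeds c n k \<equiv> real (u_binom n k) > real n powr c"

lemma u_binom_pos: "u_binom n k > 0"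
  unfolding u_binom_def by (intro prod_pos) (auto dest: prime_gt_0_nat)

lemma ln_u_binom:
  assumes "k \<le> n"
  shows "ln (real (u_binom n k)) = (\<Sum>p\<in>primes_le k. ln (real p) * (\<Sum>j=1..n. carry n k (p ^ j)))"
proof -
  have "ln (real (u_binom n k)) = (\<Sum>p\<in>primes_le k. ln (real (p ^ multiplicity p (n choose k))))"
    unfolding u_binom_def of_nat_prod by (intro ln_prod) (auto dest: prime_gt_0_nat)
  also have "\<dots> = (\<Sum>p\<in>primes_le k. ln (real p) * (\<Sum>j=1..n. carry n k (p ^ j)))"
  proof (rule sum.cong)
    fix p assume "p \<in> primes_le k"
    hence p: "prime p" "p > 0" using prime_gt_0_nat by auto
    have "real (multiplicity p (n choose k)) = (\<Sum>j=1..n. carry n k (p ^ j))"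
      unfolding kummer[OF p(1) assms] of_nat_sum by (intro sum.cong) auto
    thus "ln (real (p ^ multiplicity p (n choose k))) = ln (real p) * (\<Sum>j=1..n. carry n k (p ^ j))"
      using p by (simp add: ln_realpow)
  qed simp
  finally show ?thesis .
qed

abbreviation carry_residue :: "nat \<Rightarrow> nat \<Rightarrow> real" where
  "carry_residue k \<equiv> residue_sum (primes_le k) (\<lambda>p. k mod p)"

lemma carry_sum_conv_residue_mean: "carry_sum k = residue_mean (primes_le k) (\<lambda>p. k mod p)"
  by (simp add: residue_mean_def carry_sum_def)

text \<open>Keeping only the carry out of the last digit in each prime base already gives the lower
  bound.\<close>

lemma residue_sum_le_ln_u_binom:
  assumes "k \<le> n" "n > 0"
  shows "carry_residue k n \<le> ln (real (u_binom n k))"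
  unfolding ln_u_binom[OF assms(1)] residue_sum_def
proof (intro sum_mono mult_left_mono)
  fix p assume "p \<in> primes_le k"
  thus "0 \<le> ln (real p)" using prime_ge_1_nat[of p] by simp
  have "carry n k (p ^ 1) \<le> (\<Sum>j=1..n. carry n k (p ^ j) :: real)"
    using assms by (intro member_le_sum) auto
  thus "carry n k p \<le> (\<Sum>j=1..n. carry n k (p ^ j) :: real)" by simp
qed

text \<open>The right-hand side depends on \<open>k\<close> only through its grid point
  \<open>k0\<close>, because \<open>k mod p <= k0 mod p + (k - k0)\<close> and all primes up to
  \<open>k\<close> lie below \<open>k0 + s\<close>. One exceptional event thus serves a whole
  cell.\<close>

lemma ln_u_binom_le:
  assumes k: "k \<le> n" "k0 \<le> k" "k < k0 + s" "k \<le> K" and n: "n > 0" "n < N"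
  shows "ln (real (u_binom n k)) \<le> residue_sum (primes_le (k0 + s)) (\<lambda>p. min p (k0 mod p + s)) n + higher_carries N K n"
proof -
  let ?R = "residue_sum (primes_le (k0 + s)) (\<lambda>p. min p (k0 mod p + s)) n"
  let ?b = "\<lambda>p j. if p ^ j \<le> N \<and> n mod p ^ j < K then 1 else 0 :: real"
  note lnp = ln_prime_nonneg
  have "ln (real (u_binom n k)) = (\<Sum>p\<in>primes_le k. ln (real p) * carry n k p)
      + (\<Sum>p\<in>primes_le k. \<Sum>j=2..n. ln (real p) * carry n k (p ^ j))"
  proof -
    have "{1..n} = insert 1 {2..n}" using n by auto
    hence "(\<Sum>j=1..n. carry n k (p ^ j)) = carry n k p + (\<Sum>j=2..n. carry n k (p ^ j) :: real)" for p
      by simp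
    thus ?thesis unfolding ln_u_binom[OF k(1)] by (simp only: distrib_left sum.distrib sum_distrib_left)
  qed
  also have "(\<Sum>p\<in>primes_le k. ln (real p) * carry n k p) \<le> ?R"
  proof -
    have "(\<Sum>p\<in>primes_le k. ln (real p) * carry n k p)
        \<le> (\<Sum>p\<in>primes_le k. ln (real p) * (if n mod p < min p (k0 mod p + s) then 1 else 0))"
    proof (intro sum_mono mult_left_mono)
      fix p assume "p \<in> primes_le k"
      hence p: "prime p" "p > 0" using prime_gt_0_nat by auto
      show "0 \<le> ln (real p)" using lnp p by simp
      have "k mod p \<le> k0 mod p + (k - k0)"
      proof -
        have "k mod p = (k0 mod p + (k - k0)) mod p" using k mod_add_left_eq[of k0 p "k - k0"] by simp
        also have "\<dots> \<le> k0 mod p + (k - k0)" by (rule mod_less_eq_dividend)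
        finally show ?thesis .
      qed
      also have "\<dots> < k0 mod p + s" using k by simp
      finally have "k mod p < k0 mod p + s" .
      moreover have "n mod p < p" using p by simp
      ultimately show "carry n k p \<le> (if n mod p < min p (k0 mod p + s) then 1 else (0::real))" by auto
    qed
    also have "\<dots> \<le> ?R"
      unfolding residue_sum_def using k lnp by (intro sum_mono2) auto
    finally show ?thesis .
  qed
  also have "(\<Sum>p\<in>primes_le k. \<Sum>j=2..n. ln (real p) * carry n k (p ^ j)) \<le> higher_carries N K n"
  proof -
    have "(\<Sum>p\<in>primes_le k. \<Sum>j=2..n. ln (real p) * carry n k (p ^ j))
       \<le> (\<Sum>p\<in>primes_le k. \<Sum>j=2..N. ln (real p) * ?b p j)"
    proof (rule sum_mono)
      fix p assume "p \<in> primes_le k"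
      hence p: "prime p" by auto
      have "(\<Sum>j=2..n. ln (real p) * carry n k (p ^ j))
         \<le> (\<Sum>j=2..n. ln (real p) * ?b p j)"
      proof (intro sum_mono mult_left_mono lnp p)
        fix j
        have "p ^ j \<le> N \<and> n mod p ^ j < K" if less: "n mod p ^ j < k mod p ^ j"
        proof
          show "p ^ j \<le> N"
          proof (rule ccontr)
            assume "\<not> p ^ j \<le> N"
            hence "n mod p ^ j = n" "k mod p ^ j = k" using n k by auto
            thus False using less k by simp
          qed
          have "k mod p ^ j \<le> k" by simp
          thus "n mod p ^ j < K" using less k by linarith
        qed
        thus "carry n k (p ^ j) \<le> ?b p j" by auto
      qed
      also have "\<dots> \<le> (\<Sum>j=2..N. ln (real p) * ?b p j)"
        using n lnp[OF p] by (intro sum_mono2) auto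
      finally show "(\<Sum>j=2..n. ln (real p) * carry n k (p ^ j)) \<le> (\<Sum>j=2..N. ln (real p) * ?b p j)" .
    qed
    also have "\<dots> \<le> higher_carries N K n"
      unfolding higher_carries_def using k lnp by (intro sum_mono2 sum_nonneg mult_nonneg_nonneg) auto
    finally show ?thesis .
  qed
  finally show ?thesis by simp
qed

lemma u_binom_gt_iff: "n > 0 \<Longrightarrow> exceeds c n k \<longleftrightarrow> ln (real (u_binom n k)) > c * ln (real n)"
  using u_binom_pos[of n k] by (subst ln_less_cancel_iff[symmetric]) (auto simp: ln_powr)

lemma one_minus_euler_pos: "1 - euler_mascheroni > (0::real)"
  using euler_mascheroni_less_13_over_22 by simp

text \<open>A crossing at one single index, \<open>K N\<close>, is enough here, so neither a grid
  nor the higher carries enter.\<close>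

lemma negligible_events_upper:
  assumes c: "c > 0" and \<eta>: "\<eta> > 0"
  shows "negligible_events (\<lambda>N n. \<not> (\<exists>k\<le>n. exceeds c n k \<and> real k \<le> (c / (1 - euler_mascheroni) + \<eta>) * ln (real n)))"
proof -
  define g where "g = (1 - euler_mascheroni :: real)"
  have g: "g > 0" using one_minus_euler_pos by (simp add: g_def)
  define A where "A = c / g + \<eta> / 2"
  \<comment> \<open>Taking \<open>A\<close> halfway into the margin gives
    \<open>g * A = c + 4 * \<delta>\<close>. One \<open>\<delta>\<close> each is spent on the error
    of \<open>carry_sum\<close>, on the constants and on the deviation; the fourth makes the
    inequality strict.\<close>
  define \<delta> where "\<delta> = g * \<eta> / 8"
  have A: "A > 0" using c g \<eta> by (simp add: A_def add_pos_pos)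
  have \<delta>: "\<delta> > 0" using g \<eta> by (simp add: \<delta>_def)
  have gA: "g * A = c + 4 * \<delta>" using g by (simp add: A_def \<delta>_def field_simps)
  \<comment> \<open>Solves \<open>(c / g + \<eta>) * (1 - \<tau>) = A\<close>, so that A ln N stays
    below (c / g + eta) ln n for n at least N^(1 - tau).\<close>
  define \<tau> where "\<tau> = \<eta> / (2 * (c / g + \<eta>))"
  have cg: "c / g > 0" using c g by simp
  have \<tau>: "0 < \<tau>" "\<tau> < 1"
  proof -
    have "\<eta> < 2 * (x + \<eta>)" if "x > 0" for x
      using add_pos_pos[OF that add_pos_pos[OF that \<eta>]] by (simp add: algebra_simps)
    from this[OF cg] show "0 < \<tau>" "\<tau> < 1" unfolding \<tau>_def using \<eta> by (simp_all only: divide_less_eq_1_pos divide_pos_pos)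
  qed
  have A\<tau>: "(c / g + \<eta>) * (1 - \<tau>) = A"
  proof -
    have cancel: "y * (\<eta> / (2 * y)) = \<eta> / 2" if "y \<noteq> 0" for y using that by simp
    have "(c / g + \<eta>) * \<tau> = \<eta> / 2" unfolding \<tau>_def using add_pos_pos[OF cg \<eta>] by (intro cancel) simp
    thus ?thesis by (simp add: A_def right_diff_distrib)
  qed
  define K where "K = (\<lambda>N. nat \<lfloor>A * ln (real N)\<rfloor>)"
  obtain C where C: "C \<ge> 0" "\<forall>z. \<bar>carry_sum z - g * real z\<bar> \<le> \<delta> / A * real z + C"
    using sublinearD[OF sublinear_carry_sum, of "\<delta> / A"] \<delta> A unfolding g_def by auto
  have ev1: "eventually (\<lambda>N. g + C < \<delta> * ln (real N)) sequentially" using \<delta> by real_asymp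
  have ev2: "eventually (\<lambda>N. A * ln (real N) \<le> real N powr (1 - \<tau>)) sequentially" using A \<tau> by real_asymp
  have K_le: "eventually (\<lambda>N. real (K N) \<le> A * ln (real N)) sequentially"
    using eventually_gt_at_top[of 1]
  proof eventually_elim
    case (elim N)
    have "0 \<le> A * ln (real N)" using A elim by simp
    thus ?case unfolding K_def by linarith
  qed
  have n1: "negligible_events (\<lambda>N n. \<bar>carry_residue (K N) n - carry_sum (K N)\<bar> \<ge> \<delta> * ln (real N))"
    unfolding carry_sum_conv_residue_mean
    by (rule negligible_events_residue_sum[OF \<delta> A K_le]) (auto simp: less_imp_le prime_gt_0_nat)
  have n2: "negligible_events (\<lambda>N n. real n < real N powr (1 - \<tau>))" by (rule negligible_events_small[OF \<tau>])
  show ?thesis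
  proof (rule negligible_events_mono[OF negligible_events_disj[OF n1 n2]])
    show "eventually (\<lambda>N. \<forall>n<N. \<not> (\<exists>k\<le>n. exceeds c n k \<and> real k \<le> (c / (1 - euler_mascheroni) + \<eta>) * ln (real n)) \<longrightarrow>
       \<bar>carry_residue (K N) n - carry_sum (K N)\<bar> \<ge> \<delta> * ln (real N) \<or> real n < real N powr (1 - \<tau>)) sequentially"
      using ev1 ev2 K_le eventually_gt_at_top[of 1]
    proof eventually_elim
      case (elim N)
      show ?case
      proof (intro allI impI, rule ccontr)
        fix n assume n: "n < N" and none: "\<not> (\<exists>k\<le>n. exceeds c n k \<and> real k \<le> (c / (1 - euler_mascheroni) + \<eta>) * ln (real n))"
          and good: "\<not> (\<bar>carry_residue (K N) n - carry_sum (K N)\<bar> \<ge> \<delta> * ln (real N) \<or> real n < real N powr (1 - \<tau>))"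
        define L where "L = ln (real N)"
        have L: "L > 0" using elim by (simp add: L_def)
        have nN: "real n \<ge> real N powr (1 - \<tau>)" using good by simp
        moreover have "real N powr (1 - \<tau>) > 0" using elim by simp
        ultimately have n0: "n > 0" by (cases n) auto
        have lnn1: "ln (real n) \<le> L" using n n0 by (simp add: L_def)
        have lnn2: "ln (real n) \<ge> (1 - \<tau>) * L"
        proof -
          have "ln (real N powr (1 - \<tau>)) \<le> ln (real n)" using nN elim n0 by (intro ln_mono) auto
          thus ?thesis using elim by (simp add: L_def ln_powr)
        qed
        have kn: "K N \<le> n" using elim(2,3) nN by linarith
        have KA: "real (K N) \<le> A * L" "real (K N) > A * L - 1"
          using elim(3) unfolding K_def L_def by linarith+
        have "real (K N) \<le> (c / g + \<eta>) * (1 - \<tau>) * L" using KA A\<tau> by simp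
        also have "\<dots> = (c / g + \<eta>) * ((1 - \<tau>) * L)" by simp
        also have "\<dots> \<le> (c / g + \<eta>) * ln (real n)" using lnn2 cg \<eta> by (intro mult_left_mono) auto
        finally have Kle: "real (K N) \<le> (c / (1 - euler_mascheroni) + \<eta>) * ln (real n)" by (simp add: g_def)
        have "carry_sum (K N) \<ge> g * real (K N) - (\<delta> / A * real (K N) + C)" using spec[OF C(2), of "K N"] by linarith
        moreover have "\<delta> / A * real (K N) \<le> \<delta> * L"
        proof -
          have "\<delta> / A * real (K N) \<le> \<delta> / A * (A * L)" using KA \<delta> A by (intro mult_left_mono) auto
          thus ?thesis using A by simp
        qed
        moreover have "g * real (K N) \<ge> c * L + 4 * (\<delta> * L) - g"
        proof -
          have "g * (A * L - 1) \<le> g * real (K N)" using KA g by (intro mult_left_mono) auto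
          moreover have "g * (A * L - 1) = (g * A) * L - g" by (simp add: algebra_simps)
          ultimately show ?thesis unfolding gA by (simp add: algebra_simps)
        qed
        moreover have "g + C < \<delta> * L" using elim by (simp add: L_def)
        ultimately have "carry_sum (K N) > c * L + 2 * (\<delta> * L)" by linarith
        moreover have "carry_residue (K N) n > carry_sum (K N) - \<delta> * L"
          using good unfolding L_def[symmetric] by linarith
        moreover have "ln (real (u_binom n (K N))) \<ge> carry_residue (K N) n"
          by (rule residue_sum_le_ln_u_binom[OF kn n0])
        moreover have "\<delta> * L > 0" using \<delta> L by simp
        moreover have "c * ln (real n) \<le> c * L" using lnn1 c by (intro mult_left_mono) auto
        ultimately have "ln (real (u_binom n (K N))) > c * ln (real n)" by linarith
        hence "exceeds c n (K N)" using n0 by (simp add: u_binom_gt_iff)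
        thus False using none kn Kle by blast
      qed
    qed
  qed
qed

text \<open>A crossing \<open>k\<close> lies below \<open>K N\<close>, hence in one of boundedly
  many grid cells. Outside the exceptional events \<open>ln_u_binom_le\<close> and
  \<open>residue_mean_le\<close> keep ln u(n,k) below c ln n throughout that cell. The bound on
  \<open>\<eta>\<close> makes \<open>A\<close> positive.\<close>

lemma negligible_events_lower:
  assumes c: "c > 0" and \<eta>: "\<eta> > 0" "\<eta> < c / (1 - euler_mascheroni)"
  shows "negligible_events (\<lambda>N n. \<exists>k\<le>n. exceeds c n k \<and> real k < (c / (1 - euler_mascheroni) - \<eta>) * ln (real n))"
proof -
  define g where "g = (1 - euler_mascheroni :: real)"
  have g: "g > 0" using one_minus_euler_pos by (simp add: g_def)
  define A where "A = c / g - \<eta>"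
  have A: "A > 0" using \<eta> by (simp add: A_def g_def)
  \<comment> \<open>The margin is \<open>g * A = c - 2 * \<mu>\<close>. One \<open>\<mu>\<close>
    pays for replacing c ln n by c ln N; of the other, a quarter each goes to the enlarged intervals
    and the constant \<open>C\<close>, a fifth each to the deviation and the higher carries.\<close>
  define \<mu> where "\<mu> = g * \<eta> / 2"
  have \<mu>: "\<mu> > 0" using g \<eta> by (simp add: \<mu>_def)
  have gA: "g * A = c - 2 * \<mu>" using g by (simp add: A_def \<mu>_def field_simps)
  define \<tau> where "\<tau> = \<mu> / (c + \<mu>)"
  have \<tau>: "0 < \<tau>" "\<tau> < 1" using \<mu> c by (simp_all add: \<tau>_def)
  have c\<tau>: "c * \<tau> \<le> \<mu>" using \<mu> c by (simp add: \<tau>_def field_simps)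
  define \<delta> where "\<delta> = min (1 / 2) (\<mu> / (60 * A))"
  have \<delta>: "0 < \<delta>" "\<delta> \<le> 1 / 2" using \<mu> A by (simp_all add: \<delta>_def)
  have \<delta>A: "15 * \<delta> * A \<le> \<mu> / 4"
  proof -
    have "\<delta> \<le> \<mu> / (60 * A)" by (simp add: \<delta>_def)
    from mult_right_mono[OF this, of "15 * A"] show ?thesis using A by (simp add: mult_ac)
  qed
  define K where "K = (\<lambda>N. nat \<lfloor>A * ln (real N)\<rfloor>)"
  define s where "s = (\<lambda>N. grid_step \<delta> (K N))"
  \<comment> \<open>The cap by \<open>K N\<close> keeps each grid point in range for every
    \<open>i\<close>, as the union over \<open>i\<close> requires; for the cell containing
    \<open>k\<close> it has no effect.\<close>
  define k0 where "k0 = (\<lambda>i N. min (i * s N) (K N))"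
  define P where "P = (\<lambda>i N. primes_le (k0 i N + s N))"
  define a where "a = (\<lambda>i N p. min p (k0 i N mod p + s N))"
  define dev where "dev = (\<lambda>i N n. \<bar>residue_sum (P i N) (a i N) n - residue_mean (P i N) (a i N)\<bar>)"
  \<comment> \<open>The number of cells depends on \<open>\<delta>\<close> alone: each step exceeds
    \<open>\<delta>\<^sup>2 * K N\<close>.\<close>
  define I where "I = nat \<lceil>1 / \<delta>\<^sup>2\<rceil> + 1"
  obtain C K\<^sub>0 where CK: "\<forall>K\<ge>K\<^sub>0. \<forall>k\<le>K. residue_mean (primes_le (k + grid_step \<delta> K)) (\<lambda>p. min p (k mod p + grid_step \<delta> K))
     \<le> g * real K + 15 * \<delta> * real K + C" using residue_mean_le[OF \<delta>] unfolding g_def by blast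
  have ev1: "eventually (\<lambda>N. C < \<mu> / 4 * ln (real N)) sequentially" using \<mu> by real_asymp
  have ev2: "eventually (\<lambda>N. A * ln (real N) \<le> real N powr (1 - \<tau>)) sequentially" using A \<tau> by real_asymp
  have ev3: "eventually (\<lambda>N. A * ln (real N) > real K\<^sub>0 + 1) sequentially" using A by real_asymp
  have ev4: "eventually (\<lambda>N. ln (real N) > 1) sequentially" by real_asymp
  have K_le: "eventually (\<lambda>N. real (K N) \<le> A * ln (real N)) sequentially"
    using eventually_gt_at_top[of 1]
  proof eventually_elim
    case (elim N)
    have "0 \<le> A * ln (real N)" using A elim by simp
    thus ?case unfolding K_def by linarith
  qed
  have s_le: "real (s N) \<le> real (K N) + 1" for N
  proof -
    have "\<delta>\<^sup>2 \<le> 1\<^sup>2" using \<delta> by (intro power_mono) auto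
    hence "\<delta>\<^sup>2 * real (K N) \<le> 1 * real (K N)" by (intro mult_right_mono) auto
    moreover have "0 \<le> \<delta>\<^sup>2 * real (K N)" by simp
    ultimately show ?thesis unfolding s_def by linarith
  qed
  have s_gt: "real (s N) > \<delta>\<^sup>2 * real (K N)" for N unfolding s_def by linarith
  have A2: "2 * A + 1 > 0" using A by simp
  have \<mu>5: "\<mu> / 5 > 0" using \<mu> by simp
  have ks_le: "eventually (\<lambda>N. real (k0 i N + s N) \<le> (2 * A + 1) * ln (real N)) sequentially" for i
    using K_le ev4
  proof eventually_elim
    case (elim N)
    have "real (k0 i N) \<le> real (K N)" by (simp add: k0_def)
    moreover have "(2 * A + 1) * ln (real N) = 2 * (A * ln (real N)) + ln (real N)" by (simp add: algebra_simps)
    ultimately show ?case using elim s_le[of N] by simp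
  qed
  have n1: "negligible_events (\<lambda>N n. \<exists>i<I. dev i N n \<ge> \<mu> / 5 * ln (real N))"
    unfolding dev_def by (rule negligible_events_bex, rule negligible_events_residue_sum[OF \<mu>5 A2 ks_le]) (auto simp: P_def a_def)
  have n2: "negligible_events (\<lambda>N n. higher_carries N (K N) n \<ge> \<mu> / 5 * ln (real N))"
    by (rule negligible_events_higher_carries[OF \<mu>5 A K_le])
  have n3: "negligible_events (\<lambda>N n. real n < real N powr (1 - \<tau>))" by (rule negligible_events_small[OF \<tau>])
  show ?thesis
  proof (rule negligible_events_mono[OF negligible_events_disj[OF n1 negligible_events_disj[OF n2 n3]]])
    show "eventually (\<lambda>N. \<forall>n<N. (\<exists>k\<le>n. exceeds c n k \<and> real k < (c / (1 - euler_mascheroni) - \<eta>) * ln (real n)) \<longrightarrow>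
       (\<exists>i<I. dev i N n \<ge> \<mu> / 5 * ln (real N))
        \<or> higher_carries N (K N) n \<ge> \<mu> / 5 * ln (real N) \<or> real n < real N powr (1 - \<tau>)) sequentially"
      using ev1 ev2 ev3 ev4 K_le eventually_gt_at_top[of 1]
    proof eventually_elim
      case (elim N)
      show ?case
      proof (intro allI impI, rule ccontr)
        fix n assume n: "n < N" and ex: "\<exists>k\<le>n. exceeds c n k \<and> real k < (c / (1 - euler_mascheroni) - \<eta>) * ln (real n)"
          and good: "\<not> ((\<exists>i<I. dev i N n \<ge> \<mu> / 5 * ln (real N))
             \<or> higher_carries N (K N) n \<ge> \<mu> / 5 * ln (real N) \<or> real n < real N powr (1 - \<tau>))"
        obtain k where k: "k \<le> n" "exceeds c n k" "real k < A * ln (real n)"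
          using ex unfolding A_def g_def by blast
        define L where "L = ln (real N)"
        have L: "L > 0" using elim by (simp add: L_def)
        have nN: "real n \<ge> real N powr (1 - \<tau>)" using good by simp
        moreover have "real N powr (1 - \<tau>) > 0" using elim by simp
        ultimately have n0: "n > 0" by (cases n) auto
        have lnn1: "ln (real n) \<le> L" using n n0 by (simp add: L_def)
        have lnn2: "ln (real n) \<ge> (1 - \<tau>) * L"
        proof -
          have "ln (real N powr (1 - \<tau>)) \<le> ln (real n)" using nN elim n0 by (intro ln_mono) auto
          thus ?thesis using elim by (simp add: L_def ln_powr)
        qed
        have "A * ln (real n) \<le> A * L" using lnn1 A by (intro mult_left_mono) auto
        hence "real k < A * L" using k by linarith
        hence kK: "k \<le> K N" unfolding K_def L_def by linarith
        have K0: "K\<^sub>0 \<le> K N" using elim(3) unfolding K_def by linarith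
        have KA: "real (K N) \<le> A * L" using elim by (simp add: L_def)
        define i where "i = k div s N"
        have s0: "s N > 0" by (simp add: s_def)
        have ik: "i * s N \<le> k" "k < i * s N + s N"
          using s0 dividend_less_times_div[of "s N" k] by (simp_all add: i_def mult.commute)
        have k0i: "k0 i N = i * s N" using ik kK by (simp add: k0_def)
        have iI: "i < I"
        proof -
          have "real i * real (s N) \<le> real (K N)" using ik kK by (metis le_trans of_nat_le_iff of_nat_mult)
          moreover have "real i * (\<delta>\<^sup>2 * real (K N)) \<le> real i * real (s N)" using s_gt[of N] by (intro mult_left_mono) auto
          ultimately have *: "(real i * \<delta>\<^sup>2) * real (K N) \<le> 1 * real (K N)" by (simp add: mult.assoc)
          show ?thesis
          proof (cases "K N = 0")
            case True
            hence "i = 0" using kK by (simp add: i_def)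
            thus ?thesis by (simp add: I_def)
          next
            case False
            hence "real i * \<delta>\<^sup>2 \<le> 1" using * by simp
            hence "real i \<le> 1 / \<delta>\<^sup>2" using \<delta> by (simp add: field_simps)
            thus ?thesis unfolding I_def by linarith
          qed
        qed
        have X: "residue_sum (P i N) (a i N) n < residue_mean (P i N) (a i N) + \<mu> / 5 * L"
        proof -
          have "dev i N n < \<mu> / 5 * L"
            using good iI unfolding L_def by (meson not_le)
          thus ?thesis unfolding dev_def by linarith
        qed
        have H: "higher_carries N (K N) n < \<mu> / 5 * L" using good by (simp add: L_def)
        have "k0 i N \<le> K N" by (simp add: k0_def)
        hence "residue_mean (P i N) (a i N) \<le> g * real (K N) + 15 * \<delta> * real (K N) + C"
          using CK K0 unfolding P_def a_def s_def by blast
        moreover have "g * real (K N) \<le> c * L - 2 * (\<mu> * L)"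
        proof -
          have "g * real (K N) \<le> g * (A * L)" using KA g by (intro mult_left_mono) auto
          also have "\<dots> = (g * A) * L" by simp
          finally show ?thesis unfolding gA by (simp add: algebra_simps)
        qed
        moreover have "15 * \<delta> * real (K N) \<le> \<mu> / 4 * L"
        proof -
          have "15 * \<delta> * real (K N) \<le> 15 * \<delta> * (A * L)" using KA \<delta> by (intro mult_left_mono) auto
          also have "\<dots> = (15 * \<delta> * A) * L" by simp
          also have "\<dots> \<le> \<mu> / 4 * L" using \<delta>A L by (intro mult_right_mono) auto
          finally show ?thesis .
        qed
        moreover have "C < \<mu> / 4 * L" using elim by (simp add: L_def)
        moreover have "ln (real (u_binom n k)) \<le> residue_sum (P i N) (a i N) n + higher_carries N (K N) n"
          unfolding P_def a_def using ik by (intro ln_u_binom_le k kK n0 n) (simp_all add: k0i)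
        moreover have "\<mu> * L > 0" using \<mu> L by simp
        moreover have "c * ln (real n) \<ge> c * L - \<mu> * L"
        proof -
          have "c * ((1 - \<tau>) * L) \<le> c * ln (real n)" using lnn2 c by (intro mult_left_mono) auto
          moreover have "c * ((1 - \<tau>) * L) = c * L - (c * \<tau>) * L" by (simp add: algebra_simps)
          moreover have "(c * \<tau>) * L \<le> \<mu> * L" using c\<tau> L by (intro mult_right_mono) auto
          ultimately show ?thesis by linarith
        qed
        ultimately have "ln (real (u_binom n k)) \<le> c * ln (real n)" using X H by (simp add: field_simps)
        moreover have "ln (real (u_binom n k)) > c * ln (real n)" using k(2) n0 by (simp add: u_binom_gt_iff)
        ultimately show False by linarith
      qed
    qed
  qed
qed

section \<open>From exceptional events to the first crossing and density one\<close>

lemma f_min_cases: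
  assumes "f_min c n \<noteq> \<infinity>"
  obtains k where "f_min c n = enat k" "k \<le> n" "exceeds c n k"
proof -
  define Q where "Q = (\<lambda>k. k \<le> n \<and> exceeds c n k)"
  have ex: "\<exists>k. Q k" using assms unfolding f_min_def Q_def by (auto split: if_splits)
  have "f_min c n = enat (LEAST k. Q k)" using ex unfolding f_min_def Q_def by auto
  moreover have "Q (LEAST k. Q k)" using ex by (rule LeastI_ex)
  ultimately show ?thesis using that unfolding Q_def by blast
qed

lemma f_min_le:
  assumes "k \<le> n" "exceeds c n k"
  obtains m where "f_min c n = enat m" "m \<le> k"
proof -
  have "f_min c n = enat (LEAST k. k \<le> n \<and> exceeds c n k)"
    using assms unfolding f_min_def by auto
  moreover have "(LEAST k. k \<le> n \<and> exceeds c n k) \<le> k"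
    using assms by (intro Least_le) auto
  ultimately show ?thesis using that by blast
qed

lemma E_exc_density:
  assumes c: "c > 0" and \<eta>: "\<eta> > 0"
  shows "(\<lambda>N. real (card (E_exc c \<eta> N)) / real N) \<longlonglongrightarrow> 0"
proof -
  define \<kappa> where "\<kappa> = c / (1 - euler_mascheroni)"
  have \<kappa>: "\<kappa> > 0" using c one_minus_euler_pos by (simp add: \<kappa>_def)
  \<comment> \<open>The lower estimate requires a tolerance below \<open>\<kappa>\<close>; shrinking
    it only strengthens the conclusion.\<close>
  define \<eta>' where "\<eta>' = min \<eta> (\<kappa> / 2)"
  have \<eta>': "\<eta>' > 0" "\<eta>' < \<kappa>" "\<eta>' \<le> \<eta>" using \<eta> \<kappa> by (auto simp: \<eta>'_def)
  define B where "B = (\<lambda>(N::nat) (n::nat). \<not> (\<exists>k\<le>n. exceeds c n k \<and> real k \<le> (\<kappa> + \<eta>) * ln (real n))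
     \<or> (\<exists>k\<le>n. exceeds c n k \<and> real k < (\<kappa> - \<eta>') * ln (real n)))"
  have "negligible_events B" unfolding B_def \<kappa>_def
    by (intro negligible_events_disj negligible_events_upper negligible_events_lower c \<eta>) (use \<eta>' in \<open>auto simp: \<kappa>_def\<close>)
  hence lim: "(\<lambda>N. real (card {n\<in>{..<N}. B N n}) / real N) \<longlonglongrightarrow> 0" by (simp add: negligible_events_def)
  \<comment> \<open>\<open>E_exc\<close> includes \<open>n = N\<close>, whereas events are counted
    for \<open>n < N\<close>; the extra point contributes 1 / N.\<close>
  have sub: "E_exc c \<eta> N \<subseteq> insert N {n\<in>{..<N}. B N n}" for N
  proof
    fix n assume n: "n \<in> E_exc c \<eta> N"
    hence n2: "2 \<le> n" "n \<le> N" by (auto simp: E_exc_def)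
    have ln0: "ln (real n) > 0" using n2 by simp
    have "B N n"
    proof (rule ccontr)
      assume nB: "\<not> B N n"
      then obtain k where k: "k \<le> n" "exceeds c n k" "real k \<le> (\<kappa> + \<eta>) * ln (real n)"
        unfolding B_def by blast
      obtain m where m: "f_min c n = enat m" "m \<le> k" using f_min_le[OF k(1,2)] .
      have "f_min c n \<noteq> \<infinity>" using m by simp
      then obtain m' where m': "f_min c n = enat m'" "m' \<le> n" "exceeds c n m'"
        by (rule f_min_cases)
      have mm: "m' = m" using m m' by simp
      have "\<not> real m < (\<kappa> - \<eta>') * ln (real n)" using nB m' mm unfolding B_def by blast
      hence "(\<kappa> - \<eta>') * ln (real n) \<le> real m" by simp
      hence "\<kappa> - \<eta>' \<le> real m / ln (real n)" using ln0 by (simp add: field_simps)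
      moreover have "real m \<le> (\<kappa> + \<eta>) * ln (real n)" using m k by linarith
      hence "real m / ln (real n) \<le> \<kappa> + \<eta>" using ln0 by (simp add: field_simps)
      ultimately have "\<bar>real m / ln (real n) - \<kappa>\<bar> \<le> \<eta>" using \<eta>' by (simp add: abs_le_iff)
      thus False using n m by (simp add: E_exc_def \<kappa>_def)
    qed
    thus "n \<in> insert N {n\<in>{..<N}. B N n}" using n2 by auto
  qed
  have "card (E_exc c \<eta> N) \<le> card {n\<in>{..<N}. B N n} + 1" for N
    using card_mono[OF _ sub[of N]] card_insert_le_m1 by (simp add: card_insert_if)
  hence "real (card (E_exc c \<eta> N)) \<le> real (card {n\<in>{..<N}. B N n}) + 1" for N
    by (metis of_nat_1 of_nat_add of_nat_le_iff)
  hence le: "real (card (E_exc c \<eta> N)) / real N \<le> real (card {n\<in>{..<N}. B N n}) / real N + 1 / real N" for N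
    by (simp add: divide_right_mono flip: add_divide_distrib)
  have "(\<lambda>N. real (card {n\<in>{..<N}. B N n}) / real N + 1 / real N) \<longlonglongrightarrow> 0 + 0"
    by (intro tendsto_add lim) real_asymp
  hence lim': "(\<lambda>N. real (card {n\<in>{..<N}. B N n}) / real N + 1 / real N) \<longlonglongrightarrow> 0" by simp
  show ?thesis
    by (rule tendsto_sandwich[OF _ _ tendsto_const lim']) (use le in auto)
qed

text \<open>Lets a family of eventual statements hold along a slowly growing index:
  \<open>m N\<close> is the largest \<open>i\<close> whose start times, and those of all smaller
  indices, have passed by \<open>N\<close>. Here it turns density zero for every fixed tolerance
  into a single error sequence.\<close>

lemma diagonal_sequence:
  fixes Q :: "nat \<Rightarrow> nat \<Rightarrow> bool"
  assumes "\<And>i. eventually (Q i) sequentially"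
  obtains m :: "nat \<Rightarrow> nat" where "mono m" "filterlim m at_top sequentially" "eventually (\<lambda>N. Q (m N) N) sequentially"
proof -
  obtain T where T: "\<And>i N. N \<ge> T i \<Longrightarrow> Q i N" using assms unfolding eventually_sequentially by metis
  \<comment> \<open>The conditions only become weaker as \<open>N\<close> grows, which makes
    \<open>m\<close> monotone. The union with \<open>{0}\<close> keeps the maximum defined before
    \<open>T 0\<close>; the bound \<open>i <= N\<close> keeps the set finite.\<close>
  define A where "A = (\<lambda>N. {i. i \<le> N \<and> (\<forall>j\<le>i. T j \<le> N)} \<union> {0})"
  define m where "m = (\<lambda>N. Max (A N))"
  have fin: "finite (A N)" for N by (simp add: A_def)
  have mem: "m N \<in> A N" for N unfolding m_def by (rule Max_in) (auto simp: fin, simp add: A_def)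
  have "mono m"
  proof (rule monoI)
    fix M N :: nat assume "M \<le> N"
    hence "A M \<subseteq> A N" by (auto simp: A_def intro: le_trans)
    thus "m M \<le> m N" unfolding m_def using fin mem by (intro Max_mono) auto
  qed
  moreover have "filterlim m at_top sequentially"
    unfolding filterlim_at_top
  proof
    fix Z
    define N0 where "N0 = Z + (\<Sum>j\<le>Z. T j)"
    have "Z \<le> m N" if "N \<ge> N0" for N
    proof -
      have "T j \<le> N" if "j \<le> Z" for j
      proof -
        have "T j \<le> (\<Sum>j\<le>Z. T j)" using that by (intro member_le_sum) auto
        thus ?thesis using \<open>N \<ge> N0\<close> by (simp add: N0_def)
      qed
      hence "Z \<in> A N" using that by (simp add: A_def N0_def)
      thus ?thesis unfolding m_def using fin by (intro Max_ge) auto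
    qed
    thus "eventually (\<lambda>N. Z \<le> m N) sequentially" unfolding eventually_sequentially by blast
  qed
  moreover have "eventually (\<lambda>N. Q (m N) N) sequentially"
    using eventually_ge_at_top[of "T 0"]
  proof eventually_elim
    case (elim N)
    have "T (m N) \<le> N" using mem[of N] elim unfolding A_def by auto
    thus ?case by (rule T)
  qed
  ultimately show ?thesis by (rule that)
qed

theorem theorem1p1:
  fixes c :: real
  assumes "c > 0"
  shows "(\<forall>\<eta>>0. (\<lambda>N. real (card (E_exc c \<eta> N)) / real N) \<longlonglongrightarrow> 0) \<and>
    (\<exists>\<epsilon> :: nat \<Rightarrow> real. \<epsilon> \<longlonglongrightarrow> 0 \<and>
      almost_all_pos (\<lambda>n. f_min c n < \<infinity> \<and>
        real (the_enat (f_min c n)) = (c / (1 - euler_mascheroni) + \<epsilon> n) * ln (real n)))"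
proof (rule conjI)
  show dens: "\<forall>\<eta>>0. (\<lambda>N. real (card (E_exc c \<eta> N)) / real N) \<longlonglongrightarrow> 0"
    using E_exc_density[OF assms] by blast
  define \<kappa> where "\<kappa> = c / (1 - euler_mascheroni)"
  \<comment> \<open>The same number serves as tolerance and as bound for the proportion of
    exceptions.\<close>
  define r where "r = (\<lambda>i::nat. 1 / real (Suc i))"
  have r: "r i > 0" for i by (simp add: r_def)
  have "eventually (\<lambda>N. real (card (E_exc c (r i) N)) / real N < r i) sequentially" for i
    using dens r[of i] by (intro order_tendstoD) auto
  then obtain m where m: "mono m" "filterlim m at_top sequentially"
    "eventually (\<lambda>N. real (card (E_exc c (r (m N)) N)) / real N < r (m N)) sequentially"
    by (rule diagonal_sequence)
  have rm: "(\<lambda>N. r (m N)) \<longlonglongrightarrow> 0"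
    by (rule filterlim_compose[OF _ m(2)]) (unfold r_def, real_asymp)
  define good where "good = (\<lambda>n. n \<ge> 2 \<and> n \<notin> E_exc c (r (m n)) n)"
  \<comment> \<open>On good \<open>n\<close> this makes the required equation exact; the value 0
    elsewhere keeps the sequence tending to 0.\<close>
  define \<epsilon> where "\<epsilon> = (\<lambda>n. if good n then real (the_enat (f_min c n)) / ln (real n) - \<kappa> else 0)"
  have good_D: "f_min c n < \<infinity>" "\<bar>real (the_enat (f_min c n)) / ln (real n) - \<kappa>\<bar> \<le> r (m n)" if "good n" for n
    using that unfolding good_def E_exc_def \<kappa>_def by (auto simp: not_less)
  have "norm (\<epsilon> n) \<le> r (m n)" for n
    using good_D(2)[of n] r[of "m n"] by (auto simp: \<epsilon>_def)
  hence "\<epsilon> \<longlonglongrightarrow> 0" by (intro Lim_null_comparison[OF always_eventually rm]) auto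
  moreover have "almost_all_pos (\<lambda>n. f_min c n < \<infinity> \<and> real (the_enat (f_min c n)) = (\<kappa> + \<epsilon> n) * ln (real n))"
    (is "almost_all_pos ?Q") unfolding almost_all_pos_def
  proof (rule tendsto_sandwich)
    have Q: "?Q n" if "good n" for n
    proof -
      have "ln (real n) > 0" using that by (simp add: good_def)
      thus ?thesis using that good_D(1)[OF that] by (simp add: \<epsilon>_def)
    qed
    \<comment> \<open>Each bad \<open>n\<close> is exceptional for its own tolerance
      \<open>r (m n)\<close>. As \<open>m\<close> is monotone, \<open>r (m N)\<close> is smaller, so
      one set at \<open>N\<close> contains all bad \<open>n\<close> up to \<open>N\<close>. The
      point 1 is added because \<open>E_exc\<close> starts at 2.\<close>
    have bad: "n \<in> insert 1 (E_exc c (r (m N)) N)" if n: "n \<in> {1..N}" "\<not> ?Q n" for n N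
    proof (cases "n = 1")
      case False
      hence n2: "n \<ge> 2" "n \<le> N" using n by auto
      have "\<not> good n" using Q n by blast
      hence nE: "n \<in> E_exc c (r (m n)) n" using n2 by (simp add: good_def)
      have "m n \<le> m N" using m(1) n2 by (auto dest: monoD)
      hence "r (m N) \<le> r (m n)" by (simp add: r_def frac_le)
      hence "n \<in> E_exc c (r (m N)) N" using nE n2 unfolding E_exc_def by auto
      thus ?thesis by simp
    qed simp
    show "eventually (\<lambda>N. 1 - 1 / real N - r (m N) \<le> real (card {n \<in> {1..N}. ?Q n}) / real N) sequentially"
      using m(3) eventually_gt_at_top[of 0]
    proof eventually_elim
      case (elim N)
      have finE: "finite (E_exc c (r (m N)) N)" by (simp add: E_exc_def)
      have "{1..N} \<subseteq> {n \<in> {1..N}. ?Q n} \<union> insert 1 (E_exc c (r (m N)) N)" using bad by blast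
      hence "card {1..N} \<le> card ({n \<in> {1..N}. ?Q n} \<union> insert 1 (E_exc c (r (m N)) N))"
        using finE by (intro card_mono) auto
      also have "\<dots> \<le> card {n \<in> {1..N}. ?Q n} + card (insert 1 (E_exc c (r (m N)) N))" by (rule card_Un_le)
      also have "card (insert 1 (E_exc c (r (m N)) N)) \<le> card (E_exc c (r (m N)) N) + 1"
        using finE by (simp add: card_insert_if)
      finally have "real N \<le> real (card {n \<in> {1..N}. ?Q n}) + (real (card (E_exc c (r (m N)) N)) + 1)" by simp
      moreover have "real (card (E_exc c (r (m N)) N)) \<le> r (m N) * real N" using elim by (simp add: field_simps)
      ultimately have "real N - 1 - r (m N) * real N \<le> real (card {n \<in> {1..N}. ?Q n})" by linarith
      hence "(real N - 1 - r (m N) * real N) / real N \<le> real (card {n \<in> {1..N}. ?Q n}) / real N" by (rule divide_right_mono) simp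
      moreover have "(real N - 1 - r (m N) * real N) / real N = 1 - 1 / real N - r (m N)" using elim by (simp add: diff_divide_distrib)
      ultimately show ?case by simp
    qed
    show "eventually (\<lambda>N. real (card {n \<in> {1..N}. ?Q n}) / real N \<le> 1) sequentially"
      using eventually_gt_at_top[of 0]
    proof eventually_elim
      case (elim N)
      have "card {n \<in> {1..N}. ?Q n} \<le> card {1..N}" by (intro card_mono) auto
      thus ?case using elim by simp
    qed
    have "(\<lambda>N. 1 - 1 / real N - r (m N)) \<longlonglongrightarrow> 1 - 0 - 0"
      by (intro tendsto_diff tendsto_const rm) real_asymp
    thus "(\<lambda>N. 1 - 1 / real N - r (m N)) \<longlonglongrightarrow> 1" by simp
  qed simp
  ultimately show "\<exists>\<epsilon> :: nat \<Rightarrow> real. \<epsilon> \<longlonglongrightarrow> 0 \<and>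
      almost_all_pos (\<lambda>n. f_min c n < \<infinity> \<and>
        real (the_enat (f_min c n)) = (c / (1 - euler_mascheroni) + \<epsilon> n) * ln (real n))"
    unfolding \<kappa>_def by blast
qed

end
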